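(* Consider the (ON/OFF-BMAP)/D/1/$K$ queue described in the context, and suppose: $\lambda>1$; there is a nonnegative random variable $Y\in\mathcal{S}$ with $\sum_{l=k+1}^\infty\boldsymbol{\alpha}(l)=O(\mathbb{P}(Y>k))$ and $\sum_{l=k+1}^\infty\boldsymbol{\Lambda}(l)=O(\mathbb{P}(Y>k))$ (entrywise); $\mathbb{E}[A]<\mathbb{E}[I^{\rm off}]$; and for every $m\in\mathbb{Z}$, $I_m^{\rm on}$ is independent of the $m$th BMAP $\{(N_{m,n},J_{m,n});n\ge0\}$. Further suppose (i) $I^{\rm on}\in\mathcal{L}^{1/\theta}$ for some $0<\theta\le1/2$; (ii) $\mathbb{E}[I^{\rm on}]<\infty$ and $I^{\rm on}_{\rm e}\in\mathcal{S}$; and (iii) $\mathbb{E}[\exp\{Q(Y)\}]<\infty$ for some $Q\in\mathcal{SC}$ with $x^{\theta}=O(Q(x))$. Then $$P_{\rm loss}^{(K)}\sim\frac{(\lambda-1)\mathbb{E}[I^{\rm on}]}{\mathbb{E}[A]+\mathbb{E}[I^{\rm on}]}\,\mathbb{P}\big(I^{\rm on}_{\rm e}>K/(\lambda-1)\big)\quad(K\to\infty).$$ If in addition $\boldsymbol{\alpha}(k)=\boldsymbol{\phi}\boldsymbol{\Lambda}(k)$ for $k\ge1$, then $P_{\rm loss}^{(K)}\sim\frac{\lambda-1}{\lambda}\mathbb{P}(I^{\rm on}_{\rm e}>K/(\lambda-1))$.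
   Context: Discrete time, slots $[n,n+1]$. ON/OFF-BMAP: on- and off-periods alternate, indexed by $m\in\mathbb{Z}$; no arrivals in off-slots. For each $m$, the $m$th BMAP is $\{(N_{m,n},J_{m,n});n\ge0\}$, with $N_{m,n}$ the number of arrivals in the $n$th slot of the $m$th on-period and $J_{m,n}\in\mathbb{D}=\{0,\dots,d-1\}$, $\mathbb{P}(N_{m,0}=k,J_{m,0}=i)=\alpha_i(k)$ and $\mathbb{P}(N_{m,n}=k,J_{m,n}=j\mid J_{m,n-1}=i,\text{past})=\Lambda_{i,j}(k)$ ($k\ge1$, $n\ge1$); $\sum_k\boldsymbol{\alpha}(k)$ a probability vector, $\sum_k\boldsymbol{\Lambda}(k)$ irreducible stochastic with stationary vector $\boldsymbol{\phi}$, $\lambda=\boldsymbol{\phi}\sum_kk\boldsymbol{\Lambda}(k)\mathbf{e}$. $I_m^{\rm on}\ge1$ is the $m$th on-period length; the tuples $\{I_m^{\rm on},(N_{m,n},J_{m,n})_{0\le n<I_m^{\rm on}}\}$ are i.i.d. over $m$; off-period lengths $I_m^{\rm off}$ are i.i.d. (independent of on-period data). $A_m=\sum_{n=0}^{I_m^{\rm on}-1}(N_{m,n}-1)$. Queue with capacity $K$, unit service times: $L_{m+1}^{(K)}=(\min(L_m^{(K)}+A_{m+1},K)-I_{m+1}^{\rm off})^+$; $P_{\rm loss}^{(K)}=\mathbb{E}[(L_{m-1}^{(K)}+A_m-K)^+]/\mathbb{E}[A_m+I_m^{\rm on}]$ in stationarity. $A,I^{\rm on},I^{\rm off}$ generic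 copies; equilibrium r.v. $X_{\rm e}$: $\mathbb{P}(X_{\rm e}\le x)=\frac1{\mathbb{E}X}\int_0^x\mathbb{P}(X>y)dy$. Classes: $\mathcal{S}$: positive tail, $\mathbb{P}(X_1+X_2>x)\sim2\mathbb{P}(X>x)$ for independent copies. $\mathcal{L}$: positive tail, $\mathbb{P}(Z>x+y)\sim\mathbb{P}(Z>x)$ for some (all) $y>0$; $X\in\mathcal{L}^p$ iff $X^{1/p}\in\mathcal{L}$. $\mathcal{SC}$: $Q_X=-\log\mathbb{P}(X>\cdot)$ eventually concave, $Q_X(x)/\log x\to\infty$, $Q_X(x)/x^\alpha$ nonincreasing for $x\ge x_0$ for some $\alpha\in(0,1)$; "$Q\in\mathcal{SC}$" means $Q$ is such a cumulative hazard function. *)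

theory Defs
  imports "HOL-Probability.Probability" "HOL-Library.Landau_Symbols"
begin

definition pos_tail :: "(real \<Rightarrow> real) \<Rightarrow> bool" where
  "pos_tail T \<longleftrightarrow> (\<forall>x. 0 < T x)"

definition long_tailed :: "(real \<Rightarrow> real) \<Rightarrow> bool" where
  "long_tailed T \<longleftrightarrow> pos_tail T \<and> (\<forall>y>0. (\<lambda>x. T (x + y)) \<sim>[at_top] T)"

definition in_L_pow :: "'a measure \<Rightarrow> ('a \<Rightarrow> real) \<Rightarrow> real \<Rightarrow> bool" where
  "in_L_pow M X p \<longleftrightarrow>
     long_tailed (\<lambda>x. measure M {\<omega> \<in> space M. x < X \<omega> powr (1 / p)})"

definition subexponential :: "real measure \<Rightarrow> bool" where
  "subexponential \<mu> \<longleftrightarrow> pos_tail (\<lambda>x. measure \<mu> {x<..}) \<and>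
     ((\<lambda>x. measure (\<mu> \<star> \<mu>) {x<..}) \<sim>[at_top] (\<lambda>x. 2 * measure \<mu> {x<..}))"

definition SC :: "(real \<Rightarrow> real) \<Rightarrow> bool" where
  "SC Q \<longleftrightarrow>
     (\<exists>\<mu>::real measure. prob_space \<mu> \<and> sets \<mu> = sets borel \<and>
        (\<forall>x. Q x = - ln (measure \<mu> {x<..}))) \<and>
     (\<exists>x0. concave_on {x0..} Q) \<and>
     filterlim (\<lambda>x. Q x / ln x) at_top at_top \<and>
     (\<exists>\<alpha> x0. 0 < \<alpha> \<and> \<alpha> < 1 \<and> 0 < x0 \<and>
        (\<forall>x y. x0 \<le> x \<longrightarrow> x \<le> y \<longrightarrow> Q y / y powr \<alpha> \<le> Q x / x powr \<alpha>))"

definition equilibrium :: "'a measure \<Rightarrow> ('a \<Rightarrow> real) \<Rightarrow> real measure" where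
  "equilibrium M X = density lborel (\<lambda>y. ennreal (indicator {0..} y *
      measure M {\<omega> \<in> space M. y < X \<omega>} / (\<integral>\<omega>. X \<omega> \<partial>M)))"

text \<open>Independence of two random variables X (values in Ma) and Y (values in Mb)
  on the probability space M (the library's indep_var requires equal codomain types).\<close>
definition indep2 :: "'a measure \<Rightarrow> 'b measure \<Rightarrow> ('a \<Rightarrow> 'b) \<Rightarrow> 'c measure \<Rightarrow> ('a \<Rightarrow> 'c) \<Rightarrow> bool" where
  "indep2 M Ma X Mb Y \<longleftrightarrow> X \<in> measurable M Ma \<and> Y \<in> measurable M Mb \<and>
     (\<forall>A\<in>sets Ma. \<forall>B\<in>sets Mb.
        measure M (X -` A \<inter> Y -` B \<inter> space M) =
        measure M (X -` A \<inter> space M) * measure M (Y -` B \<inter> space M))"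

text \<open>Parameters: alpha k i = alpha_i(k), Lambda k i j = Lambda_{i,j}(k), phases 0..d-1,
  batch sizes k >= 1 (entries with k = 0 or phase index >= d are 0 by convention).\<close>
definition bmap_params :: "nat \<Rightarrow> (nat \<Rightarrow> nat \<Rightarrow> real) \<Rightarrow> (nat \<Rightarrow> nat \<Rightarrow> nat \<Rightarrow> real) \<Rightarrow> bool" where
  "bmap_params d \<alpha> \<Lambda> \<longleftrightarrow> 0 < d \<and>
     (\<forall>k i. 0 \<le> \<alpha> k i) \<and> (\<forall>k i. (k = 0 \<or> d \<le> i) \<longrightarrow> \<alpha> k i = 0) \<and>
     (\<forall>k i j. 0 \<le> \<Lambda> k i j) \<and> (\<forall>k i j. (k = 0 \<or> d \<le> i \<or> d \<le> j) \<longrightarrow> \<Lambda> k i j = 0) \<and>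
     (\<forall>i. summable (\<lambda>k. \<alpha> k i)) \<and> (\<Sum>i<d. \<Sum>k. \<alpha> k i) = 1 \<and>
     (\<forall>i j. summable (\<lambda>k. \<Lambda> k i j)) \<and> (\<forall>i<d. (\<Sum>j<d. \<Sum>k. \<Lambda> k i j) = 1)"

definition bmap_trans :: "(nat \<Rightarrow> nat \<Rightarrow> nat \<Rightarrow> real) \<Rightarrow> nat \<Rightarrow> nat \<Rightarrow> real" where
  "bmap_trans \<Lambda> i j = (\<Sum>k. \<Lambda> k i j)"

definition irreducible_mat :: "nat \<Rightarrow> (nat \<Rightarrow> nat \<Rightarrow> real) \<Rightarrow> bool" where
  "irreducible_mat d P \<longleftrightarrow>
     (\<forall>i<d. \<forall>j<d. (i, j) \<in> {(a, b). a < d \<and> b < d \<and> 0 < P a b}\<^sup>+)"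

definition stationary_vec :: "nat \<Rightarrow> (nat \<Rightarrow> nat \<Rightarrow> real) \<Rightarrow> (nat \<Rightarrow> real) \<Rightarrow> bool" where
  "stationary_vec d P \<phi> \<longleftrightarrow> (\<forall>i<d. 0 \<le> \<phi> i) \<and> (\<Sum>i<d. \<phi> i) = 1 \<and>
     (\<forall>j<d. (\<Sum>i<d. \<phi> i * P i j) = \<phi> j)"

definition bmap_rate :: "nat \<Rightarrow> (nat \<Rightarrow> nat \<Rightarrow> nat \<Rightarrow> real) \<Rightarrow> (nat \<Rightarrow> real) \<Rightarrow> real" where
  "bmap_rate d \<Lambda> \<phi> = (\<Sum>i<d. \<phi> i * (\<Sum>j<d. \<Sum>k. real k * \<Lambda> k i j))"

definition is_bmap :: "'a measure \<Rightarrow> (nat \<Rightarrow> 'a \<Rightarrow> nat) \<Rightarrow> (nat \<Rightarrow> 'a \<Rightarrow> nat) \<Rightarrow>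
    (nat \<Rightarrow> nat \<Rightarrow> real) \<Rightarrow> (nat \<Rightarrow> nat \<Rightarrow> nat \<Rightarrow> real) \<Rightarrow> bool" where
  "is_bmap M N J \<alpha> \<Lambda> \<longleftrightarrow>
     (\<forall>n. N n \<in> measurable M (count_space UNIV) \<and> J n \<in> measurable M (count_space UNIV)) \<and>
     (\<forall>n ks js. measure M {\<omega> \<in> space M. \<forall>l\<le>n. N l \<omega> = ks l \<and> J l \<omega> = js l} =
         \<alpha> (ks 0) (js 0) * (\<Prod>l\<in>{1..n}. \<Lambda> (ks l) (js (l - 1)) (js l)))"

text \<open>A = sum_{n < I_on} (N_n - 1) (N_n >= 1, so A is a natural number).\<close>
definition arrivals_excess :: "('a \<Rightarrow> nat) \<Rightarrow> (nat \<Rightarrow> 'a \<Rightarrow> nat) \<Rightarrow> 'a \<Rightarrow> nat" where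
  "arrivals_excess Ion N \<omega> = (\<Sum>n<Ion \<omega>. N n \<omega> - 1)"

text \<open>pi is a stationary distribution of the chain
  L' = (min(L + A, K) - I_off)^+ on {0..K}, where (A, I_off) is a generic copy
  (independent of L). Natural-number subtraction is the positive part.\<close>
definition queue_stationary :: "'a measure \<Rightarrow> ('a \<Rightarrow> nat) \<Rightarrow> ('a \<Rightarrow> nat) \<Rightarrow> nat \<Rightarrow> (nat \<Rightarrow> real) \<Rightarrow> bool" where
  "queue_stationary M A Ioff K \<pi> \<longleftrightarrow>
     (\<forall>l. 0 \<le> \<pi> l) \<and> (\<forall>l>K. \<pi> l = 0) \<and> (\<Sum>l\<le>K. \<pi> l) = 1 \<and>
     (\<forall>l'\<le>K. \<pi> l' = (\<Sum>l\<le>K. \<pi> l * measure M {\<omega> \<in> space M. min (l + A \<omega>) K - Ioff \<omega> = l'}))"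

text \<open>P_loss = E[(L + A - K)^+] / E[A + I_on], L stationary and independent of A.\<close>
definition loss_prob :: "'a measure \<Rightarrow> ('a \<Rightarrow> nat) \<Rightarrow> ('a \<Rightarrow> nat) \<Rightarrow> nat \<Rightarrow> (nat \<Rightarrow> real) \<Rightarrow> real" where
  "loss_prob M A Ion K \<pi> =
     (\<Sum>l\<le>K. \<pi> l * (\<integral>\<omega>. real (l + A \<omega> - K) \<partial>M)) / (\<integral>\<omega>. real (A \<omega> + Ion \<omega>) \<partial>M)"

end

theory Submission
  imports Defs "Jordan_Normal_Form.Determinant"
begin

text \<open>
  Write \<open>\<mu> = \<lambda> - 1\<close>, let \<open>S n\<close> be the net input of the first \<open>n\<close> on-slots, \<open>A = S Ion\<close>,
  \<open>H x = E (A - x)\<^sup>+\<close> and \<open>G x = E (\<mu> * Ion - x)\<^sup>+\<close>, which is a multiple of the equilibrium tail at \<open>x / \<mu>\<close>.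

  First, \<open>H\<close> and \<open>G\<close> are asymptotically equivalent. The lower bound is Jensen's inequality, as
  \<open>E (S n) \<ge> \<mu> * n - c\<close>. For the upper bound, the Poisson equation of the phase chain turns \<open>S n - \<mu> * n\<close> into
  a martingale up to a bounded term. Truncating batches at a level \<open>y \<ge> n\<close> and tilting by
  \<open>s = \<eta> * y powr (\<theta> - 1)\<close>, its exponential moment is at most \<open>exp (c * n * s\<^sup>2)\<close>, which is bounded because
  \<open>\<theta> \<le> 1/2\<close>. Hence deviations by \<open>u\<close> cost \<open>exp (- s * u)\<close>, while the long-tailedness of \<open>Ion powr \<theta>\<close> makes
  the tail of \<open>Ion\<close> gain less than any such factor when its argument is lowered by \<open>u\<close>.

  Secondly, the mean overflow \<open>E (L + A - K)\<^sup>+\<close> of the stationary finite queue is asymptotically \<open>H K\<close>.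
  A Lyapunov function whose slope climbs slowly from 0 at \<open>b\<close> to 1 at \<open>b + R\<close> bounds \<open>P (L > b + R)\<close>
  by a small multiple of \<open>P (L > b - R)\<close> plus a contribution of single jumps across \<open>b\<close>. This gives
  \<open>P (L > t) = O (H t)\<close> uniformly in \<open>K\<close>, and \<open>P (L > K - c) = o (H K)\<close>, as the jumps are cut off at \<open>K\<close>.
  Subexponentiality of the equilibrium distribution makes all the other contributions negligible.
\<close>

section \<open>Overflow of the stationary finite queue\<close>

text \<open>The length \<open>x powr (1 - \<theta>)\<close> rules the input side. It is the inverse
  of the tilt \<open>s\<close> up to a constant, it is at least of the order of the square-root
  fluctuations of \<open>S n\<close> because \<theta> \<le> 1/2, and it is the window over which the
  tail of \<open>Ion\<close> hardly changes. Fluctuations therefore cost about this length times a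
  tail, which is negligible against the integrated tail \<open>G x\<close>. On the queue side only a
  first moment of \<open>A\<close> is at hand and the mean off-period may be infinite. So the
  remainder of the Lyapunov argument is made small by dominated convergence in \<open>R\<close>
  instead of a second moment, and off-periods are cut at a level that keeps the drift negative. No
  infinite queue serves as a comparison: the balance equation of each finite queue is used directly,
  with constants free of \<open>K\<close>. The bound \<open>O (H t)\<close> alone would leave the
  states near \<open>K\<close> with a contribution of the same order as \<open>H K\<close>. There
  the counted part of a jump has bounded length, so that a plain tail \<open>H x - H (Suc x)\<close>
  replaces the integrated tail \<open>H x\<close>; this difference is \<open>o (H x)\<close> as
  \<open>H\<close> is long-tailed.\<close>

lemma ratio_tendsto_1_shift:
  fixes H :: "nat \<Rightarrow> real"
  assumes pos: "\<And>x. 0 < H x" and lt: "(\<lambda>x. H (Suc x) / H x) \<longlonglongrightarrow> 1"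
  shows "(\<lambda>x. H (x + k) / H x) \<longlonglongrightarrow> 1"
proof (induction k)
  case 0
  have "H x \<noteq> 0" for x using pos[of x] by simp
  then show ?case by simp
next
  case (Suc k)
  have "(\<lambda>x. H (Suc (x + k)) / H (x + k) * (H (x + k) / H x)) \<longlonglongrightarrow> 1 * 1"
    by (intro tendsto_mult Suc LIMSEQ_ignore_initial_segment[OF lt])
  moreover have "(\<lambda>x. H (Suc (x + k)) / H (x + k) * (H (x + k) / H x)) = (\<lambda>x. H (x + Suc k) / H x)"
  proof
    fix x
    show "H (Suc (x + k)) / H (x + k) * (H (x + k) / H x) = H (x + Suc k) / H x"
      using pos[of "x + k"] by simp
  qed
  ultimately show ?case by simp
qed

lemma ratio_tendsto_1_bound:
  fixes H :: "nat \<Rightarrow> real"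
  assumes pos: "\<And>x. 0 < H x" and lt: "(\<lambda>x. H (Suc x) / H x) \<longlonglongrightarrow> 1" and q: "1 < q"
  shows "\<exists>N. \<forall>x\<ge>N. H x \<le> q * H (x + k)"
proof -
  have "1 / q < 1" using q by simp
  from order_tendstoD(1)[OF ratio_tendsto_1_shift[OF pos lt, of k] this]
  obtain N where N: "\<And>x. x \<ge> N \<Longrightarrow> 1 / q < H (x + k) / H x"
    unfolding eventually_sequentially by blast
  show ?thesis
  proof (intro exI allI impI)
    fix x assume "N \<le> x"
    from N[OF this] show "H x \<le> q * H (x + k)" using pos[of x] q by (simp add: field_simps)
  qed
qed

section \<open>A Lyapunov function with slowly increasing slope\<close>

text \<open>This is the slope; the Lyapunov function itself is its discrete integral
  \<open>\<Sum>j<l. ramp b R j\<close>, which vanishes for \<open>l \<le> b\<close>, is convex, and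
  has slope 1 from \<open>b + R\<close> on. Truncated subtraction supplies the lower
  cut-off.\<close>

definition ramp :: "nat \<Rightarrow> nat \<Rightarrow> nat \<Rightarrow> real" where
  "ramp b R j = min 1 (real (j - b) / real R)"

lemma ramp_bounds: "0 \<le> ramp b R j" "ramp b R j \<le> 1"
  by (auto simp: ramp_def)

lemma ramp_eq_0: "j \<le> b \<Longrightarrow> ramp b R j = 0"
  by (auto simp: ramp_def)

lemma ramp_eq_1: "R > 0 \<Longrightarrow> b + R \<le> j \<Longrightarrow> ramp b R j = 1"
  by (auto simp: ramp_def min_def field_simps)

lemma ramp_le_add:
  assumes "R > 0"
  shows "ramp b R j \<le> ramp b R l + min 1 (real (j - l) / real R)"
proof -
  have "real (j - b) \<le> real (l - b) + real (j - l)" by linarith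
  then have "real (j - b) / R \<le> real (l - b) / R + real (j - l) / R"
    by (simp add: add_divide_distrib [symmetric] divide_right_mono)
  moreover have "0 \<le> real (l - b) / R" "0 \<le> real (j - l) / R" by auto
  ultimately show ?thesis unfolding ramp_def by linarith
qed

text \<open>A first-order expansion at \<open>l\<close> for the net step \<open>a - i\<close>: the
  slope is \<open>1 / R\<close>-Lipschitz with values in [0, 1], so along the step it differs from
  its value at \<open>l\<close> by at most \<open>min 1 (\<bar>a - i\<bar> / R)\<close>. The
  reflection at 0 is included through truncated subtraction.\<close>

lemma ramp_sum_le:
  assumes R: "R > 0"
  shows "(\<Sum>j<l + a - i. ramp b R j) \<le> (\<Sum>j<l. ramp b R j) + ramp b R l * (real a - real i)
           + \<bar>real a - real i\<bar> * min 1 (\<bar>real a - real i\<bar> / real R)"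
proof -
  let ?g = "ramp b R"
  consider "i \<le> a" | "a < i" "i - a \<le> l" | "a < i" "l < i - a" by linarith
  then show ?thesis
  proof cases
    case 1
    define x where "x = a - i"
    have x: "real a - real i = real x" "l + a - i = l + x" using 1 by (auto simp: x_def)
    have "(\<Sum>j<l + x. ?g j) = (\<Sum>j<l. ?g j) + (\<Sum>j\<in>{l..<l+x}. ?g j)"
      by (metis atLeast0LessThan le_add1 sum.atLeastLessThan_concat zero_le)
    also have "(\<Sum>j\<in>{l..<l+x}. ?g j) \<le> (\<Sum>j\<in>{l..<l+x}. ?g l + min 1 (real x / R))"
    proof (rule sum_mono)
      fix j assume j: "j \<in> {l..<l+x}"
      have "real (j - l) / R \<le> real x / R" using j by (intro divide_right_mono) auto
      then show "?g j \<le> ?g l + min 1 (real x / R)" using ramp_le_add[OF R, of b j l] by linarith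
    qed
    also have "\<dots> = ?g l * real x + real x * min 1 (real x / R)"
      by (simp add: algebra_simps)
    finally show ?thesis unfolding x by simp
  next
    case 2
    define y where "y = i - a"
    have y: "real a - real i = - real y" "l + a - i = l - y" "y \<le> l" using 2 by (auto simp: y_def)
    have "(\<Sum>j<l. ?g j) = (\<Sum>j<l - y. ?g j) + (\<Sum>j\<in>{l-y..<l}. ?g j)"
      by (metis atLeast0LessThan diff_le_self sum.atLeastLessThan_concat zero_le)
    moreover have "(\<Sum>j\<in>{l-y..<l}. ?g j) \<ge> (\<Sum>j\<in>{l-y..<l}. ?g l - min 1 (real y / R))"
    proof (rule sum_mono)
      fix j assume j: "j \<in> {l-y..<l}"
      have "real (l - j) / R \<le> real y / R" using j by (intro divide_right_mono) auto
      then show "?g l - min 1 (real y / R) \<le> ?g j" using ramp_le_add[OF R, of b l j] by linarith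
    qed
    moreover have "(\<Sum>j\<in>{l-y..<l}. ?g l - min 1 (real y / R)) = ?g l * real y - real y * min 1 (real y / R)"
      using y(3) by (simp add: algebra_simps)
    ultimately show ?thesis unfolding y by simp
  next
    case 3
    define y where "y = i - a"
    have y: "real a - real i = - real y" "l + a - i = 0" "l \<le> y" using 3 by (auto simp: y_def)
    \<comment> \<open>In the reflected case the linear term overstates the decrease. But the state
      \<open>l\<close> is smaller than the step \<open>y\<close>, so the slope at \<open>l\<close>
      is itself below the error slope and the remainder makes up for it.\<close>
    have "real (l - b) / R \<le> real y / R" using y(3) by (intro divide_right_mono) auto
    then have "?g l \<le> min 1 (real y / R)" unfolding ramp_def by linarith
    then have "?g l * real y \<le> real y * min 1 (real y / R)"
      by (metis mult.commute mult_left_mono of_nat_0_le_iff)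
    moreover have "0 \<le> (\<Sum>j<l. ?g j)" by (intro sum_nonneg ramp_bounds)
    ultimately show ?thesis unfolding y by simp
  qed
qed

text \<open>The mean remainder of the expansion in \<open>ramp_sum_le\<close> for a random net step
  \<open>X\<close>. The minimum with 1 keeps it finite, and vanishing as \<open>R\<close> grows,
  with a first moment only.\<close>

definition truncation_error :: "'a measure \<Rightarrow> ('a \<Rightarrow> real) \<Rightarrow> nat \<Rightarrow> real" where
  "truncation_error M X R = (\<integral>\<omega>. \<bar>X \<omega>\<bar> * min 1 (\<bar>X \<omega>\<bar> / real R) \<partial>M)"

lemma truncation_error_tendsto_0:
  assumes "integrable M X"
  shows "truncation_error M X \<longlonglongrightarrow> 0"
proof -
  have "(\<lambda>R. \<integral>\<omega>. \<bar>X \<omega>\<bar> * min 1 (\<bar>X \<omega>\<bar> / real R) \<partial>M) \<longlonglongrightarrow> (\<integral>\<omega>. 0 \<partial>M)"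
  proof (rule integral_dominated_convergence[where w = "\<lambda>\<omega>. \<bar>X \<omega>\<bar>"])
    show "AE \<omega> in M. (\<lambda>R. \<bar>X \<omega>\<bar> * min 1 (\<bar>X \<omega>\<bar> / real R)) \<longlonglongrightarrow> 0"
    proof (rule AE_I2)
      fix \<omega>
      have "(\<lambda>R. \<bar>X \<omega>\<bar> / real R) \<longlonglongrightarrow> 0" by real_asymp
      then have "(\<lambda>R. \<bar>X \<omega>\<bar> * min 1 (\<bar>X \<omega>\<bar> / real R)) \<longlonglongrightarrow> \<bar>X \<omega>\<bar> * min 1 0"
        by (intro tendsto_intros)
      then show "(\<lambda>R. \<bar>X \<omega>\<bar> * min 1 (\<bar>X \<omega>\<bar> / real R)) \<longlonglongrightarrow> 0" by simp
    qed
    show "AE \<omega> in M. norm (\<bar>X \<omega>\<bar> * min 1 (\<bar>X \<omega>\<bar> / real R)) \<le> \<bar>X \<omega>\<bar>" for R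
      by (auto intro!: AE_I2 mult_left_le simp: abs_mult)
  qed (use assms in auto)
  then show ?thesis by (simp add: truncation_error_def[abs_def])
qed

lemma (in prob_space) expectation_finite_range:
  fixes X :: "'a \<Rightarrow> nat" and g :: "nat \<Rightarrow> real"
  assumes X: "X \<in> measurable M (count_space UNIV)" and le: "\<And>\<omega>. \<omega> \<in> space M \<Longrightarrow> X \<omega> \<le> K"
  shows "(\<integral>\<omega>. g (X \<omega>) \<partial>M) = (\<Sum>l\<le>K. g l * measure M {\<omega> \<in> space M. X \<omega> = l})"
proof -
  have [measurable]: "X \<in> measurable M (count_space UNIV)" by fact
  have "(\<integral>\<omega>. g (X \<omega>) \<partial>M) = (\<integral>\<omega>. (\<Sum>l\<le>K. g l * indicator {\<omega> \<in> space M. X \<omega> = l} \<omega>) \<partial>M)"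
  proof (rule Bochner_Integration.integral_cong[OF refl])
    fix \<omega> assume w: "\<omega> \<in> space M"
    have "(\<Sum>l\<le>K. g l * indicator {\<omega> \<in> space M. X \<omega> = l} \<omega>) = (\<Sum>l\<in>{..K}. if l = X \<omega> then g l else 0)"
      using w by (intro sum.cong) (auto simp: indicator_def)
    also have "\<dots> = g (X \<omega>)" using le[OF w] by simp
    finally show "g (X \<omega>) = (\<Sum>l\<le>K. g l * indicator {\<omega> \<in> space M. X \<omega> = l} \<omega>)" by simp
  qed
  also have "\<dots> = (\<Sum>l\<le>K. (\<integral>\<omega>. g l * indicator {\<omega> \<in> space M. X \<omega> = l} \<omega> \<partial>M))"
    by (rule Bochner_Integration.integral_sum) (auto simp: less_top[symmetric])
  also have "\<dots> = (\<Sum>l\<le>K. g l * measure M {\<omega> \<in> space M. X \<omega> = l})"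
    by (intro sum.cong refl) (simp add: Int_absorb1)
  finally show ?thesis .
qed

lemma (in prob_space) stationary_expectation:
  fixes g :: "nat \<Rightarrow> real"
  assumes A[measurable]: "A \<in> measurable M (count_space UNIV)"
    and I[measurable]: "I \<in> measurable M (count_space UNIV)"
    and st: "queue_stationary M A I K p"
  shows "(\<Sum>l\<le>K. p l * (\<integral>\<omega>. g (min (l + A \<omega>) K - I \<omega>) \<partial>M)) = (\<Sum>l\<le>K. p l * g l)"
proof -
  have "(\<Sum>l\<le>K. p l * (\<integral>\<omega>. g (min (l + A \<omega>) K - I \<omega>) \<partial>M)) =
        (\<Sum>l\<le>K. p l * (\<Sum>l'\<le>K. g l' * measure M {\<omega> \<in> space M. min (l + A \<omega>) K - I \<omega> = l'}))"
    by (subst expectation_finite_range[where K = K]) auto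
  also have "\<dots> = (\<Sum>l'\<le>K. g l' * (\<Sum>l\<le>K. p l * measure M {\<omega> \<in> space M. min (l + A \<omega>) K - I \<omega> = l'}))"
    unfolding sum_distrib_left by (subst sum.swap) (simp add: algebra_simps)
  also have "\<dots> = (\<Sum>l'\<le>K. g l' * p l')"
    using st by (intro sum.cong refl) (auto simp: queue_stationary_def)
  finally show ?thesis by (simp add: mult.commute)
qed

text \<open>In stationarity the Lyapunov function has mean increment 0. From states above
  \<open>b - R\<close> the increment is at most the drift times the slope plus the remainder; from
  lower states, where the function is 0, it is at most the overshoot of \<open>b\<close> by one
  jump. The negative drift is collected in full above \<open>b + R\<close>. The cap \<open>K\<close>
  is kept in the overshoot, which matters when \<open>b\<close> is close to
  \<open>K\<close>.\<close>

lemma (in prob_space) queue_drift_inequality: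
  fixes A I :: "'a \<Rightarrow> nat"
  assumes A[measurable]: "A \<in> measurable M (count_space UNIV)"
    and I[measurable]: "I \<in> measurable M (count_space UNIV)"
    and intA: "integrable M (\<lambda>\<omega>. real (A \<omega>))"
    and st: "queue_stationary M A I K p"
    and R: "R > 0" "R \<le> b"
    and \<delta>_def: "\<delta> = - (\<integral>\<omega>. real (A \<omega>) - real (min (I \<omega>) m) \<partial>M)" and \<delta>: "\<delta> \<ge> 0"
  shows "\<delta> * (\<Sum>l\<in>{b+R<..K}. p l) \<le>
     truncation_error M (\<lambda>\<omega>. real (A \<omega>) - real (min (I \<omega>) m)) R * (\<Sum>l\<in>{b-R<..K}. p l)
     + (\<Sum>l\<in>{..K} \<inter> {..b-R}. p l * (\<integral>\<omega>. real (min (l + A \<omega>) K - b) \<partial>M))"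
proof -
  let ?X = "\<lambda>\<omega>. real (A \<omega>) - real (min (I \<omega>) m)"
  let ?e = "truncation_error M ?X R"
  let ?r = "ramp b R"
  let ?g = "\<lambda>l. \<Sum>j<l. ?r j"
  let ?h = "\<lambda>l. if l \<le> b - R then (\<integral>\<omega>. real (min (l + A \<omega>) K - b) \<partial>M) else ?e"
  have p: "0 \<le> p l" for l using st by (auto simp: queue_stationary_def)
  have intI: "integrable M (\<lambda>\<omega>. real (min (I \<omega>) m))"
    by (rule integrable_const_bound[where B = m]) auto
  have intX: "integrable M ?X" using intA intI by simp
  have intE: "integrable M (\<lambda>\<omega>. \<bar>?X \<omega>\<bar> * min 1 (\<bar>?X \<omega>\<bar> / real R))"
    by (rule Bochner_Integration.integrable_bound[OF integrable_abs[OF intX]])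
       (auto intro!: AE_I2 mult_left_le simp: abs_mult)
  have g_mono: "?g i \<le> ?g j" if "i \<le> j" for i j
    using that by (intro sum_mono2) (auto simp: ramp_bounds)
  have g_le: "?g l \<le> real (l - b)" for l
  proof -
    have "?g l \<le> (\<Sum>j<l. if j < b then 0 else 1)"
      by (intro sum_mono) (auto simp: ramp_bounds ramp_eq_0)
    also have "\<dots> = (\<Sum>j\<in>{b..<l}. 1)"
      by (intro sum.mono_neutral_cong_right) auto
    finally show ?thesis by simp
  qed
  have g_int: "integrable M (\<lambda>\<omega>. ?g (min (l + A \<omega>) K - I \<omega>))" for l
    by (rule integrable_const_bound[where B = "?g K"])
       (auto intro!: AE_I2 g_mono simp: abs_of_nonneg sum_nonneg ramp_bounds)
  have step: "(\<integral>\<omega>. ?g (min (l + A \<omega>) K - I \<omega>) \<partial>M) \<le> ?g l - \<delta> * ?r l + ?h l" if "l \<le> K" for l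
  proof (cases "l \<le> b - R")
    case True
    then have g0: "?g l = 0" "?r l = 0" by (auto intro!: sum.neutral simp: ramp_eq_0)
    \<comment> \<open>From a low state the departures are ignored and the slope is bounded by
      1.\<close>
    have "(\<integral>\<omega>. ?g (min (l + A \<omega>) K - I \<omega>) \<partial>M) \<le> (\<integral>\<omega>. real (min (l + A \<omega>) K - b) \<partial>M)"
    proof (rule integral_mono[OF g_int])
      show "integrable M (\<lambda>\<omega>. real (min (l + A \<omega>) K - b))"
        by (rule integrable_const_bound[where B = K]) auto
      show "?g (min (l + A \<omega>) K - I \<omega>) \<le> real (min (l + A \<omega>) K - b)" for \<omega>
        using g_le[of "min (l + A \<omega>) K"] g_mono[of "min (l + A \<omega>) K - I \<omega>" "min (l + A \<omega>) K"]
        by (meson diff_le_self order_trans)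
    qed
    with True g0 show ?thesis by simp
  next
    case False
    have "(\<integral>\<omega>. ?g (min (l + A \<omega>) K - I \<omega>) \<partial>M) \<le>
          (\<integral>\<omega>. ?g l + ?r l * ?X \<omega> + \<bar>?X \<omega>\<bar> * min 1 (\<bar>?X \<omega>\<bar> / real R) \<partial>M)"
    proof (rule integral_mono[OF g_int])
      show "integrable M (\<lambda>\<omega>. ?g l + ?r l * ?X \<omega> + \<bar>?X \<omega>\<bar> * min 1 (\<bar>?X \<omega>\<bar> / real R))"
        using intX intE by simp
      fix \<omega>
      \<comment> \<open>Dropping the cap and shortening the off-period only raises the next state,
        and the Lyapunov function is monotone.\<close>
      have "min (l + A \<omega>) K - I \<omega> \<le> l + A \<omega> - min (I \<omega>) m" by linarith
      from order_trans[OF g_mono[OF this] ramp_sum_le[OF R(1)]]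
      show "?g (min (l + A \<omega>) K - I \<omega>) \<le> ?g l + ?r l * ?X \<omega> + \<bar>?X \<omega>\<bar> * min 1 (\<bar>?X \<omega>\<bar> / real R)" .
    qed
    also have "\<dots> = ?g l + ?r l * (- \<delta>) + ?e"
      using intX intE by (simp add: truncation_error_def \<delta>_def prob_space)
    finally show ?thesis using False by (simp add: algebra_simps)
  qed
  have "(\<Sum>l\<le>K. p l * ?g l) \<le> (\<Sum>l\<le>K. p l * (?g l - \<delta> * ?r l + ?h l))"
    by (subst stationary_expectation[OF A I st, of ?g, symmetric])
       (intro sum_mono mult_left_mono step p, auto)
  then have le: "\<delta> * (\<Sum>l\<le>K. p l * ?r l) \<le> (\<Sum>l\<le>K. p l * ?h l)"
    by (simp add: algebra_simps sum.distrib sum_subtractf sum_distrib_left)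
  have "(\<Sum>l\<in>{b+R<..K}. p l) = (\<Sum>l\<in>{b+R<..K}. p l * ?r l)"
    using R by (intro sum.cong) (auto simp: ramp_eq_1)
  also have "\<dots> \<le> (\<Sum>l\<le>K. p l * ?r l)"
    by (intro sum_mono2) (auto simp: p ramp_bounds)
  finally have "\<delta> * (\<Sum>l\<in>{b+R<..K}. p l) \<le> (\<Sum>l\<le>K. p l * ?h l)"
    by (rule order_trans[OF mult_left_mono[OF _ \<delta>] le])
  also have "(\<Sum>l\<le>K. p l * ?h l) = (\<Sum>l\<in>{b-R<..K}. p l * ?h l) + (\<Sum>l\<in>{..K} \<inter> {..b-R}. p l * ?h l)"
    by (subst sum.union_disjoint[symmetric]) (auto intro!: sum.cong)
  also have "(\<Sum>l\<in>{b-R<..K}. p l * ?h l) = ?e * (\<Sum>l\<in>{b-R<..K}. p l)"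
    unfolding sum_distrib_left by (intro sum.cong) auto
  also have "(\<Sum>l\<in>{..K} \<inter> {..b-R}. p l * ?h l) =
     (\<Sum>l\<in>{..K} \<inter> {..b-R}. p l * (\<integral>\<omega>. real (min (l + A \<omega>) K - b) \<partial>M))"
    by (intro sum.cong) auto
  finally show ?thesis .
qed

text \<open>Summation by parts: \<open>H (b - l)\<close> telescopes into \<open>H (b - c)\<close>
  and increments over \<open>t\<close> in \<open>{c..<l}\<close>, and exchanging the sums turns the
  weights \<open>p\<close> into their tails. The two versions differ in the boundary term: without
  the states up to \<open>c\<close> it carries only the mass above \<open>c\<close>, with them it
  carries a mass of at most 1.\<close>

lemma sum_abel_tail_le:
  fixes p H :: "nat \<Rightarrow> real"
  assumes p: "\<And>l. 0 \<le> p l" and H: "antimono H" and H0: "\<And>l. 0 \<le> H l"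
    and p1: "(\<Sum>l\<le>K. p l) \<le> 1" and d: "c \<le> d" "d \<le> b"
  shows "(\<Sum>l\<in>{..K} \<inter> {c<..d}. p l * H (b - l)) \<le>
      (\<Sum>l\<in>{c<..K}. p l) * H (b - c)
      + (\<Sum>t\<in>{c..<d}. (\<Sum>l\<in>{t<..K}. p l) * (H (b - t - 1) - H (b - t)))" (is ?th1)
    and "(\<Sum>l\<in>{..K} \<inter> {..d}. p l * H (b - l)) \<le> H (b - c)
      + (\<Sum>t\<in>{c..<d}. (\<Sum>l\<in>{t<..K}. p l) * (H (b - t - 1) - H (b - t)))" (is ?th2)
proof -
  let ?a = "\<lambda>t. H (b - t - 1) - H (b - t)"
  let ?S = "\<Sum>t\<in>{c..<d}. (\<Sum>l\<in>{t<..K}. p l) * ?a t"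
  have a: "0 \<le> ?a t" for t using antimonoD[OF H, of "b - t - 1" "b - t"] by simp
  have tel: "H (b - l) = H (b - c) + (\<Sum>t\<in>{c..<l}. ?a t)" if "c \<le> l" for l
    using that
  proof (induction l rule: dec_induct)
    case (step n)
    then show ?case by (simp add: diff_diff_eq)
  qed simp
  have "(\<Sum>l\<in>{..K} \<inter> {c<..d}. p l * H (b - l)) =
        (\<Sum>l\<in>{..K} \<inter> {c<..d}. p l * H (b - c) + (\<Sum>t\<in>{c..<d}. if t < l then p l * ?a t else 0))"
  proof (rule sum.cong[OF refl])
    fix l assume l: "l \<in> {..K} \<inter> {c<..d}"
    have "(\<Sum>t\<in>{c..<d}. if t < l then p l * ?a t else 0) = (\<Sum>t\<in>{c..<l}. p l * ?a t)"
      using l by (intro sum.mono_neutral_cong_right) auto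
    then show "p l * H (b - l) = p l * H (b - c) + (\<Sum>t\<in>{c..<d}. if t < l then p l * ?a t else 0)"
      using l tel[of l] by (simp add: algebra_simps sum_distrib_left)
  qed
  also have "\<dots> = (\<Sum>l\<in>{..K} \<inter> {c<..d}. p l) * H (b - c)
      + (\<Sum>t\<in>{c..<d}. \<Sum>l\<in>{..K} \<inter> {c<..d}. if t < l then p l * ?a t else 0)"
    by (subst sum.swap) (simp add: sum.distrib sum_distrib_right)
  also have "(\<Sum>t\<in>{c..<d}. \<Sum>l\<in>{..K} \<inter> {c<..d}. if t < l then p l * ?a t else 0) \<le> ?S"
  proof (rule sum_mono)
    fix t
    have "(\<Sum>l\<in>{..K} \<inter> {c<..d}. if t < l then p l * ?a t else 0) =
          (\<Sum>l\<in>{..K} \<inter> {c<..d} \<inter> {t<..}. p l * ?a t)"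
      by (intro sum.mono_neutral_cong_right) auto
    also have "\<dots> \<le> (\<Sum>l\<in>{t<..K}. p l * ?a t)"
      by (intro sum_mono2 mult_nonneg_nonneg p a) auto
    finally show "(\<Sum>l\<in>{..K} \<inter> {c<..d}. if t < l then p l * ?a t else 0) \<le> (\<Sum>l\<in>{t<..K}. p l) * ?a t"
      by (simp add: sum_distrib_right)
  qed
  also have "(\<Sum>l\<in>{..K} \<inter> {c<..d}. p l) * H (b - c) \<le> (\<Sum>l\<in>{c<..K}. p l) * H (b - c)"
    by (intro mult_right_mono sum_mono2 p H0) auto
  finally show th1: ?th1 by simp
  have "(\<Sum>l\<in>{..K} \<inter> {..d}. p l * H (b - l)) =
        (\<Sum>l\<in>{..K} \<inter> {..c}. p l * H (b - l)) + (\<Sum>l\<in>{..K} \<inter> {c<..d}. p l * H (b - l))"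
    using d by (subst sum.union_disjoint[symmetric]) (auto intro!: sum.cong)
  also have "(\<Sum>l\<in>{..K} \<inter> {..c}. p l * H (b - l)) \<le> (\<Sum>l\<in>{..K} \<inter> {..c}. p l) * H (b - c)"
    unfolding sum_distrib_right by (intro sum_mono mult_left_mono antimonoD[OF H] p) auto
  also have "(\<Sum>l\<in>{..K} \<inter> {..c}. p l) * H (b - c) + (\<Sum>l\<in>{..K} \<inter> {c<..d}. p l * H (b - l))
     \<le> ((\<Sum>l\<in>{..K} \<inter> {..c}. p l) + (\<Sum>l\<in>{c<..K}. p l)) * H (b - c) + ?S"
    using th1 by (simp add: algebra_simps)
  also have "(\<Sum>l\<in>{..K} \<inter> {..c}. p l) + (\<Sum>l\<in>{c<..K}. p l) = (\<Sum>l\<le>K. p l)"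
    by (subst sum.union_disjoint[symmetric]) (auto intro!: sum.cong)
  also have "(\<Sum>l\<le>K. p l) * H (b - c) \<le> 1 * H (b - c)"
    using p1 H0 by (intro mult_right_mono) auto
  finally show ?th2 by simp
qed

section \<open>Queue-length tails, uniformly in the capacity\<close>

text \<open>The stability condition uses nonnegative integrals because the mean of the off-period
  \<open>I\<close> may be infinite; it forces the mean of \<open>A\<close> to be finite. The
  sequence \<open>p\<close> contains one stationary law for each capacity.\<close>

locale finite_queue = prob_space M for M :: "'a measure" +
  fixes A I :: "'a \<Rightarrow> nat" and p :: "nat \<Rightarrow> nat \<Rightarrow> real"
  assumes A[measurable]: "A \<in> measurable M (count_space UNIV)"
    and I[measurable]: "I \<in> measurable M (count_space UNIV)"
    and stable: "(\<integral>\<^sup>+\<omega>. of_nat (A \<omega>) \<partial>M) < (\<integral>\<^sup>+\<omega>. of_nat (I \<omega>) \<partial>M)"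
    and stationary: "\<And>K. queue_stationary M A I K (p K)"
begin

definition H :: "nat \<Rightarrow> real" where "H x = (\<integral>\<omega>. real (A \<omega> - x) \<partial>M)"

text \<open>The stationary probability of \<open>L > t\<close> at capacity \<open>K\<close>; it is 0
  for \<open>t \<ge> K\<close>.\<close>

definition T :: "nat \<Rightarrow> nat \<Rightarrow> real" where "T K t = (\<Sum>l\<in>{t<..K}. p K l)"

lemma integrable_A: "integrable M (\<lambda>\<omega>. real (A \<omega>))"
  using stable by (intro integrableI_nonneg) (auto simp: ennreal_of_nat_eq_real_of_nat intro: less_le_trans)

lemma integrable_excess: "integrable M (\<lambda>\<omega>. real (A \<omega> - x))"
  by (rule Bochner_Integration.integrable_bound[OF integrable_A]) auto

lemma H_nonneg: "0 \<le> H x"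
  by (simp add: H_def)

lemma antimono_H: "antimono H"
  unfolding H_def by (intro antimonoI integral_mono integrable_excess) auto

text \<open>Tails of \<open>A\<close> are increments of \<open>H\<close>. Hence the Abel sums above
  are convolutions with the tail of \<open>A\<close>, and a single tail is negligible against
  \<open>H\<close> as soon as consecutive values of \<open>H\<close> have ratio tending to
  1.\<close>

lemma prob_greater_eq: "prob {\<omega> \<in> space M. x < A \<omega>} = H x - H (Suc x)"
proof -
  have "H x - H (Suc x) = (\<integral>\<omega>. real (A \<omega> - x) - real (A \<omega> - Suc x) \<partial>M)"
    unfolding H_def by (simp add: integrable_excess)
  also have "\<dots> = (\<integral>\<omega>. indicator {\<omega> \<in> space M. x < A \<omega>} \<omega> \<partial>M)"
    by (intro Bochner_Integration.integral_cong) (auto simp: indicator_def of_nat_diff)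
  finally show ?thesis by (simp add: Int_absorb1)
qed

lemma H_tendsto_0: "H \<longlonglongrightarrow> 0"
proof -
  have "(\<lambda>x. \<integral>\<omega>. real (A \<omega> - x) \<partial>M) \<longlonglongrightarrow> (\<integral>\<omega>. 0 \<partial>M)"
  proof (rule integral_dominated_convergence[where w = "\<lambda>\<omega>. real (A \<omega>)"])
    show "AE \<omega> in M. (\<lambda>x. real (A \<omega> - x)) \<longlonglongrightarrow> 0"
    proof (rule AE_I2)
      fix \<omega>
      have "\<forall>\<^sub>F x in sequentially. real (A \<omega> - x) = 0"
        using eventually_ge_at_top[of "A \<omega>"] by eventually_elim simp
      then show "(\<lambda>x. real (A \<omega> - x)) \<longlonglongrightarrow> 0" by (rule tendsto_eventually)
    qed
  qed (auto simp: integrable_A)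
  then show ?thesis by (simp add: H_def[abs_def])
qed

lemma integrable_min_I: "integrable M (\<lambda>\<omega>. real (min (I \<omega>) m))"
  by (rule integrable_const_bound[where B = m]) auto

text \<open>By monotone convergence the truncated means of \<open>I\<close> exceed the mean of
  \<open>A\<close> at some finite level, even if \<open>I\<close> has infinite mean.\<close>

lemma negative_truncated_drift: "\<exists>m. 0 < - (\<integral>\<omega>. real (A \<omega>) - real (min (I \<omega>) m) \<partial>M)"
proof -
  have "(\<integral>\<^sup>+\<omega>. of_nat (I \<omega>) \<partial>M) = (\<integral>\<^sup>+\<omega>. (SUP m. of_nat (min (I \<omega>) m)) \<partial>M)"
  proof (intro nn_integral_cong)
    fix \<omega>
    show "(of_nat (I \<omega>) :: ennreal) = (SUP m. of_nat (min (I \<omega>) m))"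
      by (rule antisym, rule SUP_upper2[of "I \<omega>"], simp, simp, rule SUP_least, simp)
  qed
  also have "\<dots> = (SUP m. \<integral>\<^sup>+\<omega>. of_nat (min (I \<omega>) m) \<partial>M)"
    by (intro nn_integral_monotone_convergence_SUP) (auto simp: incseq_def le_fun_def)
  finally obtain m where m: "(\<integral>\<^sup>+\<omega>. of_nat (A \<omega>) \<partial>M) < (\<integral>\<^sup>+\<omega>. of_nat (min (I \<omega>) m) \<partial>M)"
    using stable by (auto simp: less_SUP_iff)
  note int = integrable_min_I[of m]
  have "ennreal (\<integral>\<omega>. real (A \<omega>) \<partial>M) < ennreal (\<integral>\<omega>. real (min (I \<omega>) m) \<partial>M)"
    using m by (simp add: nn_integral_eq_integral[symmetric] integrable_A int ennreal_of_nat_eq_real_of_nat)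
  then have "(\<integral>\<omega>. real (A \<omega>) \<partial>M) < (\<integral>\<omega>. real (min (I \<omega>) m) \<partial>M)"
    by (simp add: ennreal_less_iff)
  then show ?thesis using integrable_A int by (intro exI[of _ m]) simp
qed

lemma p_nonneg: "0 \<le> p K l"
  using stationary[of K] by (auto simp: queue_stationary_def)

lemma sum_p: "(\<Sum>l\<le>K. p K l) = 1"
  using stationary[of K] by (auto simp: queue_stationary_def)

lemma T_nonneg: "0 \<le> T K t"
  by (simp add: T_def sum_nonneg p_nonneg)

lemma T_le_1: "T K t \<le> 1"
proof -
  have "T K t \<le> (\<Sum>l\<le>K. p K l)"
    unfolding T_def by (intro sum_mono2) (auto simp: p_nonneg)
  then show ?thesis by (simp add: sum_p)
qed

end

text \<open>\<open>H_subexp\<close> is subexponentiality in the form needed here: reaching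
  \<open>K\<close> by two contributions that are both at least \<open>c\<close> is negligible
  against \<open>H K\<close>.\<close>

locale subexponential_queue = finite_queue +
  assumes H_pos: "0 < H x"
    and H_long: "(\<lambda>x. H (Suc x) / H x) \<longlonglongrightarrow> 1"
    and H_subexp: "e > 0 \<Longrightarrow> \<exists>c. \<exists>N. \<forall>K\<ge>N. (\<Sum>t\<in>{c..K-c}. H t * (H (K - t) - H (Suc (K - t)))) \<le> e * H K"
begin

lemmas H_shift = ratio_tendsto_1_bound[OF H_pos H_long]
lemmas H_mono = antimonoD[OF antimono_H]

lemma excess_le_H: "l \<le> b \<Longrightarrow> (\<integral>\<omega>. real (min (l + A \<omega>) K - b) \<partial>M) \<le> H (b - l)"
  unfolding H_def
proof (rule integral_mono[OF _ integrable_excess])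
  show "integrable M (\<lambda>\<omega>. real (min (l + A \<omega>) K - b))"
    by (rule integrable_const_bound[where B = K]) auto
qed auto

text \<open>With \<open>b - 1\<close> in place of \<open>K\<close> the increments match those of
  \<open>H_subexp\<close>, as \<open>H (b - t - 1) - H (b - t)\<close> is the tail of
  \<open>A\<close> at \<open>b - 1 - t\<close>. The conditions on \<open>c\<close>,
  \<open>c'\<close> and \<open>R\<close> put the range of \<open>t\<close> inside
  \<open>{c..(b - 1) - c}\<close>.\<close>

lemma convolution_le:
  assumes le: "\<And>t. c \<le> t \<Longrightarrow> t < b - R \<Longrightarrow> T K t \<le> C * H t"
    and "c \<le> c'" "c' \<le> R" "R < b" "0 \<le> C"
    and N: "\<And>K. K \<ge> N \<Longrightarrow> (\<Sum>t\<in>{c..K-c}. H t * (H (K - t) - H (Suc (K - t)))) \<le> e * H K"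
    and b: "N < b"
  shows "(\<Sum>t\<in>{c'..<b-R}. T K t * (H (b - t - 1) - H (b - t))) \<le> C * (e * H (b - 1))"
proof -
  have nn: "0 \<le> H x - H (Suc x)" for x using H_mono[of x "Suc x"] by simp
  have "(\<Sum>t\<in>{c'..<b-R}. T K t * (H (b - t - 1) - H (b - t))) \<le>
        (\<Sum>t\<in>{c'..<b-R}. C * (H t * (H ((b - 1) - t) - H (Suc ((b - 1) - t)))))"
  proof (rule sum_mono)
    fix t assume t: "t \<in> {c'..<b-R}"
    then have eq: "b - t - 1 = b - 1 - t" "b - t = Suc (b - 1 - t)" by auto
    have "T K t \<le> C * H t" using t assms(2) by (intro le) auto
    then show "T K t * (H (b - t - 1) - H (b - t)) \<le> C * (H t * (H ((b - 1) - t) - H (Suc ((b - 1) - t))))"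
      unfolding eq using nn[of "b - 1 - t"] by (simp add: mult.assoc[symmetric] mult_right_mono)
  qed
  also have "\<dots> \<le> (\<Sum>t\<in>{c..(b-1)-c}. C * (H t * (H ((b - 1) - t) - H (Suc ((b - 1) - t)))))"
    using assms(2-5) by (intro sum_mono2 mult_nonneg_nonneg nn H_nonneg) auto
  also have "\<dots> \<le> C * (e * H (b - 1))"
    unfolding sum_distrib_left[symmetric] using N[of "b - 1"] b \<open>0 \<le> C\<close>
    by (intro mult_left_mono) auto
  finally show ?thesis .
qed

text \<open>Strong induction on \<open>t\<close> with a fixed constant. The drift inequality at
  \<open>b = t - R\<close> involves the tail of \<open>L\<close> only at arguments below
  \<open>t\<close>, and it enters with small factors: the remainder for large \<open>R\<close>, and
  the convolution by \<open>H_subexp\<close>. What is left is a boundary term of order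
  \<open>H t\<close> without the factor \<open>C\<close>, so a large \<open>C\<close> closes the
  induction. Nothing chosen depends on \<open>K\<close>.\<close>

lemma queue_tail_le: "\<exists>C>0. \<forall>K t. T K t \<le> C * H t"
proof -
  obtain m where m: "0 < - (\<integral>\<omega>. real (A \<omega>) - real (min (I \<omega>) m) \<partial>M)"
    using negative_truncated_drift by blast
  define \<delta> where "\<delta> = - (\<integral>\<omega>. real (A \<omega>) - real (min (I \<omega>) m) \<partial>M)"
  have \<delta>: "0 < \<delta>" using m by (simp add: \<delta>_def)
  let ?err = "truncation_error M (\<lambda>\<omega>. real (A \<omega>) - real (min (I \<omega>) m))"
  have "integrable M (\<lambda>\<omega>. real (A \<omega>) - real (min (I \<omega>) m))"
    by (intro Bochner_Integration.integrable_diff integrable_A integrable_min_I)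
  from order_tendstoD(2)[OF truncation_error_tendsto_0[OF this], of "\<delta> / 8"] \<delta>
  obtain R0 where R0: "\<And>R. R \<ge> R0 \<Longrightarrow> ?err R \<le> \<delta> / 8"
    unfolding eventually_sequentially by (auto intro: less_imp_le)
  obtain c N1 where N1: "\<And>K. K \<ge> N1 \<Longrightarrow> (\<Sum>t\<in>{c..K-c}. H t * (H (K - t) - H (Suc (K - t)))) \<le> \<delta> / 8 * H K"
    using H_subexp[of "\<delta> / 8"] \<delta> by auto
  define R where "R = max (max R0 c) 1"
  have R: "R0 \<le> R" "c \<le> R" "0 < R" by (auto simp: R_def)
  \<comment> \<open>One shift covers the distances from \<open>b - R\<close>, \<open>b - c\<close>
    and \<open>b - 1\<close> up to \<open>t = b + R\<close>; each costs a factor 2.\<close>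
  obtain N2 where N2: "\<And>x. x \<ge> N2 \<Longrightarrow> H x \<le> 2 * H (x + (2 * R + c + 1))"
    using H_shift[of 2 "2 * R + c + 1"] by auto
  define b0 where "b0 = N1 + N2 + R + c + 2"
  \<comment> \<open>The induction step needs \<open>C * \<delta> / 2 + 2 \<le> C * \<delta>\<close>,
    which is \<open>4 \<le> C * \<delta>\<close>. The other value makes the claim trivial for
    \<open>t < b0 + R\<close>, as probabilities are at most 1.\<close>
  define C where "C = max (4 / \<delta>) (1 / H (b0 + R))"
  have C: "4 \<le> C * \<delta>" "1 \<le> C * H (b0 + R)" "0 < C"
    using \<delta> H_pos[of "b0 + R"] by (auto simp: C_def field_simps max_def)
  have "T K t \<le> C * H t" for K t
  proof (induction t rule: less_induct)
    case (less t)
    show ?case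
    proof (cases "t < b0 + R")
      case True
      have "T K t \<le> C * H (b0 + R)" using T_le_1[of K t] C(2) by linarith
      also have "\<dots> \<le> C * H t" using True C(3) by (intro mult_left_mono H_mono) auto
      finally show ?thesis .
    next
      case False
      define b where "b = t - R"
      have b: "t = b + R" "b0 \<le> b" using False by (auto simp: b_def)
      have bb: "R < b" "N1 < b" "N2 \<le> b - R" "N2 \<le> b - c" "N2 \<le> b - 1" "c \<le> b - R"
        using b(2) by (auto simp: b0_def)
      have sh: "H x \<le> 2 * H t" if "x \<ge> N2" "t \<le> x + (2 * R + c + 1)" for x
        using N2[OF that(1)] H_mono[OF that(2)] by linarith
      have "\<delta> * T K t \<le> ?err R * T K (b - R)
         + (\<Sum>l\<in>{..K} \<inter> {..b-R}. p K l * (\<integral>\<omega>. real (min (l + A \<omega>) K - b) \<partial>M))"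
        unfolding T_def b(1) using bb R \<delta>
        by (intro queue_drift_inequality[OF A I integrable_A stationary]) (auto simp: \<delta>_def)
      also have "(\<Sum>l\<in>{..K} \<inter> {..b-R}. p K l * (\<integral>\<omega>. real (min (l + A \<omega>) K - b) \<partial>M)) \<le>
           (\<Sum>l\<in>{..K} \<inter> {..b-R}. p K l * H (b - l))"
        by (intro sum_mono mult_left_mono excess_le_H p_nonneg) auto
      also have "\<dots> \<le> H (b - c) + (\<Sum>t\<in>{c..<b-R}. T K t * (H (b - t - 1) - H (b - t)))"
        unfolding T_def using bb
        by (intro sum_abel_tail_le p_nonneg antimono_H H_nonneg) (auto simp: sum_p)
      also have "(\<Sum>t\<in>{c..<b-R}. T K t * (H (b - t - 1) - H (b - t))) \<le> C * (\<delta> / 8 * H (b - 1))"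
      proof (rule convolution_le[OF _ order_refl R(2) bb(1) _ N1 bb(2)])
        show "T K t' \<le> C * H t'" if "t' < b - R" for t' using that b by (intro less) auto
      qed (use C in auto)
      also have "?err R * T K (b - R) \<le> \<delta> / 8 * (C * H (b - R))"
        using b \<delta> R bb by (intro mult_mono R0 less T_nonneg) auto
      also have "H (b - R) \<le> 2 * H t" using bb b by (intro sh) auto
      also have "H (b - c) \<le> 2 * H t" using bb b by (intro sh) auto
      also have "H (b - 1) \<le> 2 * H t" using bb b by (intro sh) auto
      finally have "\<delta> * T K t \<le> \<delta> / 8 * (C * (2 * H t)) + (2 * H t + C * (\<delta> / 8 * (2 * H t)))"
        using C \<delta> by simp
      also have "\<dots> = (C * \<delta> / 2 + 2) * H t" by (simp add: field_simps)
      also have "\<dots> \<le> (C * \<delta>) * H t"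
        using C H_nonneg by (intro mult_right_mono) auto
      finally show ?thesis using \<delta> by (simp add: mult.assoc mult.left_commute[of C])
    qed
  qed
  with C show ?thesis by blast
qed

text \<open>The drift inequality at \<open>b = K - r - R\<close>, now with
  \<open>queue_tail_le\<close> for the tails on the right. The one term that was not small before,
  jumps across \<open>b\<close> from states up to \<open>c\<close>, is so now: the cap limits the
  overshoot to \<open>R + r\<close>, and what remains is a multiple of a tail of
  \<open>A\<close>.\<close>

lemma queue_tail_near_capacity:
  assumes e: "0 < e"
  shows "\<exists>N. \<forall>K\<ge>N. T K (K - r) \<le> e * H K"
proof -
  obtain m where m: "0 < - (\<integral>\<omega>. real (A \<omega>) - real (min (I \<omega>) m) \<partial>M)"
    using negative_truncated_drift by blast
  define \<delta> where "\<delta> = - (\<integral>\<omega>. real (A \<omega>) - real (min (I \<omega>) m) \<partial>M)"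
  have \<delta>: "0 < \<delta>" using m by (simp add: \<delta>_def)
  obtain C where C: "0 < C" "\<And>K t. T K t \<le> C * H t" using queue_tail_le by blast
  \<comment> \<open>Four contributions will each be at most
    \<open>\<delta> * e / 16 * (2 * H K)\<close>, half of the allowed total.\<close>
  have \<delta>e: "0 < \<delta> * e / (16 * C)" using \<delta> e C by simp
  let ?err = "truncation_error M (\<lambda>\<omega>. real (A \<omega>) - real (min (I \<omega>) m))"
  have "integrable M (\<lambda>\<omega>. real (A \<omega>) - real (min (I \<omega>) m))"
    by (intro Bochner_Integration.integrable_diff integrable_A integrable_min_I)
  from order_tendstoD(2)[OF truncation_error_tendsto_0[OF this] \<delta>e]
  obtain R0 where R0: "\<And>R. R \<ge> R0 \<Longrightarrow> ?err R \<le> \<delta> * e / (16 * C)"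
    unfolding eventually_sequentially by (auto intro: less_imp_le)
  obtain c0 N1 where N1: "\<And>K. K \<ge> N1 \<Longrightarrow>
      (\<Sum>t\<in>{c0..K-c0}. H t * (H (K - t) - H (Suc (K - t)))) \<le> \<delta> * e / (16 * C) * H K"
    using H_subexp[OF \<delta>e] by auto
  obtain c1 where c1: "\<And>c. c \<ge> c1 \<Longrightarrow> H c \<le> \<delta> * e / (16 * C)"
    using order_tendstoD(2)[OF H_tendsto_0 \<delta>e] unfolding eventually_sequentially
    by (auto intro: less_imp_le)
  define c where "c = max c0 c1"
  define R where "R = max (max R0 c) 1"
  have R: "R0 \<le> R" "c0 \<le> c" "c1 \<le> c" "c \<le> R" "0 < R" by (auto simp: R_def c_def)
  obtain N2 where N2: "\<And>x. x \<ge> N2 \<Longrightarrow> H x \<le> 2 * H (x + (2 * R + r + c + 1))"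
    using H_shift[of 2 "2 * R + r + c + 1"] by auto
  \<comment> \<open>\<open>q\<close> bounds the relative decrease of \<open>H\<close> over one step
    and is small enough to absorb the overshoot bound \<open>R + r\<close>; the value 1/2 keeps
    \<open>1 - q\<close> positive.\<close>
  define q where "q = min (1/2) (\<delta> * e / (16 * (R + r)))"
  have "0 < \<delta> * e / (16 * (R + r))" using \<delta> e R by simp
  then have q: "0 < q" "q \<le> 1/2" "q \<le> \<delta> * e / (16 * (R + r))"
    unfolding q_def by linarith+
  then have "1 < 1 / (1 - q)" by (simp add: field_simps)
  from H_shift[OF this, of 1]
  obtain N3 where N3: "\<And>x. x \<ge> N3 \<Longrightarrow> H x \<le> 1 / (1 - q) * H (x + 1)" by auto
  have jump: "(R + r) * (H x - H (Suc x)) \<le> \<delta> * e / 16 * H x" if "x \<ge> N3" for x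
  proof -
    have "(1 - q) * H x \<le> H (Suc x)"
      using N3[OF that] q(2) by (simp add: field_simps)
    then have "H x - H (Suc x) \<le> q * H x" by (simp add: algebra_simps)
    also have "\<dots> \<le> \<delta> * e / (16 * (R + r)) * H x" by (intro mult_right_mono q H_nonneg)
    finally have "(R + r) * (H x - H (Suc x)) \<le> (R + r) * (\<delta> * e / (16 * (R + r)) * H x)"
      by (intro mult_left_mono) auto
    also have "\<dots> = \<delta> * e / 16 * H x"
    proof -
      have "16 * real R + 16 * real r \<noteq> 0" "0 < real R + real r" using R by auto
      then show ?thesis by (simp add: divide_simps)
    qed
    finally show ?thesis .
  qed
  have "T K (K - r) \<le> e * H K" if K: "K \<ge> N1 + N2 + N3 + 2 * R + r + c + 2" for K
  proof -
    define b where "b = K - r - R"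
    have b: "K - r = b + R" "K = b + R + r" using K by (auto simp: b_def)
    have bb: "R < b" "N1 < b" "N2 \<le> b - R" "N2 \<le> b - c" "N2 \<le> b - 1" "c \<le> b - R" "N3 \<le> b - c"
      using K b(2) by auto
    have sh: "H x \<le> 2 * H K" if "x \<ge> N2" "K \<le> x + (2 * R + r + c + 1)" for x
      using N2[OF that(1)] H_mono[OF that(2)] by linarith
    let ?E = "\<lambda>l. \<integral>\<omega>. real (min (l + A \<omega>) K - b) \<partial>M"
    have "\<delta> * T K (K - r) \<le> ?err R * T K (b - R) + (\<Sum>l\<in>{..K} \<inter> {..b-R}. p K l * ?E l)"
      unfolding T_def b(1) using bb R \<delta>
      by (intro queue_drift_inequality[OF A I integrable_A stationary]) (auto simp: \<delta>_def)
    also have "(\<Sum>l\<in>{..K} \<inter> {..b-R}. p K l * ?E l) =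
        (\<Sum>l\<in>{..K} \<inter> {..c}. p K l * ?E l) + (\<Sum>l\<in>{..K} \<inter> {c<..b-R}. p K l * ?E l)"
      using bb by (subst sum.union_disjoint[symmetric]) (auto intro!: sum.cong)
    also have "(\<Sum>l\<in>{..K} \<inter> {..c}. p K l * ?E l) \<le>
        (\<Sum>l\<in>{..K} \<inter> {..c}. p K l * (\<delta> * e / 16 * H (b - c)))"
    proof (intro sum_mono mult_left_mono p_nonneg)
      fix l assume l: "l \<in> {..K} \<inter> {..c}"
      \<comment> \<open>The capped overshoot is at most \<open>K - b = R + r\<close>, and it
        vanishes unless \<open>A > b - l\<close>, where \<open>b - l \<ge> b - c\<close>.\<close>
      have "?E l \<le> (\<integral>\<omega>. real (R + r) * indicator {\<omega> \<in> space M. b - c < A \<omega>} \<omega> \<partial>M)"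
      proof (rule integral_mono)
        show "integrable M (\<lambda>\<omega>. real (min (l + A \<omega>) K - b))"
          by (rule integrable_const_bound[where B = K]) auto
        show "integrable M (\<lambda>\<omega>. real (R + r) * indicator {\<omega> \<in> space M. b - c < A \<omega>} \<omega>)"
          by (rule integrable_const_bound[where B = "R + r"]) (auto simp: indicator_def)
        fix \<omega> assume "\<omega> \<in> space M"
        then show "real (min (l + A \<omega>) K - b) \<le> real (R + r) * indicator {\<omega> \<in> space M. b - c < A \<omega>} \<omega>"
          using l b(2) bb by (cases "b - c < A \<omega>") auto
      qed
      also have "\<dots> = (R + r) * (H (b - c) - H (Suc (b - c)))"
        by (simp add: Int_absorb1 prob_greater_eq)
      finally show "?E l \<le> \<delta> * e / 16 * H (b - c)" using jump[OF bb(7)] by linarith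
    qed
    also have "\<dots> = (\<Sum>l\<in>{..K} \<inter> {..c}. p K l) * (\<delta> * e / 16 * H (b - c))"
      by (simp add: sum_distrib_right)
    also have "\<dots> \<le> (\<Sum>l\<le>K. p K l) * (\<delta> * e / 16 * H (b - c))"
      using \<delta> e H_nonneg by (intro mult_right_mono sum_mono2 p_nonneg mult_nonneg_nonneg) auto
    also have "\<dots> = \<delta> * e / 16 * H (b - c)" by (simp add: sum_p)
    also have "(\<Sum>l\<in>{..K} \<inter> {c<..b-R}. p K l * ?E l) \<le> (\<Sum>l\<in>{..K} \<inter> {c<..b-R}. p K l * H (b - l))"
      by (intro sum_mono mult_left_mono excess_le_H p_nonneg) auto
    \<comment> \<open>The version without the states up to \<open>c\<close> is essential: its
      boundary term has the factor \<open>T K c\<close>, which is small because \<open>H c\<close>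
      is.\<close>
    also have "\<dots> \<le> T K c * H (b - c) + (\<Sum>t\<in>{c..<b-R}. T K t * (H (b - t - 1) - H (b - t)))"
      unfolding T_def using bb
      by (intro sum_abel_tail_le p_nonneg antimono_H H_nonneg) (auto simp: sum_p)
    also have "T K c * H (b - c) \<le> (C * (\<delta> * e / (16 * C))) * H (b - c)"
      using C(1) by (intro mult_right_mono order_trans[OF C(2)] mult_left_mono c1 R H_nonneg) auto
    also have "(\<Sum>t\<in>{c..<b-R}. T K t * (H (b - t - 1) - H (b - t))) \<le> C * (\<delta> * e / (16 * C) * H (b - 1))"
      by (rule convolution_le[OF C(2) R(2) R(4) bb(1) _ N1 bb(2)]) (use C in auto)
    also have "?err R * T K (b - R) \<le> \<delta> * e / (16 * C) * (C * H (b - R))"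
      using \<delta>e R by (intro mult_mono R0 C T_nonneg) auto
    also have "H (b - R) \<le> 2 * H K" using bb b by (intro sh) auto
    also have "H (b - c) \<le> 2 * H K" using bb b by (intro sh) auto
    also have "H (b - 1) \<le> 2 * H K" using bb b by (intro sh) auto
    finally have "\<delta> * T K (K - r) \<le> \<delta> * e / (16 * C) * (C * (2 * H K)) + (\<delta> * e / 16 * (2 * H K) +
        (C * (\<delta> * e / (16 * C)) * (2 * H K) + C * (\<delta> * e / (16 * C) * (2 * H K))))"
      using C \<delta> e by simp
    also have "\<dots> = \<delta> * (e * H K) / 2" using C by (simp add: field_simps)
    also have "\<dots> \<le> \<delta> * (e * H K)" using \<delta> e H_nonneg[of K] by simp
    finally show ?thesis using \<delta> by simp
  qed
  then show ?thesis by blast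
qed

text \<open>The weights sum to 1 and \<open>H\<close> decreases, which gives the lower bound. Above,
  the states away from \<open>K\<close> yield \<open>H (K - c)\<close>, equivalent to
  \<open>H K\<close>, plus a convolution that is negligible by \<open>H_subexp\<close>.\<close>

theorem queue_loss_asymptotics: "(\<lambda>K. (\<Sum>l\<le>K. p K l * H (K - l)) / H K) \<longlonglongrightarrow> 1"
proof (rule LIMSEQ_I)
  fix e :: real assume e: "0 < e"
  obtain C where C: "0 < C" "\<And>K t. T K t \<le> C * H t" using queue_tail_le by blast
  have e1: "0 < e / (16 * C)" using e C by simp
  obtain c N1 where N1: "\<And>K. K \<ge> N1 \<Longrightarrow>
      (\<Sum>t\<in>{c..K-c}. H t * (H (K - t) - H (Suc (K - t)))) \<le> e / (16 * C) * H K"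
    using H_subexp[OF e1] by auto
  have "0 < e / (4 * H 0)" using e H_pos[of 0] by simp
  from queue_tail_near_capacity[OF this, of "Suc c"]
  obtain N2 where N2: "\<And>K. K \<ge> N2 \<Longrightarrow> T K (K - Suc c) \<le> e / (4 * H 0) * H K" by blast
  obtain N3 where N3: "\<And>x. x \<ge> N3 \<Longrightarrow> H x \<le> (1 + e / 4) * H (x + c)"
    using H_shift[of "1 + e / 4" c] e by auto
  obtain N4 where N4: "\<And>x. x \<ge> N4 \<Longrightarrow> H x \<le> 2 * H (x + 1)"
    using H_shift[of 2 1] by auto
  show "\<exists>N. \<forall>K\<ge>N. norm ((\<Sum>l\<le>K. p K l * H (K - l)) / H K - 1) < e"
  proof (intro exI allI impI)
    fix K assume K: "K \<ge> N1 + N2 + N3 + N4 + 2 * c + 2"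
    have "H K = (\<Sum>l\<le>K. p K l * H K)" by (simp add: sum_distrib_right[symmetric] sum_p)
    also have "\<dots> \<le> (\<Sum>l\<le>K. p K l * H (K - l))"
      by (intro sum_mono mult_left_mono H_mono p_nonneg) auto
    finally have lower: "H K \<le> (\<Sum>l\<le>K. p K l * H (K - l))" .
    have "(\<Sum>l\<le>K. p K l * H (K - l)) = (\<Sum>l\<in>{..K} \<inter> {..K - Suc c}. p K l * H (K - l))
        + (\<Sum>l\<in>{K - Suc c<..K}. p K l * H (K - l))"
      by (subst sum.union_disjoint[symmetric]) (auto intro!: sum.cong)
    also have "(\<Sum>l\<in>{..K} \<inter> {..K - Suc c}. p K l * H (K - l)) \<le>
        H (K - c) + (\<Sum>t\<in>{c..<K - Suc c}. T K t * (H (K - t - 1) - H (K - t)))"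
      unfolding T_def using K
      by (intro sum_abel_tail_le p_nonneg antimono_H H_nonneg) (auto simp: sum_p)
    also have "(\<Sum>t\<in>{c..<K - Suc c}. T K t * (H (K - t - 1) - H (K - t))) \<le> C * (e / (16 * C) * H (K - 1))"
      by (rule convolution_le[OF C(2) order_refl _ _ _ N1]) (use C K in auto)
    also have "H (K - 1) \<le> 2 * H K" using N4[of "K - 1"] K by simp
    also have "H (K - c) \<le> (1 + e / 4) * H K" using N3[of "K - c"] K by simp
    \<comment> \<open>Close to the capacity \<open>H (K - l)\<close> is of order 1, so the smallness
      has to come from the probability of these states.\<close>
    also have "(\<Sum>l\<in>{K - Suc c<..K}. p K l * H (K - l)) \<le> (\<Sum>l\<in>{K - Suc c<..K}. p K l * H 0)"
      by (intro sum_mono mult_left_mono H_mono p_nonneg) auto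
    also have "\<dots> = T K (K - Suc c) * H 0" by (simp add: T_def sum_distrib_right)
    also have "\<dots> \<le> e / (4 * H 0) * H K * H 0" using K by (intro mult_right_mono N2 H_nonneg) auto
    finally have "(\<Sum>l\<le>K. p K l * H (K - l)) \<le>
        (1 + e / 4) * H K + C * (e / (16 * C) * (2 * H K)) + e / (4 * H 0) * H K * H 0"
      using C e by simp
    also have "\<dots> = (1 + 5 / 8 * e) * H K"
      using C H_pos[of 0] by (simp add: field_simps)
    also have "\<dots> < (1 + e) * H K"
      using e H_pos[of K] by (intro mult_strict_right_mono) auto
    finally show "norm ((\<Sum>l\<le>K. p K l * H (K - l)) / H K - 1) < e"
      using lower H_pos[of K] e by (simp add: abs_if field_simps)
  qed
qed

end

section \<open>Subexponential and long-tailed functions\<close>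

lemma sum_by_parts_le:
  fixes G H :: "nat \<Rightarrow> real"
  assumes "c \<le> d" "d \<le> K" "0 \<le> G c" "\<And>x. 0 \<le> H x"
  shows "(\<Sum>t\<in>{c..d}. G t * (H (K - t) - H (Suc (K - t)))) \<le>
     G d * H (K - d) + (\<Sum>t\<in>{c..<d}. H (K - t) * (G t - G (Suc t)))"
  using assms(1,2)
proof (induction d rule: dec_induct)
  case base
  then show ?case using assms(3,4) by (simp add: right_diff_distrib)
next
  case (step d)
  have "Suc (K - Suc d) = K - d" using step by auto
  then show ?case using step by (simp add: algebra_simps)
qed

lemma long_tail_ratio_transfer:
  fixes G H :: "nat \<Rightarrow> real"
  assumes G: "\<And>x. 0 < G x" and H: "\<And>x. 0 < H x"
    and eq: "(\<lambda>x. H x / G x) \<longlonglongrightarrow> 1" and long: "(\<lambda>x. G (Suc x) / G x) \<longlonglongrightarrow> 1"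
  shows "(\<lambda>x. H (Suc x) / H x) \<longlonglongrightarrow> 1"
proof -
  have "(\<lambda>x. (H (Suc x) / G (Suc x)) * (G (Suc x) / G x) * inverse (H x / G x)) \<longlonglongrightarrow> 1 * 1 * inverse 1"
    by (intro tendsto_mult tendsto_inverse LIMSEQ_Suc[OF eq] eq long) simp
  moreover have "(\<lambda>x. (H (Suc x) / G (Suc x)) * (G (Suc x) / G x) * inverse (H x / G x)) = (\<lambda>x. H (Suc x) / H x)"
  proof
    fix x show "(H (Suc x) / G (Suc x)) * (G (Suc x) / G x) * inverse (H x / G x) = H (Suc x) / H x"
      using G[of x] G[of "Suc x"] by simp
  qed
  ultimately show ?thesis by simp
qed

lemma ratio_tendsto_imp_le:
  fixes G H :: "nat \<Rightarrow> real"
  assumes G: "\<And>x. 0 < G x" and eq: "(\<lambda>x. H x / G x) \<longlonglongrightarrow> l"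
  shows "\<exists>C>0. \<forall>x. H x \<le> C * G x"
proof -
  have "Bseq (\<lambda>x. H x / G x)" using eq by (intro convergent_imp_Bseq convergentI)
  then obtain C where C: "0 < C" "\<And>x. \<bar>H x / G x\<bar> \<le> C" by (auto simp: Bseq_def)
  have "H x \<le> C * G x" for x
    using C(2)[of x] G[of x] by (simp add: abs_le_iff field_simps)
  with C(1) show ?thesis by blast
qed

text \<open>Equivalence of \<open>H\<close> and \<open>G\<close> says nothing about their
  differences. So the factor \<open>H t\<close> is compared with \<open>G t\<close> first, then
  summation by parts moves the difference from \<open>H\<close> to \<open>G\<close>, and only then
  is the second factor compared. The boundary term is small because \<open>H c\<close> tends to
  0.\<close>

lemma subexponential_convolution_transfer:
  fixes G H :: "nat \<Rightarrow> real"
  assumes G: "\<And>x. 0 < G x" "antimono G" and H: "\<And>x. 0 < H x" "antimono H" "H \<longlonglongrightarrow> 0"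
    and eq: "(\<lambda>x. H x / G x) \<longlonglongrightarrow> 1" and long: "(\<lambda>x. G (Suc x) / G x) \<longlonglongrightarrow> 1"
    and sub: "\<And>e. e > 0 \<Longrightarrow> \<exists>c. \<exists>N. \<forall>K\<ge>N. (\<Sum>t\<in>{c..K-c}. G (K - t) * (G t - G (Suc t))) \<le> e * G K"
    and e: "0 < (e::real)"
  shows "\<exists>c. \<exists>N. \<forall>K\<ge>N. (\<Sum>t\<in>{c..K-c}. H t * (H (K - t) - H (Suc (K - t)))) \<le> e * H K"
proof -
  obtain C where C: "0 < C" "\<And>x. H x \<le> C * G x" using ratio_tendsto_imp_le[OF G(1) eq] by blast
  have "(\<lambda>x. inverse (H x / G x)) \<longlonglongrightarrow> inverse 1" by (intro tendsto_inverse eq) simp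
  then have "(\<lambda>x. G x / H x) \<longlonglongrightarrow> 1" by (simp add: field_simps)
  from ratio_tendsto_imp_le[OF H(1) this] obtain D where D: "0 < D" "\<And>x. G x \<le> D * H x" by blast
  have "0 < e / (2 * C * C * D)" using e C D by simp
  from sub[OF this] obtain c0 N1 where N1: "\<And>K. K \<ge> N1 \<Longrightarrow>
     (\<Sum>t\<in>{c0..K-c0}. G (K - t) * (G t - G (Suc t))) \<le> e / (2 * C * C * D) * G K" by blast
  have "0 < e / (4 * C * D)" using e C D by simp
  from order_tendstoD(2)[OF H(3) this] obtain c1 where c1: "\<And>c. c \<ge> c1 \<Longrightarrow> H c \<le> e / (4 * C * D)"
    unfolding eventually_sequentially by (auto intro: less_imp_le)
  define c where "c = max c0 c1"
  have c: "c0 \<le> c" "c1 \<le> c" by (auto simp: c_def)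
  have nnG: "0 \<le> G x - G (Suc x)" for x using antimonoD[OF G(2), of x "Suc x"] by simp
  have nnH: "0 \<le> H x - H (Suc x)" for x using antimonoD[OF H(2), of x "Suc x"] by simp
  obtain N2 where N2: "\<And>x. x \<ge> N2 \<Longrightarrow> G x \<le> 2 * G (x + c)"
    using ratio_tendsto_1_bound[OF G(1) long, of 2 c] by auto
  show ?thesis
  proof (intro exI allI impI)
    fix K assume K: "K \<ge> N1 + N2 + 2 * c"
    have "(\<Sum>t\<in>{c..K-c}. H t * (H (K - t) - H (Suc (K - t)))) \<le>
          (\<Sum>t\<in>{c..K-c}. C * (G t * (H (K - t) - H (Suc (K - t)))))"
      unfolding mult.assoc[symmetric] by (intro sum_mono mult_right_mono C nnH)
    also have "\<dots> \<le> C * (G (K - c) * H (K - (K - c)) + (\<Sum>t\<in>{c..<K-c}. H (K - t) * (G t - G (Suc t))))"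
      unfolding sum_distrib_left[symmetric] using K C G(1) H(1)
      by (intro mult_left_mono sum_by_parts_le) (auto intro: less_imp_le)
    also have "(\<Sum>t\<in>{c..<K-c}. H (K - t) * (G t - G (Suc t))) \<le> (\<Sum>t\<in>{c..<K-c}. C * (G (K - t) * (G t - G (Suc t))))"
      unfolding mult.assoc[symmetric] by (intro sum_mono mult_right_mono C nnG)
    also have "\<dots> \<le> (\<Sum>t\<in>{c0..K-c0}. C * (G (K - t) * (G t - G (Suc t))))"
      using c C(1) G(1) by (intro sum_mono2 mult_nonneg_nonneg nnG) (auto intro: less_imp_le)
    also have "\<dots> \<le> C * (e / (2 * C * C * D) * G K)"
      unfolding sum_distrib_left[symmetric] using K C by (intro mult_left_mono N1) auto
    also have "G (K - c) * H (K - (K - c)) \<le> (2 * G K) * (e / (4 * C * D))"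
      using N2[of "K - c"] K c G(1)[of K] H(1)[of c] by (intro mult_mono c1) (auto intro: less_imp_le)
    finally have "(\<Sum>t\<in>{c..K-c}. H t * (H (K - t) - H (Suc (K - t)))) \<le>
        C * (2 * G K * (e / (4 * C * D)) + C * (e / (2 * C * C * D) * G K))"
      using C(1) by simp
    also have "\<dots> = e / D * G K" using C D by (simp add: field_simps)
    also have "\<dots> \<le> e / D * (D * H K)" using e D by (intro mult_left_mono) auto
    also have "\<dots> = e * H K" using D by simp
    finally show "(\<Sum>t\<in>{c..K-c}. H t * (H (K - t) - H (Suc (K - t)))) \<le> e * H K" .
  qed
qed

text \<open>For independent copies X, Y the event \<open>X + Y > K * r\<close> contains three
  disjoint events: both exceed \<open>c * r\<close> and their sum exceeds \<open>K * r\<close>, or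
  one lies in \<open>{0..c * r}\<close> and the other exceeds \<open>K * r\<close>. The last two
  have total probability \<open>2 * (1 - F c) * F K\<close>, the whole one is asymptotically
  \<open>2 * F K\<close>, so the first is at most \<open>(e / 2 + 2 * F c) * F K\<close> for large
  \<open>K\<close>. The sum in the claim is a discretised lower estimate of the first, with mesh
  \<open>r\<close>.\<close>

lemma subexponential_both_large:
  fixes E :: "real measure"
  assumes E: "prob_space E" "sets E = sets borel" "measure E {..<0} = 0"
    and sub: "subexponential E" and r: "0 < r" and e: "0 < e"
  shows "\<exists>c::nat. \<exists>N. \<forall>K\<ge>N. (\<Sum>t\<in>{c..K-c}. measure E {real (K - t) * r<..} *
     (measure E {real t * r<..} - measure E {real (Suc t) * r<..})) \<le> e * measure E {real K * r<..}"
proof -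
  interpret E: prob_space E by fact
  interpret EE: pair_prob_space E E ..
  note [measurable_cong] = E(2)
  have spE: "space E = UNIV" using sets_eq_imp_space_eq[OF E(2)] by simp
  define F where "F t = measure E {real t * r<..}" for t :: nat
  have F_pos: "0 < F t" for t using sub by (auto simp: subexponential_def pos_tail_def F_def)
  have times: "measure (E \<Otimes>\<^sub>M E) (A \<times> B) = measure E A * measure E B"
    if "A \<in> sets borel" "B \<in> sets borel" for A B
    using that by (simp add: measure_def E.emeasure_pair_measure_Times E(2) enn2real_mult)
  have F_diff: "F t - F (Suc t) = measure E {real t * r<..real (Suc t) * r}" for t
  proof -
    have "{real t * r<..real (Suc t) * r} = {real t * r<..} - {real (Suc t) * r<..}" by auto
    moreover have "measure E ({real t * r<..} - {real (Suc t) * r<..}) = F t - F (Suc t)"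
      unfolding F_def using r by (intro E.finite_measure_Diff) (auto simp: E(2))
    ultimately show ?thesis by simp
  qed
  define D where "D c K = {c * r<..} \<times> {c * r<..} \<inter> {(x, y). real K * r < x + y}" for c :: real and K :: nat
  have Dsets: "D c K \<in> sets (E \<Otimes>\<^sub>M E)" for c K
  proof -
    have "{c * r<..} \<times> {c * r<..} \<in> sets (E \<Otimes>\<^sub>M E)" using E(2) by (intro pair_measureI) auto
    moreover have "{z \<in> space (E \<Otimes>\<^sub>M E). real K * r < fst z + snd z} \<in> sets (E \<Otimes>\<^sub>M E)" by measurable
    ultimately have "{c * r<..} \<times> {c * r<..} \<inter> {z \<in> space (E \<Otimes>\<^sub>M E). real K * r < fst z + snd z} \<in> sets (E \<Otimes>\<^sub>M E)" by blast
    then show ?thesis by (simp add: D_def space_pair_measure spE case_prod_beta)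
  qed
  have sum_le: "(\<Sum>t\<in>{c..K-c}. F (K - t) * (F t - F (Suc t))) \<le> measure (E \<Otimes>\<^sub>M E) (D (real c) K)" for c K
  proof -
    \<comment> \<open>Disjoint half-strips whose measures are the summands: the first coordinate
      exceeds \<open>t * r\<close> and the second \<open>(K - t) * r\<close>, hence the sum exceeds
      \<open>K * r\<close>.\<close>
    let ?R = "\<lambda>t. {real t * r<..real (Suc t) * r} \<times> {real (K - t) * r<..}"
    have dis: "disjoint_family_on ?R {c..K-c}"
    proof (unfold disjoint_family_on_def, intro ballI impI)
      fix s t assume st: "s \<noteq> (t::nat)"
      show "?R s \<inter> ?R t = {}"
      proof (rule ccontr)
        assume "?R s \<inter> ?R t \<noteq> {}"
        then obtain x where x: "real s * r < x" "x \<le> real (Suc s) * r" "real t * r < x" "x \<le> real (Suc t) * r" by auto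
        then have "real s * r < real (Suc t) * r" "real t * r < real (Suc s) * r" by linarith+
        then have "s = t" using r by (simp add: mult_less_cancel_right)
        with st show False by simp
      qed
    qed
    have "(\<Sum>t\<in>{c..K-c}. F (K - t) * (F t - F (Suc t))) = (\<Sum>t\<in>{c..K-c}. measure (E \<Otimes>\<^sub>M E) (?R t))"
      unfolding F_diff by (intro sum.cong refl) (simp add: times F_def mult.commute)
    also have "\<dots> = measure (E \<Otimes>\<^sub>M E) (\<Union>t\<in>{c..K-c}. ?R t)"
      using dis by (intro EE.finite_measure_finite_Union[symmetric]) (auto intro!: pair_measureI simp: E(2))
    also have "\<dots> \<le> measure (E \<Otimes>\<^sub>M E) (D (real c) K)"
    proof (rule EE.finite_measure_mono[OF subsetI Dsets])
      fix z assume "z \<in> (\<Union>t\<in>{c..K-c}. ?R t)"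
      then obtain t x y where t: "t \<in> {c..K-c}" and x: "x \<in> {real t * r<..real (Suc t) * r}"
        and y: "y \<in> {real (K - t) * r<..}" and z: "z = (x, y)" by blast
      have "real c * r \<le> real t * r" "real c * r \<le> real (K - t) * r"
        using t r by (auto intro!: mult_right_mono)
      moreover have "real K * r = real t * r + real (K - t) * r"
        using t by (subst distrib_right[symmetric], subst of_nat_add[symmetric]) force
      ultimately show "z \<in> D (real c) K" using x y z by (auto simp: D_def)
    qed
    finally show ?thesis .
  qed
  have conv: "measure (E \<star> E) {real K * r<..} = measure (E \<Otimes>\<^sub>M E) {(x, y). real K * r < x + y}" for K
  proof -
    have "measure (E \<star> E) {real K * r<..} = measure (E \<Otimes>\<^sub>M E) ((\<lambda>(x, y). x + y) -` {real K * r<..} \<inter> space (E \<Otimes>\<^sub>M E))"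
      unfolding convolution_def by (rule measure_distr) auto
    also have "(\<lambda>(x, y). x + y) -` {real K * r<..} \<inter> space (E \<Otimes>\<^sub>M E) = {(x, y). real K * r < x + y}"
      by (auto simp: space_pair_measure spE)
    finally show ?thesis .
  qed
  have mid: "measure E {0..real c * r} = 1 - F c" for c
  proof -
    have "0 \<le> real c * r" using r by simp
    have "UNIV = {..<0} \<union> ({0..real c * r} \<union> {real c * r<..})" using r by auto
    then have "1 = measure E ({..<0} \<union> ({0..real c * r} \<union> {real c * r<..}))" using E.prob_space spE by simp
    also have "\<dots> = measure E {..<0} + (measure E {0..real c * r} + measure E {real c * r<..})"
      using \<open>0 \<le> real c * r\<close> by (subst E.finite_measure_Union; (subst E.finite_measure_Union)?) (auto simp: E(2))
    finally show ?thesis using E(3) by (simp add: F_def)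
  qed
  have D_le: "measure (E \<Otimes>\<^sub>M E) (D (real c) K) \<le> measure (E \<star> E) {real K * r<..} - 2 * (1 - F c) * F K"
    if cK: "c \<le> K" for c K
  proof -
    let ?L = "{0..real c * r}" and ?U = "{real K * r<..}"
    have sets: "?L \<times> ?U \<in> sets (E \<Otimes>\<^sub>M E)" "?U \<times> ?L \<in> sets (E \<Otimes>\<^sub>M E)"
      using E(2) by (auto intro!: pair_measureI)
    have cr: "real c * r \<le> real K * r" using cK r by (intro mult_right_mono) auto
    have "measure (E \<Otimes>\<^sub>M E) (D (real c) K) + (measure (E \<Otimes>\<^sub>M E) (?L \<times> ?U) + measure (E \<Otimes>\<^sub>M E) (?U \<times> ?L)) =
       measure (E \<Otimes>\<^sub>M E) (D (real c) K \<union> (?L \<times> ?U \<union> ?U \<times> ?L))"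
      using sets Dsets cr by (subst EE.finite_measure_Union; (subst EE.finite_measure_Union)?) (auto simp: D_def)
    also have "\<dots> \<le> measure (E \<Otimes>\<^sub>M E) {(x, y). real K * r < x + y}"
    proof (rule EE.finite_measure_mono)
      show "D (real c) K \<union> (?L \<times> ?U \<union> ?U \<times> ?L) \<subseteq> {(x, y). real K * r < x + y}"
        using r by (auto simp: D_def)
      have "{z \<in> space (E \<Otimes>\<^sub>M E). real K * r < fst z + snd z} \<in> sets (E \<Otimes>\<^sub>M E)" by measurable
      then show "{(x, y). real K * r < x + y} \<in> sets (E \<Otimes>\<^sub>M E)"
        by (simp add: space_pair_measure spE case_prod_unfold)
    qed
    finally have "measure (E \<Otimes>\<^sub>M E) (D (real c) K) + (measure E ?L * measure E ?U + measure E ?U * measure E ?L) \<le> measure (E \<star> E) {real K * r<..}"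
      unfolding conv by (simp add: times)
    then show ?thesis unfolding mid F_def[of K, symmetric] by (simp add: algebra_simps)
  qed
  have F_lim: "F \<longlonglongrightarrow> 0"
  proof -
    have "(\<lambda>t. measure E {real t * r<..}) \<longlonglongrightarrow> measure E (\<Inter>t. {real t * r<..})"
    proof (rule E.finite_Lim_measure_decseq)
      show "decseq (\<lambda>t. {real t * r<..})"
        unfolding decseq_def using r by (auto intro: le_less_trans[OF mult_right_mono])
    qed (auto simp: E(2))
    also have "(\<Inter>t. {real t * r<..}) = {}"
    proof -
      have "\<exists>t. \<not> real t * r < x" for x using reals_Archimedean3[OF r] by (meson less_not_sym)
      then show ?thesis by auto
    qed
    finally show ?thesis by (simp add: F_def[abs_def])
  qed
  have "0 < e / 4" using e by simp
  from order_tendstoD(2)[OF F_lim this] obtain c where c: "F c \<le> e / 4"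
    unfolding eventually_sequentially by (auto intro: less_imp_le)
  have asy: "(\<lambda>x. measure (E \<star> E) {x<..}) \<sim>[at_top] (\<lambda>x. 2 * measure E {x<..})"
    using sub by (auto simp: subexponential_def)
  have "filterlim (\<lambda>K. real K * r) at_top sequentially"
    using r by real_asymp
  from asymp_equivD_strong[OF asymp_equiv_compose'[OF asy this]] F_pos
  have "(\<lambda>K. measure (E \<star> E) {real K * r<..} / (2 * F K)) \<longlonglongrightarrow> 1"
    by (auto simp: F_def less_imp_neq[THEN not_sym])
  from order_tendstoD(2)[OF this, of "1 + e / 4"] e obtain N where
    N: "\<And>K. K \<ge> N \<Longrightarrow> measure (E \<star> E) {real K * r<..} / (2 * F K) < 1 + e / 4"
    unfolding eventually_sequentially by auto
  show ?thesis unfolding F_def[symmetric]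
  proof (intro exI allI impI)
    fix K assume K: "K \<ge> N + c"
    have "measure (E \<star> E) {real K * r<..} \<le> (1 + e / 4) * (2 * F K)"
      using N[of K] K F_pos[of K] by (simp add: divide_less_eq less_imp_le)
    moreover have "(\<Sum>t\<in>{c..K-c}. F (K - t) * (F t - F (Suc t))) \<le> measure (E \<star> E) {real K * r<..} - 2 * (1 - F c) * F K"
      using K by (intro order_trans[OF sum_le D_le]) auto
    ultimately have "(\<Sum>t\<in>{c..K-c}. F (K - t) * (F t - F (Suc t))) \<le> (e / 2 + 2 * F c) * F K"
      by (simp add: algebra_simps)
    also have "\<dots> \<le> e * F K" using c F_pos[of K] by (intro mult_right_mono) auto
    finally show "(\<Sum>t\<in>{c..K-c}. F (K - t) * (F t - F (Suc t))) \<le> e * F K" .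
  qed
qed

section \<open>Equilibrium distribution, long tails and power scales\<close>

text \<open>By Tonelli the integral of the tail over y > x is the mean of the positive part of
  \<open>X - x\<close>; at x = 0 this gives total mass 1. The density lives on \<open>{0..}\<close>,
  so \<open>{..0}\<close> only contains the null point 0 of the support.\<close>

lemma (in prob_space) equilibrium_properties:
  fixes X :: "'a \<Rightarrow> real"
  assumes X: "integrable M X" and X0: "\<And>\<omega>. \<omega> \<in> space M \<Longrightarrow> 0 \<le> X \<omega>" and pos: "0 < (\<integral>\<omega>. X \<omega> \<partial>M)"
  shows "sets (equilibrium M X) = sets borel"
    and "x \<ge> 0 \<Longrightarrow> measure (equilibrium M X) {x<..} = (\<integral>\<omega>. max 0 (X \<omega> - x) \<partial>M) / (\<integral>\<omega>. X \<omega> \<partial>M)"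
    and "prob_space (equilibrium M X)"
    and "measure (equilibrium M X) {..<0} = 0"
proof -
  have [measurable]: "X \<in> borel_measurable M" using X by simp
  let ?m = "\<integral>\<omega>. X \<omega> \<partial>M"
  let ?f = "\<lambda>y. ennreal (indicator {0..} y * measure M {\<omega> \<in> space M. y < X \<omega>} / ?m)"
  interpret pair_sigma_finite lborel M ..
  show sets: "sets (equilibrium M X) = sets borel" by (simp add: equilibrium_def)
  have meas[measurable]: "(\<lambda>y. measure M {\<omega> \<in> space M. y < X \<omega>}) \<in> borel_measurable borel"
  proof -
    have "(\<lambda>y. - measure M {\<omega> \<in> space M. y < X \<omega>}) \<in> borel_measurable borel"
      by (intro borel_measurable_mono monoI, simp, intro finite_measure_mono) auto
    then show ?thesis by simp
  qed
  have em: "emeasure (equilibrium M X) B = (\<integral>\<^sup>+y. ?f y * indicator B y \<partial>lborel)" if "B \<in> sets borel" for B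
    unfolding equilibrium_def using that by (intro emeasure_density) auto
  have tail: "emeasure (equilibrium M X) {x<..} = ennreal ((\<integral>\<omega>. max 0 (X \<omega> - x) \<partial>M) / ?m)" if x: "0 \<le> x" for x
  proof -
    have "emeasure (equilibrium M X) {x<..} = (\<integral>\<^sup>+y. ennreal (1 / ?m) * (\<integral>\<^sup>+\<omega>. indicator {x<..<X \<omega>} y \<partial>M) \<partial>lborel)"
    proof (subst em, simp, intro nn_integral_cong)
      fix y :: real
      have "(\<integral>\<^sup>+\<omega>. indicator {x<..<X \<omega>} y \<partial>M) = (\<integral>\<^sup>+\<omega>. indicator {x<..} y * indicator {\<omega> \<in> space M. y < X \<omega>} \<omega> \<partial>M)"
        by (intro nn_integral_cong) (auto simp: indicator_def)
      also have "\<dots> = indicator {x<..} y * emeasure M {\<omega> \<in> space M. y < X \<omega>}"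
        by (subst nn_integral_cmult) auto
      finally show "?f y * indicator {x<..} y = ennreal (1 / ?m) * (\<integral>\<^sup>+\<omega>. indicator {x<..<X \<omega>} y \<partial>M)"
        using x pos by (auto simp: emeasure_eq_measure indicator_def ennreal_mult[symmetric])
    qed
    also have "\<dots> = ennreal (1 / ?m) * (\<integral>\<^sup>+y. (\<integral>\<^sup>+\<omega>. indicator {x<..<X \<omega>} y \<partial>M) \<partial>lborel)"
      by (subst nn_integral_cmult) (auto simp: indicator_def greaterThanLessThan_def)
    also have "(\<integral>\<^sup>+y. (\<integral>\<^sup>+\<omega>. indicator {x<..<X \<omega>} y \<partial>M) \<partial>lborel) = (\<integral>\<^sup>+\<omega>. (\<integral>\<^sup>+y. indicator {x<..<X \<omega>} y \<partial>lborel) \<partial>M)"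
      by (rule Fubini'[of "\<lambda>y \<omega>. indicator {x<..<X \<omega>} y", symmetric]) (auto simp: indicator_def greaterThanLessThan_def)
    also have "\<dots> = (\<integral>\<^sup>+\<omega>. ennreal (max 0 (X \<omega> - x)) \<partial>M)"
      by (intro nn_integral_cong) (auto simp: max_def ennreal_neg)
    also have "\<dots> = ennreal (\<integral>\<omega>. max 0 (X \<omega> - x) \<partial>M)"
      using X by (intro nn_integral_eq_integral) auto
    finally show ?thesis using pos by (simp add: ennreal_mult'[symmetric])
  qed
  show "measure (equilibrium M X) {x<..} = (\<integral>\<omega>. max 0 (X \<omega> - x) \<partial>M) / ?m" if "x \<ge> 0"
    using tail[OF that] pos by (simp add: measure_def integral_nonneg_AE)
  have le0: "emeasure (equilibrium M X) {..0} = 0"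
  proof -
    have "emeasure (equilibrium M X) {..0} = (\<integral>\<^sup>+y. 0 \<partial>(lborel :: real measure))"
    proof (subst em, simp, intro nn_integral_cong_AE)
      show "AE y in lborel. ?f y * indicator {..0} y = 0"
        using AE_lborel_singleton[of "0::real"] by eventually_elim (auto simp: indicator_def)
    qed
    then show ?thesis by simp
  qed
  show "measure (equilibrium M X) {..<0} = 0"
  proof -
    have "emeasure (equilibrium M X) {..<0} \<le> emeasure (equilibrium M X) {..0}"
      by (intro emeasure_mono) (auto simp: sets)
    then show ?thesis using le0 by (simp add: measure_def)
  qed
  show "prob_space (equilibrium M X)"
  proof (rule prob_spaceI)
    have "space (equilibrium M X) = {..0} \<union> {0<..}" using sets_eq_imp_space_eq[OF sets] by auto
    then have "emeasure (equilibrium M X) (space (equilibrium M X)) =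
      emeasure (equilibrium M X) {..0} + emeasure (equilibrium M X) {0<..}"
      by (simp only:) (subst plus_emeasure, auto simp: sets)
    also have "(\<integral>\<omega>. max 0 (X \<omega> - 0) \<partial>M) = ?m" using X0 by (intro Bochner_Integration.integral_cong) auto
    then have "emeasure (equilibrium M X) {..0} + emeasure (equilibrium M X) {0<..} = 1"
      using tail[of 0] pos le0 by simp
    finally show "emeasure (equilibrium M X) (space (equilibrium M X)) = 1" .
  qed
qed

text \<open>A long tail decays more slowly than any exponential: from some \<open>z0\<close> on, a
  unit step reduces it by a factor of at least \<open>exp (- \<eta>)\<close>, and this is
  iterated.\<close>

lemma long_tailed_exponential_bound:
  assumes T: "long_tailed T" and anti: "antimono T" and le1: "\<And>z. T z \<le> 1" and \<eta>: "0 < \<eta>"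
  shows "\<exists>C>0. \<forall>z' z. z' \<le> z \<longrightarrow> T z' \<le> C * exp (\<eta> * (z - z')) * T z"
proof -
  have pos: "0 < T z" for z using T by (auto simp: long_tailed_def pos_tail_def)
  have ne: "T z \<noteq> 0" for z using pos[of z] by simp
  have "(\<lambda>x. T (x + 1)) \<sim>[at_top] T" using T by (auto simp: long_tailed_def)
  then have "((\<lambda>x. T (x + 1) / T x) \<longlongrightarrow> 1) at_top"
    by (rule asymp_equivD_strong) (simp add: ne)
  from order_tendstoD(1)[OF this, of "exp (-\<eta>)"] \<eta> obtain z0 where
    z0: "\<And>z. z \<ge> z0 \<Longrightarrow> exp (-\<eta>) < T (z + 1) / T z"
    by (auto simp: eventually_at_top_linorder)
  have step: "T z \<le> exp \<eta> * T (z + 1)" if "z \<ge> z0" for z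
    using z0[OF that] pos[of z] by (simp add: exp_minus field_simps)
  have steps: "T z \<le> exp (\<eta> * real k) * T (z + real k)" if "z \<ge> z0" for z k
  proof (induction k)
    case (Suc k)
    have "T z \<le> exp (\<eta> * real k) * T (z + real k)" by fact
    also have "\<dots> \<le> exp (\<eta> * real k) * (exp \<eta> * T (z + real k + 1))"
      using that by (intro mult_left_mono step) auto
    finally show ?case by (simp add: algebra_simps exp_add)
  qed simp
  have gen: "T z' \<le> exp \<eta> * exp (\<eta> * (z - z')) * T z" if "z0 \<le> z'" "z' \<le> z" for z z'
  proof -
    define k where "k = nat \<lceil>z - z'\<rceil>"
    have k: "z - z' \<le> real k" "real k \<le> z - z' + 1" using that(2) unfolding k_def by linarith+
    have "T z' \<le> exp (\<eta> * real k) * T (z' + real k)" using that by (intro steps)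
    also have "\<dots> \<le> exp (\<eta> * (z - z' + 1)) * T z"
      using k \<eta> pos by (intro mult_mono antimonoD[OF anti]) (auto intro: less_imp_le)
    also have "exp (\<eta> * (z - z' + 1)) = exp \<eta> * exp (\<eta> * (z - z'))"
      by (simp add: exp_add[symmetric] algebra_simps)
    finally show ?thesis .
  qed
  \<comment> \<open>\<open>exp \<eta>\<close> pays for rounding the distance up to an integer,
    \<open>1 / T z0\<close> for arguments below \<open>z0\<close>, where only the bound 1 is
    used.\<close>
  define C where "C = exp \<eta> / T z0"
  have Cge: "exp \<eta> \<le> C" "1 \<le> C * T z0" "0 < C"
    using pos[of z0] le1[of z0] \<eta> by (auto simp: C_def field_simps)
  have "T z' \<le> C * exp (\<eta> * (z - z')) * T z" if zz: "z' \<le> z" for z z'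
  proof -
    consider "z0 \<le> z'" | "z' < z0" "z0 \<le> z" | "z < z0" by linarith
    then show ?thesis
    proof cases
      case 1
      have "T z' \<le> exp \<eta> * exp (\<eta> * (z - z')) * T z" by (rule gen[OF 1 zz])
      also have "\<dots> \<le> C * exp (\<eta> * (z - z')) * T z"
        using Cge pos by (intro mult_right_mono) (auto intro: less_imp_le)
      finally show ?thesis .
    next
      case 2
      have "T z' \<le> T z0 / T z0" using le1[of z'] pos[of z0] by simp
      also have "\<dots> \<le> (exp \<eta> * exp (\<eta> * (z - z0)) * T z) / T z0"
        using pos[of z0] 2 by (intro divide_right_mono gen) auto
      also have "\<dots> = C * exp (\<eta> * (z - z0)) * T z" by (simp add: C_def)
      also have "\<dots> \<le> C * exp (\<eta> * (z - z')) * T z"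
        using 2 \<eta> Cge pos by (intro mult_right_mono mult_left_mono) (auto intro: less_imp_le)
      finally show ?thesis .
    next
      case 3
      have "T z' \<le> 1 * 1" using le1 by simp
      also have "\<dots> \<le> (C * T z0) * exp (\<eta> * (z - z'))"
        using Cge \<eta> zz by (intro mult_mono) auto
      also have "\<dots> \<le> (C * T z) * exp (\<eta> * (z - z'))"
        using 3 Cge antimonoD[OF anti, of z z0] by (intro mult_right_mono mult_left_mono) auto
      finally show ?thesis by (simp add: mult_ac)
    qed
  qed
  with Cge(3) show ?thesis by blast
qed

text \<open>The power is concave on \<open>{0..}\<close>, so it lies above its chord from 0 to
  \<open>x\<close>, that is, \<open>x powr \<theta> * (y / x) \<le> y powr \<theta>\<close>.\<close>

lemma powr_diff_le:
  fixes x y :: real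
  assumes "0 \<le> y" "y \<le> x" "0 < x" "0 < \<theta>" "\<theta> \<le> 1"
  shows "x powr \<theta> - y powr \<theta> \<le> x powr (\<theta> - 1) * (x - y)"
proof -
  have "y / x \<le> (y / x) powr \<theta>"
  proof (cases "y = 0")
    case False
    have "(y / x) powr 1 \<le> (y / x) powr \<theta>" using assms False by (intro powr_mono') auto
    then show ?thesis using assms False by simp
  qed simp
  then have "x powr \<theta> * (y / x) \<le> x powr \<theta> * (y / x) powr \<theta>" by (intro mult_left_mono) auto
  also have "\<dots> = y powr \<theta>" using assms by (simp add: powr_mult[symmetric])
  finally show ?thesis using assms by (simp add: powr_diff field_simps)
qed

text \<open>Take out the factor \<open>x\<close> and use
  \<open>(1 + v) powr \<theta> \<le> 1 + v\<close> for \<open>v \<ge> 0\<close>.\<close>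

lemma powr_add_le:
  fixes x w :: real
  assumes "0 < x" "0 \<le> w" "0 < \<theta>" "\<theta> \<le> 1"
  shows "(x + w * x powr (1 - \<theta>)) powr \<theta> \<le> x powr \<theta> + w"
proof -
  have eq: "x + w * x powr (1 - \<theta>) = x * (1 + w * x powr - \<theta>)"
    using assms by (simp add: algebra_simps powr_diff powr_minus field_simps)
  have "(1 + w * x powr - \<theta>) powr \<theta> \<le> (1 + w * x powr - \<theta>) powr 1"
    using assms by (intro powr_mono) auto
  then have "(x + w * x powr (1 - \<theta>)) powr \<theta> \<le> x powr \<theta> * (1 + w * x powr - \<theta>)"
    unfolding eq using assms by (simp add: powr_mult add_nonneg_nonneg)
  also have "\<dots> = x powr \<theta> + w" using assms by (simp add: algebra_simps powr_minus)
  finally show ?thesis .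
qed

section \<open>The integrated tail of an insensitive period\<close>

text \<open>\<open>tail\<close> and \<open>excess\<close> belong to the scaled period
  \<open>\<mu> * I\<close>, while \<open>power_tail\<close> lives on the scale on which the
  long-tail assumption is made; \<open>tail_conv\<close> connects the two scales.\<close>

locale insensitive_period = prob_space M for M :: "'a measure" +
  fixes I :: "'a \<Rightarrow> nat" and \<theta> \<mu> :: real
  assumes I[measurable]: "I \<in> measurable M (count_space UNIV)"
    and I_pos: "\<And>\<omega>. \<omega> \<in> space M \<Longrightarrow> 1 \<le> I \<omega>"
    and integrable_I: "integrable M (\<lambda>\<omega>. real (I \<omega>))"
    and theta: "0 < \<theta>" "\<theta> \<le> 1" and mu: "0 < \<mu>"
    and long: "long_tailed (\<lambda>x. measure M {\<omega> \<in> space M. x < real (I \<omega>) powr \<theta>})"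
begin

definition tail :: "real \<Rightarrow> real" where
  "tail x = prob {\<omega> \<in> space M. x < \<mu> * real (I \<omega>)}"

definition excess :: "real \<Rightarrow> real" where
  "excess x = (\<integral>\<omega>. max 0 (\<mu> * real (I \<omega>) - x) \<partial>M)"

definition power_tail :: "real \<Rightarrow> real" where
  "power_tail x = prob {\<omega> \<in> space M. x < real (I \<omega>) powr \<theta>}"

lemma tail_conv: "0 \<le> x \<Longrightarrow> tail x = power_tail ((x / \<mu>) powr \<theta>)"
  unfolding tail_def power_tail_def
proof (intro arg_cong[where f = prob] Collect_cong conj_cong refl)
  fix \<omega> assume "0 \<le> x"
  have "x < \<mu> * real (I \<omega>) \<longleftrightarrow> x / \<mu> < real (I \<omega>)" using mu by (simp add: field_simps)
  also have "\<dots> \<longleftrightarrow> (x / \<mu>) powr \<theta> < real (I \<omega>) powr \<theta>"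
  proof
    assume "x / \<mu> < real (I \<omega>)"
    then show "(x / \<mu>) powr \<theta> < real (I \<omega>) powr \<theta>"
      using theta mu \<open>0 \<le> x\<close> by (intro powr_less_mono2) auto
  next
    assume less: "(x / \<mu>) powr \<theta> < real (I \<omega>) powr \<theta>"
    show "x / \<mu> < real (I \<omega>)"
    proof (rule ccontr)
      assume "\<not> x / \<mu> < real (I \<omega>)"
      then have "real (I \<omega>) powr \<theta> \<le> (x / \<mu>) powr \<theta>" using theta by (intro powr_mono2) auto
      with less show False by simp
    qed
  qed
  finally show "x < \<mu> * real (I \<omega>) \<longleftrightarrow> (x / \<mu>) powr \<theta> < real (I \<omega>) powr \<theta>" .
qed

lemma power_tail_bounds: "0 < power_tail x" "power_tail x \<le> 1"
  using long by (auto simp: long_tailed_def pos_tail_def power_tail_def)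

lemma antimono_power_tail: "antimono power_tail"
  unfolding power_tail_def by (intro antimonoI finite_measure_mono) auto

lemma tail_pos: "0 < tail x"
proof (cases "0 \<le> x")
  case False
  have "x < \<mu> * real (I \<omega>)" for \<omega>
  proof -
    have "0 \<le> \<mu> * real (I \<omega>)" using mu by simp
    with False show ?thesis by linarith
  qed
  then have "tail x = prob (space M)"
    unfolding tail_def by (intro arg_cong[where f = prob]) auto
  then show ?thesis by (simp add: prob_space)
qed (simp add: tail_conv power_tail_bounds)

lemma integrable_excess: "integrable M (\<lambda>\<omega>. max 0 (\<mu> * real (I \<omega>) - x))"
  using integrable_I by auto

lemma integrable_mult_indicator_event:
  assumes [measurable]: "B \<in> events"
  shows "integrable M (\<lambda>\<omega>. (w::real) * indicator B \<omega>)"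
proof (rule integrable_const_bound[where B = "\<bar>w\<bar>"])
  show "AE \<omega> in M. norm (w * indicator B \<omega>) \<le> \<bar>w\<bar>"
    by (intro AE_I2) (simp add: indicator_def)
qed measurable

lemma integrable_tail_indicator:
  "integrable M (\<lambda>\<omega>. (w::real) * indicator {\<omega> \<in> space M. x < \<mu> * real (I \<omega>)} \<omega>)"
  by (rule integrable_mult_indicator_event) measurable

lemma excess_ge_tail:
  assumes "0 \<le> w"
  shows "w * tail (x + w) \<le> excess x"
proof -
  have "w * tail (x + w) = (\<integral>\<omega>. w * indicator {\<omega> \<in> space M. x + w < \<mu> * real (I \<omega>)} \<omega> \<partial>M)"
    by (simp add: tail_def Int_absorb1)
  also have "\<dots> \<le> excess x"
    unfolding excess_def
    by (rule integral_mono[OF integrable_tail_indicator integrable_excess])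
       (use assms in \<open>auto simp: indicator_def\<close>)
  finally show ?thesis .
qed

lemma excess_pos: "0 < excess x"
  using excess_ge_tail[of 1 x] tail_pos[of "x + 1"] by simp

lemma excess_shift_le:
  assumes "0 \<le> w"
  shows "excess x \<le> excess (x + w) + w * tail x"
proof -
  have "excess x \<le> (\<integral>\<omega>. max 0 (\<mu> * real (I \<omega>) - (x + w)) + w * indicator {\<omega> \<in> space M. x < \<mu> * real (I \<omega>)} \<omega> \<partial>M)"
    unfolding excess_def
  proof (rule integral_mono[OF integrable_excess])
    show "integrable M (\<lambda>\<omega>. max 0 (\<mu> * real (I \<omega>) - (x + w)) + w * indicator {\<omega> \<in> space M. x < \<mu> * real (I \<omega>)} \<omega>)"
      by (intro Bochner_Integration.integrable_add integrable_excess integrable_tail_indicator)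
  qed (use assms in \<open>auto simp: indicator_def\<close>)
  also have "\<dots> = excess (x + w) + w * tail x"
    unfolding excess_def tail_def
    by (subst Bochner_Integration.integral_add[OF integrable_excess integrable_tail_indicator])
       (simp add: Int_absorb1)
  finally show ?thesis .
qed

lemma excess_antimono: "x \<le> y \<Longrightarrow> excess y \<le> excess x"
  unfolding excess_def by (intro integral_mono integrable_excess) auto

text \<open>Shifting \<open>x\<close> by \<open>w * x powr (1 - \<theta>)\<close> moves \<open>x powr \<theta>\<close> by at most \<open>w\<close>; since the
  \<open>\<theta>\<close>-th power of the period is long-tailed, the excess is therefore eventually at least
  \<open>w / 2 * x powr (1 - \<theta>) * tail x\<close>, for every \<open>w\<close>.\<close>

lemma tail_negligible: "(\<lambda>x::nat. real x powr (1 - \<theta>) * tail x / excess x) \<longlonglongrightarrow> 0"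
proof (rule LIMSEQ_I)
  fix e :: real assume e: "0 < e"
  \<comment> \<open>Half of the tail survives the shift, so the ratio is at most
    \<open>2 / w = e / 2\<close>. Below, \<open>v\<close> is the same shift seen on the scale of
    \<open>I powr \<theta>\<close>.\<close>
  define w where "w = 4 / e"
  have w: "0 < w" using e by (simp add: w_def)
  define v where "v = w / \<mu> powr \<theta>"
  have v: "0 < v" using w mu by (simp add: v_def)
  have ne: "power_tail z \<noteq> 0" for z using power_tail_bounds(1)[of z] by simp
  have "(\<lambda>x. power_tail (x + v)) \<sim>[at_top] power_tail"
    using long v by (auto simp: long_tailed_def power_tail_def[abs_def])
  then have "((\<lambda>x. power_tail (x + v) / power_tail x) \<longlongrightarrow> 1) at_top"
    by (rule asymp_equivD_strong) (simp add: ne)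
  moreover have "filterlim (\<lambda>x::nat. (real x / \<mu>) powr \<theta>) at_top sequentially"
    using mu theta by real_asymp
  ultimately have "(\<lambda>x::nat. power_tail ((real x / \<mu>) powr \<theta> + v) / power_tail ((real x / \<mu>) powr \<theta>)) \<longlonglongrightarrow> 1"
    by (rule filterlim_compose)
  from order_tendstoD(1)[OF this, of "1/2"] obtain N where
    N: "\<And>x::nat. x \<ge> N \<Longrightarrow> 1/2 < power_tail ((real x / \<mu>) powr \<theta> + v) / power_tail ((real x / \<mu>) powr \<theta>)"
    by (auto simp: eventually_sequentially)
  show "\<exists>N. \<forall>x\<ge>N. norm (real x powr (1 - \<theta>) * tail x / excess x - 0) < e"
  proof (intro exI allI impI)
    fix x :: nat assume x: "x \<ge> N + 1"
    define u where "u = w * real x powr (1 - \<theta>)"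
    have u: "0 < u" using x w by (simp add: u_def)
    have "((x + u) / \<mu>) powr \<theta> \<le> (real x / \<mu>) powr \<theta> + v"
    proof -
      have "(x + u) powr \<theta> \<le> real x powr \<theta> + w"
        unfolding u_def using x w theta by (intro powr_add_le) auto
      then show ?thesis using mu x u by (simp add: powr_divide v_def add_divide_distrib[symmetric] divide_right_mono)
    qed
    then have "power_tail ((real x / \<mu>) powr \<theta> + v) \<le> tail (x + u)"
      using u by (simp add: tail_conv antimonoD[OF antimono_power_tail])
    moreover have "tail x / 2 < power_tail ((real x / \<mu>) powr \<theta> + v)"
      using N[of x] x power_tail_bounds(1)[of "(real x / \<mu>) powr \<theta>"] by (simp add: tail_conv field_simps)
    ultimately have "u * (tail x / 2) \<le> u * tail (x + u)" using u by (intro mult_left_mono) auto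
    also have "\<dots> \<le> excess x" using u by (intro excess_ge_tail) auto
    finally have "real x powr (1 - \<theta>) * tail x \<le> e / 2 * excess x"
      using e by (simp add: u_def w_def field_simps)
    then have "real x powr (1 - \<theta>) * tail x / excess x \<le> e / 2"
      using excess_pos[of x] by (simp add: divide_le_eq)
    moreover have "0 \<le> real x powr (1 - \<theta>) * tail x / excess x"
      using excess_pos[of x] tail_pos[of x] by (simp add: less_imp_le)
    ultimately show "norm (real x powr (1 - \<theta>) * tail x / excess x - 0) < e"
      unfolding real_norm_def diff_zero using e by linarith
  qed
qed

lemma tail_div_excess: "(\<lambda>x::nat. tail x / excess x) \<longlonglongrightarrow> 0"
proof (rule tendsto_sandwich[OF _ _ tendsto_const tail_negligible])
  show "\<forall>\<^sub>F x in sequentially. 0 \<le> tail (real x) / excess (real x)"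
    using excess_pos tail_pos by (auto intro!: always_eventually divide_nonneg_nonneg less_imp_le)
  show "\<forall>\<^sub>F x in sequentially. tail (real x) / excess (real x) \<le> real x powr (1 - \<theta>) * tail (real x) / excess (real x)"
    using eventually_ge_at_top[of 1]
  proof eventually_elim
    case (elim x)
    have "1 \<le> real x powr (1 - \<theta>)" using elim theta by (intro ge_one_powr_ge_zero) auto
    from mult_right_mono[OF this less_imp_le[OF tail_pos[of x]]]
    show ?case using excess_pos[of x] by (intro divide_right_mono) auto
  qed
qed

lemma excess_shift_ratio:
  assumes "0 \<le> c"
  shows "(\<lambda>x::nat. excess (x + c) / excess x) \<longlonglongrightarrow> 1"
proof (rule tendsto_sandwich[OF _ _ _ tendsto_const])
  show "(\<lambda>x::nat. 1 - c * (tail x / excess x)) \<longlonglongrightarrow> 1"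
    using tendsto_diff[OF tendsto_const tendsto_mult[OF tendsto_const tail_div_excess], of 1 c] by simp
  show "\<forall>\<^sub>F x in sequentially. 1 - c * (tail (real x) / excess (real x)) \<le> excess (real x + c) / excess (real x)"
  proof (intro always_eventually allI)
    fix x :: nat
    show "1 - c * (tail (real x) / excess (real x)) \<le> excess (real x + c) / excess (real x)"
      using divide_right_mono[OF excess_shift_le[OF assms, of x] less_imp_le[OF excess_pos[of x]]] excess_pos[of x]
      by (simp add: add_divide_distrib)
  qed
  show "\<forall>\<^sub>F x in sequentially. excess (real x + c) / excess (real x) \<le> 1"
    using excess_antimono assms excess_pos by (intro always_eventually allI) (simp add: divide_le_eq)
qed

lemma integrable_light_part:
  assumes "0 < \<eta>"
  shows "integrable M (\<lambda>\<omega>. exp (- \<eta> * (x powr \<theta> - (\<mu> * real (I \<omega>)) powr \<theta>)) * indicator {\<omega> \<in> space M. \<mu> * real (I \<omega>) \<le> x} \<omega>)"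
proof (rule integrable_const_bound[where B = 1])
  have "(\<mu> * real (I \<omega>)) powr \<theta> \<le> x powr \<theta>" if "\<mu> * real (I \<omega>) \<le> x" for \<omega>
    using that mu theta by (intro powr_mono2) auto
  then show "AE \<omega> in M. norm (exp (- \<eta> * (x powr \<theta> - (\<mu> * real (I \<omega>)) powr \<theta>)) * indicator {\<omega> \<in> space M. \<mu> * real (I \<omega>) \<le> x} \<omega>) \<le> 1"
    using assms by (intro AE_I2) (auto simp: indicator_def)
next
  have [measurable]: "{\<omega> \<in> space M. \<mu> * real (I \<omega>) \<le> x} \<in> events" by measurable
  have [measurable]: "(\<lambda>\<omega>. exp (- \<eta> * (x powr \<theta> - (\<mu> * real (I \<omega>)) powr \<theta>))) \<in> borel_measurable M"
    by measurable
  show "(\<lambda>\<omega>. exp (- \<eta> * (x powr \<theta> - (\<mu> * real (I \<omega>)) powr \<theta>)) * indicator {\<omega> \<in> space M. \<mu> * real (I \<omega>) \<le> x} \<omega>) \<in> borel_measurable M"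
    by (intro borel_measurable_times borel_measurable_indicator) fact+
qed

text \<open>Turns the exponential cost of a deviation into a tail. Cut the distance between
  \<open>z\<close> and \<open>I powr \<theta>\<close> into unit layers: layer \<open>k\<close> has
  weight \<open>exp (- \<kappa> * k)\<close>, and lowering the argument of the tail by
  \<open>k + 1\<close> gains at most a factor of order \<open>exp (\<kappa> / 2 * k)\<close>, so the
  layers sum to a geometric series with ratio \<open>q\<close>.\<close>

lemma tail_exponential_moment:
  assumes \<eta>: "0 < \<eta>"
  shows "\<exists>C>0. \<forall>x\<ge>0. exp (- \<eta> * x powr \<theta>) \<le> C * tail x \<and>
     (\<integral>\<omega>. exp (- \<eta> * (x powr \<theta> - (\<mu> * real (I \<omega>)) powr \<theta>)) * indicator {\<omega> \<in> space M. \<mu> * real (I \<omega>) \<le> x} \<omega> \<partial>M) \<le> C * tail x"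
proof -
  \<comment> \<open>The rate on the scale of \<open>z = (x / \<mu>) powr \<theta>\<close>, since
    \<open>\<eta> * x powr \<theta> = \<kappa> * z\<close>.\<close>
  define \<kappa> where "\<kappa> = \<eta> * \<mu> powr \<theta>"
  have \<kappa>: "0 < \<kappa>" using \<eta> mu by (simp add: \<kappa>_def)
  have "long_tailed power_tail" using long by (simp add: power_tail_def[abs_def])
  from long_tailed_exponential_bound[OF this antimono_power_tail power_tail_bounds(2), of "\<kappa> / 2"] \<kappa>
  obtain C where C: "0 < C" "\<And>z' z. z' \<le> z \<Longrightarrow> power_tail z' \<le> C * exp (\<kappa> / 2 * (z - z')) * power_tail z"
    by auto
  define q where "q = exp (- (\<kappa> / 2))"
  have q: "0 < q" "q < 1" using \<kappa> by (auto simp: q_def)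
  \<comment> \<open>The first summand serves the plain exponential, where the tail at 0 is compared
    with that at \<open>z\<close>; the second is the constant of the geometric series.\<close>
  define D where "D = C / power_tail 0 + C * exp (\<kappa> / 2) / (1 - q)"
  have D: "0 < D" using C q power_tail_bounds(1)[of 0] by (auto simp: D_def intro!: add_pos_pos)
  show ?thesis
  proof (intro exI[of _ D] conjI allI impI D)
    fix x :: real assume x: "0 \<le> x"
    define z where "z = (x / \<mu>) powr \<theta>"
    have z: "0 \<le> z" "tail x = power_tail z" using x by (auto simp: z_def tail_conv)
    have xz: "\<eta> * x powr \<theta> = \<kappa> * z" using x mu by (simp add: \<kappa>_def z_def powr_divide)
    have "exp (- \<kappa> * z) * power_tail 0 \<le> exp (- \<kappa> * z) * (C * exp (\<kappa> / 2 * (z - 0)) * power_tail z)"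
      using z by (intro mult_left_mono C) auto
    also have "\<dots> = C * exp (- (\<kappa> / 2) * z) * power_tail z"
    proof -
      have "- \<kappa> * z + \<kappa> / 2 * (z - 0) = - (\<kappa> / 2) * z" by simp
      then have "exp (- \<kappa> * z) * exp (\<kappa> / 2 * (z - 0)) = exp (- (\<kappa> / 2) * z)"
        by (simp only: exp_add[symmetric])
      then show ?thesis by (metis mult.assoc mult.left_commute)
    qed
    also have "\<dots> \<le> C * 1 * power_tail z"
      using C \<kappa> z power_tail_bounds(1) by (intro mult_right_mono mult_left_mono) (auto intro: less_imp_le)
    finally have "exp (- \<kappa> * z) \<le> C / power_tail 0 * power_tail z"
      using power_tail_bounds(1)[of 0] by (simp add: field_simps)
    also have "\<dots> \<le> D * power_tail z"
      using C q power_tail_bounds(1) by (intro mult_right_mono) (auto simp: D_def intro: less_imp_le)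
    finally show "exp (- \<eta> * x powr \<theta>) \<le> D * tail x" using xz z by simp
    let ?Z = "\<lambda>\<omega>. real (I \<omega>) powr \<theta>"
    let ?n = "nat \<lfloor>z\<rfloor>"
    have "(\<integral>\<omega>. exp (- \<eta> * (x powr \<theta> - (\<mu> * real (I \<omega>)) powr \<theta>)) * indicator {\<omega> \<in> space M. \<mu> * real (I \<omega>) \<le> x} \<omega> \<partial>M)
      \<le> (\<integral>\<omega>. (\<Sum>k\<le>?n. exp (- \<kappa> * real k) * indicator {\<omega> \<in> space M. z - real k - 1 < ?Z \<omega>} \<omega>) \<partial>M)"
    proof (rule integral_mono)
      show "integrable M (\<lambda>\<omega>. exp (- \<eta> * (x powr \<theta> - (\<mu> * real (I \<omega>)) powr \<theta>)) * indicator {\<omega> \<in> space M. \<mu> * real (I \<omega>) \<le> x} \<omega>)"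
        by (rule integrable_light_part[OF \<eta>])
      show "integrable M (\<lambda>\<omega>. (\<Sum>k\<le>?n. exp (- \<kappa> * real k) * indicator {\<omega> \<in> space M. z - real k - 1 < ?Z \<omega>} \<omega>))"
        by (intro Bochner_Integration.integrable_sum integrable_mult_indicator_event) measurable
      fix \<omega> assume w: "\<omega> \<in> space M"
      let ?S = "\<Sum>k\<le>?n. exp (- \<kappa> * real k) * indicator {\<omega> \<in> space M. z - real k - 1 < ?Z \<omega>} \<omega>"
      have S0: "0 \<le> ?S" by (intro sum_nonneg) auto
      show "exp (- \<eta> * (x powr \<theta> - (\<mu> * real (I \<omega>)) powr \<theta>)) * indicator {\<omega> \<in> space M. \<mu> * real (I \<omega>) \<le> x} \<omega> \<le> ?S"
      proof (cases "\<mu> * real (I \<omega>) \<le> x")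
        case True
        have Zz: "?Z \<omega> \<le> z"
          unfolding z_def using True mu theta by (intro powr_mono2) (auto simp: field_simps)
        define k where "k = nat \<lfloor>z - ?Z \<omega>\<rfloor>"
        have k: "real k \<le> z - ?Z \<omega>" "z - ?Z \<omega> < real k + 1" using Zz unfolding k_def by linarith+
        have "z - ?Z \<omega> \<le> z" by simp
        then have kn: "k \<le> ?n" unfolding k_def by (intro nat_mono floor_mono)
        have "exp (- \<eta> * (x powr \<theta> - (\<mu> * real (I \<omega>)) powr \<theta>)) = exp (- (\<kappa> * (z - ?Z \<omega>)))"
        proof -
          have "\<eta> * (x powr \<theta> - (\<mu> * real (I \<omega>)) powr \<theta>) = \<kappa> * z - \<eta> * (\<mu> * real (I \<omega>)) powr \<theta>"
            using xz by (simp only: right_diff_distrib)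
          also have "\<dots> = \<kappa> * (z - ?Z \<omega>)"
            using mu by (simp add: \<kappa>_def powr_mult right_diff_distrib)
          finally show ?thesis by simp
        qed
        also have "\<dots> \<le> exp (- \<kappa> * real k)" using k \<kappa> by simp
        also have "\<dots> = exp (- \<kappa> * real k) * indicator {\<omega> \<in> space M. z - real k - 1 < ?Z \<omega>} \<omega>"
          using k w by (simp add: indicator_def)
        also have "\<dots> \<le> ?S"
          using kn by (intro member_le_sum) auto
        finally have "exp (- \<eta> * (x powr \<theta> - (\<mu> * real (I \<omega>)) powr \<theta>)) \<le> ?S" .
        moreover have "indicator {\<omega> \<in> space M. \<mu> * real (I \<omega>) \<le> x} \<omega> = (1::real)" using True w by simp
        ultimately show ?thesis by (simp only: mult_1_right)
      next
        case False
        then have "indicator {\<omega> \<in> space M. \<mu> * real (I \<omega>) \<le> x} \<omega> = (0::real)" by simp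
        with S0 show ?thesis by (simp only: mult_zero_right)
      qed
    qed
    also have "\<dots> = (\<Sum>k\<le>?n. exp (- \<kappa> * real k) * power_tail (z - real k - 1))"
    proof -
      have "(\<integral>\<omega>. (\<Sum>k\<le>?n. exp (- \<kappa> * real k) * indicator {\<omega> \<in> space M. z - real k - 1 < ?Z \<omega>} \<omega>) \<partial>M) =
         (\<Sum>k\<le>?n. \<integral>\<omega>. exp (- \<kappa> * real k) * indicator {\<omega> \<in> space M. z - real k - 1 < ?Z \<omega>} \<omega> \<partial>M)"
      proof (rule Bochner_Integration.integral_sum)
        fix k
        have [measurable]: "{\<omega> \<in> space M. z - real k - 1 < ?Z \<omega>} \<in> events" by measurable
        show "integrable M (\<lambda>\<omega>. exp (- \<kappa> * real k) * indicator {\<omega> \<in> space M. z - real k - 1 < ?Z \<omega>} \<omega>)"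
          by (rule integrable_mult_indicator_event) fact
      qed
      also have "\<dots> = (\<Sum>k\<le>?n. exp (- \<kappa> * real k) * power_tail (z - real k - 1))"
        by (intro sum.cong refl) (simp add: power_tail_def Int_absorb1)
      finally show ?thesis .
    qed
    also have "\<dots> \<le> (\<Sum>k\<le>?n. C * exp (\<kappa> / 2) * power_tail z * q ^ k)"
    proof (rule sum_mono)
      fix k :: nat
      have "exp (- \<kappa> * real k) * power_tail (z - real k - 1) \<le>
            exp (- \<kappa> * real k) * (C * exp (\<kappa> / 2 * (z - (z - real k - 1))) * power_tail z)"
        by (intro mult_left_mono C) auto
      also have "\<dots> = C * power_tail z * (exp (- \<kappa> * real k) * exp (\<kappa> / 2 * (real k + 1)))" by simp
      also have "exp (- \<kappa> * real k) * exp (\<kappa> / 2 * (real k + 1)) = exp (\<kappa> / 2) * q ^ k"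
      proof -
        have "q ^ k = exp (real k * - (\<kappa> / 2))" by (simp only: q_def exp_of_nat_mult)
        moreover have "- \<kappa> * real k + \<kappa> / 2 * (real k + 1) = \<kappa> / 2 + real k * - (\<kappa> / 2)"
          by (simp add: field_simps)
        ultimately show ?thesis by (simp only: exp_add[symmetric])
      qed
      finally show "exp (- \<kappa> * real k) * power_tail (z - real k - 1) \<le> C * exp (\<kappa> / 2) * power_tail z * q ^ k"
        by (simp add: mult_ac)
    qed
    also have "\<dots> = C * exp (\<kappa> / 2) * power_tail z * (\<Sum>k\<le>?n. q ^ k)" by (simp add: sum_distrib_left)
    also have "\<dots> \<le> C * exp (\<kappa> / 2) * power_tail z * (1 / (1 - q))"
    proof (rule mult_left_mono)
      show "(\<Sum>k\<le>?n. q ^ k) \<le> 1 / (1 - q)"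
        using q sum_le_suminf[of "\<lambda>k. q ^ k" "{..?n}"] by (simp add: summable_geometric suminf_geometric)
      show "0 \<le> C * exp (\<kappa> / 2) * power_tail z"
        using C(1) power_tail_bounds(1)[of z] by simp
    qed
    also have "\<dots> = (C * exp (\<kappa> / 2) / (1 - q)) * power_tail z" by simp
    also have "\<dots> \<le> D * power_tail z"
      using C(1) power_tail_bounds(1)[of z] power_tail_bounds(1)[of 0]
      by (intro mult_right_mono) (auto simp: D_def)
    also have "\<dots> = D * tail x" by (simp add: z)
    finally show "(\<integral>\<omega>. exp (- \<eta> * (x powr \<theta> - (\<mu> * real (I \<omega>)) powr \<theta>)) * indicator {\<omega> \<in> space M. \<mu> * real (I \<omega>) \<le> x} \<omega> \<partial>M) \<le> D * tail x" .
  qed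
qed

text \<open>\<open>e n x\<close> stands for the mean excess over \<open>x\<close> of the input of a
  period of length \<open>n\<close>. The lower bound integrates to a shifted excess. In the upper
  bound the light part contributes \<open>x powr (1 - \<theta>)\<close> times a tail; the heavy part
  contributes the excess itself, again such a product, and a fraction
  \<open>x powr (- \<theta>)\<close> of the excess.\<close>

theorem integrated_tail_asymptotics:
  fixes e :: "nat \<Rightarrow> nat \<Rightarrow> real"
  assumes lower: "\<And>n x. 1 \<le> n \<Longrightarrow> max 0 (\<mu> * real n - (real x + c)) \<le> e n x" and c: "0 \<le> c"
    and C: "0 < C" and \<eta>: "0 < \<eta>"
    and light: "\<And>n x. 1 \<le> n \<Longrightarrow> 1 \<le> x \<Longrightarrow> \<mu> * real n \<le> real x \<Longrightarrow>
      e n x \<le> C * (real x powr (1 - \<theta>) * exp (- \<eta> * (real x powr \<theta> - (\<mu> * real n) powr \<theta>)) + exp (- \<eta> * real x powr \<theta>))"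
    and heavy: "\<And>n x. 1 \<le> n \<Longrightarrow> real x < \<mu> * real n \<Longrightarrow> e n x \<le> (\<mu> * real n - real x) + C * real n powr (1 - \<theta>)"
  shows "(\<lambda>x. (\<integral>\<omega>. e (I \<omega>) x \<partial>M) / excess x) \<longlonglongrightarrow> 1"
proof -
  obtain D where D: "0 < D" "\<And>x. 0 \<le> x \<Longrightarrow> exp (- \<eta> * x powr \<theta>) \<le> D * tail x"
    "\<And>x. 0 \<le> x \<Longrightarrow> (\<integral>\<omega>. exp (- \<eta> * (x powr \<theta> - (\<mu> * real (I \<omega>)) powr \<theta>)) * indicator {\<omega> \<in> space M. \<mu> * real (I \<omega>) \<le> x} \<omega> \<partial>M) \<le> D * tail x"
    using tail_exponential_moment[OF \<eta>] by blast
  define k where "k = (2 / \<mu>) powr (1 - \<theta>)"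
  have k: "0 < k" using mu by (simp add: k_def)
  let ?E = "\<lambda>x \<omega>. exp (- \<eta> * (x powr \<theta> - (\<mu> * real (I \<omega>)) powr \<theta>)) * indicator {\<omega> \<in> space M. \<mu> * real (I \<omega>) \<le> x} \<omega>"
  let ?ind = "\<lambda>x. indicator {\<omega> \<in> space M. x < \<mu> * real (I \<omega>)} :: 'a \<Rightarrow> real"
  let ?m = "\<lambda>x \<omega>. max 0 (\<mu> * real (I \<omega>) - x)"
  let ?U = "\<lambda>x \<omega>. ((?m x \<omega> + C * x powr (1 - \<theta>) * ?E x \<omega>) + C * exp (- \<eta> * x powr \<theta>))
      + ((C * k * x powr (1 - \<theta>)) * ?ind x \<omega> + (C * k * x powr (- \<theta>)) * ?m x \<omega>)"
  \<comment> \<open>Split at \<open>\<mu> * n = 2 * x\<close>: below, \<open>n\<close> is comparable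
    with \<open>x\<close>; above, \<open>\<mu> * n - x\<close> is at least half of
    \<open>\<mu> * n\<close>, so \<open>n powr (1 - \<theta>)\<close> is a small fraction of the
    overshoot. The constant \<open>k\<close> comes from this split.\<close>
  have n_le: "real n powr (1 - \<theta>) \<le> k * x powr (1 - \<theta>) + k * x powr (- \<theta>) * (\<mu> * real n - x)"
    if x: "1 \<le> x" "x < \<mu> * real n" for n :: nat and x :: real
  proof -
    have kx: "k * x powr (1 - \<theta>) = (2 * x / \<mu>) powr (1 - \<theta>)"
      using x mu by (simp add: k_def powr_mult[symmetric])
    have nn: "0 \<le> k * x powr (- \<theta>) * (\<mu> * real n - x)" "0 \<le> k * x powr (1 - \<theta>)"
      using x k by auto
    show ?thesis
    proof (cases "\<mu> * real n \<le> 2 * x")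
      case True
      then have "real n \<le> 2 * x / \<mu>" using mu by (simp add: field_simps)
      then have "real n powr (1 - \<theta>) \<le> k * x powr (1 - \<theta>)"
        unfolding kx using theta by (intro powr_mono2) auto
      with nn show ?thesis by linarith
    next
      case False
      have "0 < \<mu> * real n" using x by linarith
      then have n: "0 < real n" using mu by (simp add: zero_less_mult_iff)
      have "real n powr (1 - \<theta>) = real n * real n powr (- \<theta>)"
        using n by (simp add: powr_diff powr_minus divide_inverse)
      also have "\<dots> \<le> real n * (2 * x / \<mu>) powr (- \<theta>)"
        using False mu theta x by (intro mult_left_mono powr_mono2') (auto simp: field_simps)
      also have "\<dots> \<le> (2 / \<mu> * (\<mu> * real n - x)) * (2 * x / \<mu>) powr (- \<theta>)"
        using False mu by (intro mult_right_mono) (auto simp: field_simps)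
      also have "(2 * x / \<mu>) powr (- \<theta>) = (2 / \<mu>) powr (- \<theta>) * x powr (- \<theta>)"
        using x mu by (simp add: powr_mult[symmetric])
      also have "(2 / \<mu> * (\<mu> * real n - x)) * ((2 / \<mu>) powr (- \<theta>) * x powr (- \<theta>)) =
          (2 / \<mu> * (2 / \<mu>) powr (- \<theta>)) * x powr (- \<theta>) * (\<mu> * real n - x)" by (simp only: mult_ac)
      also have "2 / \<mu> * (2 / \<mu>) powr (- \<theta>) = k"
        using mu by (simp add: k_def powr_diff powr_minus divide_inverse)
      finally show ?thesis using nn by linarith
    qed
  qed
  have up: "e (I \<omega>) x \<le> ?U x \<omega>" if w: "\<omega> \<in> space M" and x: "1 \<le> x" for x :: nat and \<omega>
  proof (cases "\<mu> * real (I \<omega>) \<le> x")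
    case True
    have "e (I \<omega>) x \<le> C * (real x powr (1 - \<theta>) * exp (- \<eta> * (real x powr \<theta> - (\<mu> * real (I \<omega>)) powr \<theta>)) + exp (- \<eta> * real x powr \<theta>))"
      by (rule light[OF I_pos[OF w] x True])
    moreover have "?m x \<omega> = 0" "?ind x \<omega> = 0" "indicator {\<omega> \<in> space M. \<mu> * real (I \<omega>) \<le> x} \<omega> = (1::real)"
      using True w by auto
    ultimately show ?thesis by (simp only:) (simp add: algebra_simps)
  next
    case False
    have "e (I \<omega>) x \<le> (\<mu> * real (I \<omega>) - real x) + C * real (I \<omega>) powr (1 - \<theta>)"
      using False by (intro heavy[OF I_pos[OF w]]) auto
    also have "C * real (I \<omega>) powr (1 - \<theta>) \<le> C * (k * real x powr (1 - \<theta>) + k * real x powr (- \<theta>) * (\<mu> * real (I \<omega>) - real x))"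
      using False x C by (intro mult_left_mono n_le) auto
    finally have "e (I \<omega>) x \<le> (\<mu> * real (I \<omega>) - real x) + C * (k * real x powr (1 - \<theta>) + k * real x powr (- \<theta>) * (\<mu> * real (I \<omega>) - real x))"
      by simp
    moreover have "?m x \<omega> = \<mu> * real (I \<omega>) - real x" "?ind x \<omega> = 1"
      "indicator {\<omega> \<in> space M. \<mu> * real (I \<omega>) \<le> x} \<omega> = (0::real)"
      using False w by auto
    moreover have "0 \<le> C * exp (- \<eta> * real x powr \<theta>)" using C by simp
    ultimately show ?thesis by (simp only:) (simp add: algebra_simps)
  qed
  have intU: "integrable M (?U x)" for x
    by (intro Bochner_Integration.integrable_add integrable_mult_right integrable_excess
        integrable_tail_indicator integrable_light_part \<eta> integrable_const)
  have norm_le: "norm a \<le> norm b" if "0 \<le> a" "a \<le> b" for a b :: real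
    using that by simp
  have inte: "integrable M (\<lambda>\<omega>. e (I \<omega>) x)" if "1 \<le> x" for x
  proof (rule Bochner_Integration.integrable_bound[OF intU[of x]])
    show "(\<lambda>\<omega>. e (I \<omega>) x) \<in> borel_measurable M"
      by (rule measurable_compose[OF I]) simp
    show "AE \<omega> in M. norm (e (I \<omega>) x) \<le> norm (?U x \<omega>)"
    proof (rule AE_I2)
      fix \<omega> assume w: "\<omega> \<in> space M"
      have "0 \<le> e (I \<omega>) x" using lower[OF I_pos[OF w], of x] by simp
      then show "norm (e (I \<omega>) x) \<le> norm (?U x \<omega>)" 
        by (rule norm_le[OF _ up[OF w that]])
    qed
  qed
  have lin: "(\<integral>\<omega>. ((f \<omega> + a * g \<omega>) + b) + (c * h \<omega> + d * f \<omega>) \<partial>M) =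
      (((\<integral>\<omega>. f \<omega> \<partial>M) + a * (\<integral>\<omega>. g \<omega> \<partial>M)) + b) + (c * (\<integral>\<omega>. h \<omega> \<partial>M) + d * (\<integral>\<omega>. f \<omega> \<partial>M))"
    if "integrable M f" "integrable M g" "integrable M h" for f g h :: "'a \<Rightarrow> real" and a b c d
    using that by (simp add: prob_space)
  show ?thesis
  proof (rule tendsto_sandwich)
    show "(\<lambda>x::nat. excess (x + c) / excess x) \<longlonglongrightarrow> 1" by (rule excess_shift_ratio[OF c])
    show "(\<lambda>x::nat. 1 + C * D * (real x powr (1 - \<theta>) * tail x / excess x) + C * D * (tail x / excess x)
       + C * k * (real x powr (1 - \<theta>) * tail x / excess x) + C * k * real x powr (- \<theta>)) \<longlonglongrightarrow> 1"
    proof -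
      have "(\<lambda>x::nat. real x powr (- \<theta>)) \<longlonglongrightarrow> 0" using theta by real_asymp
      then have "(\<lambda>x::nat. 1 + C * D * (real x powr (1 - \<theta>) * tail x / excess x) + C * D * (tail x / excess x)
       + C * k * (real x powr (1 - \<theta>) * tail x / excess x) + C * k * real x powr (- \<theta>)) \<longlonglongrightarrow>
         1 + C * D * 0 + C * D * 0 + C * k * 0 + C * k * 0"
        by (intro tendsto_intros tail_negligible tail_div_excess)
      then show ?thesis by simp
    qed
    show "\<forall>\<^sub>F x in sequentially. excess (real x + c) / excess (real x) \<le> (\<integral>\<omega>. e (I \<omega>) x \<partial>M) / excess (real x)"
      using eventually_ge_at_top[of 1]
    proof eventually_elim
      case (elim x)
      have "excess (real x + c) \<le> (\<integral>\<omega>. e (I \<omega>) x \<partial>M)"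
        unfolding excess_def
        by (rule integral_mono[OF integrable_excess inte[OF elim] lower[OF I_pos]])
      then show ?case using excess_pos[of x] by (intro divide_right_mono) auto
    qed
    show "\<forall>\<^sub>F x in sequentially. (\<integral>\<omega>. e (I \<omega>) x \<partial>M) / excess (real x) \<le>
      1 + C * D * (real x powr (1 - \<theta>) * tail x / excess x) + C * D * (tail x / excess x)
       + C * k * (real x powr (1 - \<theta>) * tail x / excess x) + C * k * real x powr (- \<theta>)"
      using eventually_ge_at_top[of 1]
    proof eventually_elim
      case (elim x)
      have "(\<integral>\<omega>. e (I \<omega>) x \<partial>M) \<le> (\<integral>\<omega>. ?U x \<omega> \<partial>M)"
        by (rule integral_mono[OF inte[OF elim] intU up[OF _ elim]])
      also have "\<dots> = ((excess x + C * real x powr (1 - \<theta>) * (\<integral>\<omega>. ?E x \<omega> \<partial>M)) + C * exp (- \<eta> * real x powr \<theta>))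
          + ((C * k * real x powr (1 - \<theta>)) * tail x + (C * k * real x powr (- \<theta>)) * excess x)"
      proof -
        have "integrable M (?ind x)" using integrable_tail_indicator[of 1 "real x"] by simp
        then have "(\<integral>\<omega>. ?U x \<omega> \<partial>M) = ((excess x + C * real x powr (1 - \<theta>) * (\<integral>\<omega>. ?E x \<omega> \<partial>M)) + C * exp (- \<eta> * real x powr \<theta>))
          + ((C * k * real x powr (1 - \<theta>)) * (\<integral>\<omega>. ?ind x \<omega> \<partial>M) + (C * k * real x powr (- \<theta>)) * excess x)"
          unfolding excess_def by (intro lin integrable_excess integrable_light_part \<eta>)
        then show ?thesis by (simp add: tail_def Int_absorb1)
      qed
      also have "\<dots> \<le> ((excess x + C * real x powr (1 - \<theta>) * (D * tail x)) + C * (D * tail x))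
          + ((C * k * real x powr (1 - \<theta>)) * tail x + (C * k * real x powr (- \<theta>)) * excess x)"
        using C by (intro add_mono mult_left_mono D order_refl) auto
      finally have "(\<integral>\<omega>. e (I \<omega>) x \<partial>M) / excess x \<le> \<dots> / excess x"
        using excess_pos[of x] by (intro divide_right_mono) auto
      also have "\<dots> = 1 + C * D * (real x powr (1 - \<theta>) * tail x / excess x) + C * D * (tail x / excess x)
       + C * k * (real x powr (1 - \<theta>) * tail x / excess x) + C * k * real x powr (- \<theta>)"
        using excess_pos[of x] by (simp add: add_divide_distrib mult_ac)
      finally show ?case .
    qed
  qed
qed

end

section \<open>The Poisson equation\<close>

text \<open>Maximum principle: where the maximum is attained, the averaging forces it at every state
  reachable in one step, and by irreducibility everywhere.\<close>

lemma irreducible_fixed_vector_constant: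
  fixes P :: "nat \<Rightarrow> nat \<Rightarrow> real"
  assumes d: "0 < d" and P: "\<And>i j. i < d \<Longrightarrow> j < d \<Longrightarrow> 0 \<le> P i j" and sum1: "\<And>i. i < d \<Longrightarrow> (\<Sum>j<d. P i j) = 1"
    and irr: "irreducible_mat d P" and fixed: "\<And>i. i < d \<Longrightarrow> (\<Sum>j<d. P i j * x j) = x i"
  shows "\<exists>m. \<forall>i<d. x i = m"
proof -
  define m where "m = Max (x ` {..<d})"
  have ne: "x ` {..<d} \<noteq> {}" using d by auto
  have le: "x i \<le> m" if "i < d" for i using that by (auto simp: m_def)
  obtain i0 where i0: "i0 < d" "x i0 = m"
    using Max_in[OF _ ne] by (auto simp: m_def)
  have step: "x j = m" if i: "i < d" "x i = m" and j: "j < d" "0 < P i j" for i j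
  proof -
    have "(\<Sum>j<d. P i j * (m - x j)) = (\<Sum>j<d. P i j) * m - (\<Sum>j<d. P i j * x j)"
      by (simp add: algebra_simps sum_subtractf sum_distrib_left)
    also have "\<dots> = 0" using sum1 fixed i by simp
    finally have "(\<Sum>j<d. P i j * (m - x j)) = 0" .
    then have "\<forall>j\<in>{..<d}. P i j * (m - x j) = 0"
      using P le i by (subst (asm) sum_nonneg_eq_0_iff) auto
    then show ?thesis using j by force
  qed
  have "x j = m" if "j < d" for j
  proof -
    have "(i0, j) \<in> {(a, b). a < d \<and> b < d \<and> 0 < P a b}\<^sup>+"
      using irr i0 that by (auto simp: irreducible_mat_def)
    then show ?thesis
      by (induction rule: trancl_induct) (use i0 step in auto)
  qed
  then show ?thesis by blast
qed

lemma linear_system_solvable: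
  fixes a :: "nat \<Rightarrow> nat \<Rightarrow> 'a :: field"
  assumes inj: "\<And>x. (\<And>i. i < d \<Longrightarrow> (\<Sum>j<d. a i j * x j) = 0) \<Longrightarrow> (\<And>i. i < d \<Longrightarrow> x i = 0)"
  shows "\<exists>x. \<forall>i<d. (\<Sum>j<d. a i j * x j) = b i"
proof -
  let ?A = "mat d d (\<lambda>(i, j). a i j)"
  have A: "?A \<in> carrier_mat d d" by simp
  have prod: "(?A *\<^sub>v v) $ i = (\<Sum>j<d. a i j * v $ j)" if "v \<in> carrier_vec d" "i < d" for v i
    using that by (auto simp: scalar_prod_def atLeast0LessThan)
  have "det ?A \<noteq> 0"
  proof
    assume "det ?A = 0"
    then obtain v where v: "v \<in> carrier_vec d" "v \<noteq> 0\<^sub>v d" "?A *\<^sub>v v = 0\<^sub>v d"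
      using det_0_iff_vec_prod_zero_field[OF A] by blast
    have "v $ i = 0" if "i < d" for i
      by (rule inj[OF _ that]) (use prod[OF v(1)] v(3) in auto)
    then have "v = 0\<^sub>v d" using v(1) by (intro eq_vecI) auto
    with v(2) show False by blast
  qed
  from det_non_zero_imp_unit[OF A this, of "()"]
  obtain B where B: "B \<in> carrier_mat d d" "?A * B = 1\<^sub>m d"
    by (auto simp: Units_def ring_mat_def)
  define v where "v = B *\<^sub>v vec d b"
  have v: "v \<in> carrier_vec d" using B by (auto simp: v_def)
  have "?A *\<^sub>v v = (?A * B) *\<^sub>v vec d b"
    unfolding v_def by (rule assoc_mult_mat_vec[symmetric]) (use B in auto)
  also have "\<dots> = vec d b" using B by simp
  finally have "?A *\<^sub>v v = vec d b" .
  then show ?thesis using prod[OF v] by (intro exI[of _ "\<lambda>i. v $ i"]) auto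
qed

text \<open>The matrix \<open>I - P\<close> with the row \<open>\<phi>\<close> added to every row is
  injective: applying \<open>\<phi>\<close> to a null vector \<open>x\<close> gives
  \<open>\<phi> x = 0\<close>, so \<open>P x = x\<close>, so \<open>x\<close> is constant and hence
  0. The right-hand side has \<open>\<phi>\<close>-mean 0; so has the solution, and the added
  rank-one term drops out.\<close>

lemma poisson_equation:
  fixes P :: "nat \<Rightarrow> nat \<Rightarrow> real"
  assumes d: "0 < d" and P: "\<And>i j. i < d \<Longrightarrow> j < d \<Longrightarrow> 0 \<le> P i j" and sum1: "\<And>i. i < d \<Longrightarrow> (\<Sum>j<d. P i j) = 1"
    and irr: "irreducible_mat d P" and st: "stationary_vec d P \<phi>"
  shows "\<exists>h. (\<forall>i. 0 \<le> h i) \<and> (\<forall>i<d. g i + (\<Sum>j<d. P i j * h j) = (\<Sum>j<d. \<phi> j * g j) + h i)"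
proof -
  have phi1: "(\<Sum>i<d. \<phi> i) = 1" and phiP: "\<And>j. j < d \<Longrightarrow> (\<Sum>i<d. \<phi> i * P i j) = \<phi> j"
    using st by (auto simp: stationary_vec_def)
  have phi_prod: "(\<Sum>i<d. \<phi> i * (\<Sum>j<d. P i j * x j)) = (\<Sum>j<d. \<phi> j * x j)" for x
  proof -
    have "(\<Sum>i<d. \<phi> i * (\<Sum>j<d. P i j * x j)) = (\<Sum>j<d. (\<Sum>i<d. \<phi> i * P i j) * x j)"
      unfolding sum_distrib_left sum_distrib_right by (subst sum.swap) (simp add: mult.assoc)
    then show ?thesis by (simp add: phiP)
  qed
  let ?a = "\<lambda>i j. (if i = j then 1 else 0) - P i j + \<phi> j"
  have a: "(\<Sum>j<d. ?a i j * x j) = x i - (\<Sum>j<d. P i j * x j) + (\<Sum>j<d. \<phi> j * x j)" if "i < d" for i and x :: "nat \<Rightarrow> real"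
  proof -
    have "(\<Sum>j<d. ?a i j * x j) = (\<Sum>j<d. if j = i then x i else 0) - (\<Sum>j<d. P i j * x j) + (\<Sum>j<d. \<phi> j * x j)"
      unfolding sum.distrib[symmetric] sum_subtractf[symmetric]
      by (intro sum.cong) (auto simp: algebra_simps)
    then show ?thesis using that by simp
  qed
  have phi_a: "(\<Sum>j<d. \<phi> j * x j) = (\<Sum>i<d. \<phi> i * b i)"
    if "\<And>i. i < d \<Longrightarrow> (\<Sum>j<d. ?a i j * x j) = b i" for b x :: "nat \<Rightarrow> real"
  proof -
    have "(\<Sum>i<d. \<phi> i * b i) = (\<Sum>i<d. \<phi> i * (x i - (\<Sum>j<d. P i j * x j) + (\<Sum>j<d. \<phi> j * x j)))"
      using that a by (intro sum.cong) auto
    also have "\<dots> = (\<Sum>i<d. \<phi> i * x i) - (\<Sum>i<d. \<phi> i * (\<Sum>j<d. P i j * x j)) + (\<Sum>i<d. \<phi> i) * (\<Sum>j<d. \<phi> j * x j)"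
      by (simp only: ring_distribs sum.distrib sum_subtractf sum_distrib_right)
    finally show ?thesis by (simp add: phi_prod phi1)
  qed
  have "\<exists>x. \<forall>i<d. (\<Sum>j<d. ?a i j * x j) = g i - (\<Sum>j<d. \<phi> j * g j)"
  proof (rule linear_system_solvable)
    fix x :: "nat \<Rightarrow> real" and i assume eq: "\<And>i. i < d \<Longrightarrow> (\<Sum>j<d. ?a i j * x j) = 0" and i: "i < d"
    have phix: "(\<Sum>j<d. \<phi> j * x j) = 0" using phi_a[of x "\<lambda>_. 0"] eq by simp
    have "(\<Sum>j<d. P i j * x j) = x i" if "i < d" for i
      using eq[OF that] a[OF that, of x] phix by simp
    from irreducible_fixed_vector_constant[OF d P sum1 irr this]
    obtain m where m: "\<And>i. i < d \<Longrightarrow> x i = m" by blast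
    have "(\<Sum>j<d. \<phi> j * x j) = (\<Sum>j<d. \<phi> j) * m"
      unfolding sum_distrib_right using m by (intro sum.cong) auto
    then show "x i = 0" using m[OF i] phix phi1 by simp
  qed
  then obtain x where x: "\<And>i. i < d \<Longrightarrow> (\<Sum>j<d. ?a i j * x j) = g i - (\<Sum>j<d. \<phi> j * g j)" by blast
  have "(\<Sum>j<d. \<phi> j * x j) = (\<Sum>i<d. \<phi> i * (g i - (\<Sum>j<d. \<phi> j * g j)))"
    by (rule phi_a[OF x])
  also have "\<dots> = (\<Sum>i<d. \<phi> i * g i) - (\<Sum>i<d. \<phi> i) * (\<Sum>j<d. \<phi> j * g j)"
    by (simp only: ring_distribs sum_subtractf sum_distrib_right)
  finally have "(\<Sum>j<d. \<phi> j * x j) = 0" by (simp add: phi1)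
  then have sol: "x i - (\<Sum>j<d. P i j * x j) = g i - (\<Sum>j<d. \<phi> j * g j)" if "i < d" for i
    using x[OF that] a[OF that, of x] by simp
  \<comment> \<open>Adding a constant keeps the equation because \<open>P\<close> is stochastic; it
    makes \<open>h\<close> nonnegative, as needed in nonnegative integrals and in bounds that
    discard \<open>h\<close>.\<close>
  define B where "B = (\<Sum>i<d. \<bar>x i\<bar>)"
  define h where "h i = (if i < d then x i + B else 0)" for i
  have "0 \<le> h i" for i
  proof (cases "i < d")
    case True
    then have "\<bar>x i\<bar> \<le> B" unfolding B_def by (intro member_le_sum) auto
    then show ?thesis by (auto simp: h_def)
  qed (simp add: h_def)
  moreover have "g i + (\<Sum>j<d. P i j * h j) = (\<Sum>j<d. \<phi> j * g j) + h i" if "i < d" for i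
  proof -
    have "(\<Sum>j<d. P i j * h j) = (\<Sum>j<d. P i j * x j) + (\<Sum>j<d. P i j) * B"
      by (simp add: h_def ring_distribs sum.distrib sum_distrib_right)
    then show ?thesis using sol[OF that] sum1[OF that] that by (simp add: h_def)
  qed
  ultimately show ?thesis by blast
qed

section \<open>Deviations of Markov-modulated sums\<close>

lemma nn_integral_countable_rv:
  fixes X :: "'a \<Rightarrow> 'b :: countable"
  assumes X: "X \<in> measurable M (count_space UNIV)"
  shows "(\<integral>\<^sup>+\<omega>. F (X \<omega>) \<partial>M) = (\<integral>\<^sup>+x. F x * emeasure M {\<omega> \<in> space M. X \<omega> = x} \<partial>count_space UNIV)"
proof -
  have vim: "X -` {x} \<inter> space M = {\<omega> \<in> space M. X \<omega> = x}" for x by auto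
  have "distr M (count_space UNIV) X = density (count_space UNIV) (\<lambda>x. emeasure M {\<omega> \<in> space M. X \<omega> = x})"
  proof (rule measure_eqI_countable[of _ UNIV])
    fix x
    show "emeasure (distr M (count_space UNIV) X) {x} =
      emeasure (density (count_space UNIV) (\<lambda>x. emeasure M {\<omega> \<in> space M. X \<omega> = x})) {x}"
      using X by (simp add: emeasure_distr vim emeasure_density)
  qed (auto simp: countableI_type)
  moreover have "(\<integral>\<^sup>+\<omega>. F (X \<omega>) \<partial>M) = (\<integral>\<^sup>+x. F x \<partial>distr M (count_space UNIV) X)"
    using X by (intro nn_integral_distr[symmetric]) auto
  ultimately show ?thesis
    by (simp add: nn_integral_density mult.commute)
qed

lemma nn_integral_ennreal_count_space:
  assumes "\<And>k. 0 \<le> f k" "f sums (s :: real)"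
  shows "(\<integral>\<^sup>+k. ennreal (f k) \<partial>count_space UNIV) = ennreal s"
proof -
  have "(\<lambda>k. ennreal (f k)) sums ennreal s" using assms by (intro sums_ennreal[THEN iffD2]) (auto intro: sums_le[OF _ sums_zero])
  then show ?thesis by (simp add: nn_integral_count_space_nat sums_iff)
qed

section \<open>The BMAP and its transition operator\<close>

locale bmap_process = prob_space M for M :: "'a measure" +
  fixes d :: nat and \<alpha> :: "nat \<Rightarrow> nat \<Rightarrow> real" and \<Lambda> :: "nat \<Rightarrow> nat \<Rightarrow> nat \<Rightarrow> real"
    and N J :: "nat \<Rightarrow> 'a \<Rightarrow> nat"
  assumes params: "bmap_params d \<alpha> \<Lambda>" and bmap: "is_bmap M N J \<alpha> \<Lambda>"
begin

lemma N_rv[measurable]: "N n \<in> measurable M (count_space UNIV)"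
  and J_rv[measurable]: "J n \<in> measurable M (count_space UNIV)"
  using bmap by (auto simp: is_bmap_def)

lemma Lambda_nonneg: "0 \<le> \<Lambda> k i j" and alpha_nonneg: "0 \<le> \<alpha> k i"
  and Lambda_0: "k = 0 \<or> d \<le> i \<or> d \<le> j \<Longrightarrow> \<Lambda> k i j = 0" and alpha_0: "k = 0 \<or> d \<le> i \<Longrightarrow> \<alpha> k i = 0"
  using params unfolding bmap_params_def by auto

text \<open>The history is a list so that it takes values in a countable type: conditioning on the
  past becomes summation over lists.\<close>

definition path :: "nat \<Rightarrow> 'a \<Rightarrow> (nat \<times> nat) list" where
  "path n \<omega> = map (\<lambda>l. (N l \<omega>, J l \<omega>)) [0..<n]"

lemma path_eq_iff: "path n \<omega> = xs \<longleftrightarrow> length xs = n \<and> (\<forall>l<n. N l \<omega> = fst (xs ! l) \<and> J l \<omega> = snd (xs ! l))"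
  unfolding path_def list_eq_iff_nth_eq by (auto simp: prod_eq_iff)

lemma path_measurable[measurable]: "path n \<in> measurable M (count_space UNIV)"
proof -
  have "path n -` {xs} \<inter> space M \<in> events" for xs
  proof -
    have "path n -` {xs} \<inter> space M = {\<omega> \<in> space M. path n \<omega> = xs}" by auto
    also have "\<dots> \<in> events" unfolding path_eq_iff by measurable
    finally show ?thesis .
  qed
  then show ?thesis by (subst measurable_count_space_eq2_countable) auto
qed

text \<open>The transition operator applied to a function of the next batch and the next phase; the
  result depends on the current phase only. Values in \<open>ennreal\<close> avoid integrability
  conditions.\<close>

definition step :: "(nat \<Rightarrow> nat \<Rightarrow> ennreal) \<Rightarrow> nat \<Rightarrow> ennreal" where
  "step f i = (\<integral>\<^sup>+k. (\<Sum>j<d. f k j * ennreal (\<Lambda> k i j)) \<partial>count_space UNIV)"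

definition initial :: "(nat \<Rightarrow> nat \<Rightarrow> ennreal) \<Rightarrow> ennreal" where
  "initial f = (\<integral>\<^sup>+k. (\<Sum>j<d. f k j * ennreal (\<alpha> k j)) \<partial>count_space UNIV)"

lemma sum_phases:
  assumes "\<And>j. d \<le> j \<Longrightarrow> g j = (0::ennreal)"
  shows "(\<integral>\<^sup>+j. g j \<partial>count_space UNIV) = (\<Sum>j<d. g j)"
proof -
  have "(\<integral>\<^sup>+j. g j \<partial>count_space UNIV) = (\<integral>\<^sup>+j. g j * indicator {..<d} j \<partial>count_space UNIV)"
    using assms by (intro nn_integral_cong) (auto simp: indicator_def not_less)
  also have "\<dots> = (\<integral>\<^sup>+j. g j \<partial>count_space {..<d})"
    by (subst nn_integral_restrict_space[symmetric]) (auto simp: restrict_count_space)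
  finally show ?thesis by (simp add: nn_integral_count_space_finite)
qed

text \<open>The finite-dimensional law is a product, so one more slot contributes one more factor.
  \<open>0 < n\<close> makes the list nonempty, with its last phase as the current one.\<close>

lemma emeasure_path_step:
  assumes n: "0 < n" and len: "length xs = n"
  shows "emeasure M {\<omega> \<in> space M. path n \<omega> = xs \<and> N n \<omega> = k \<and> J n \<omega> = j} =
     emeasure M {\<omega> \<in> space M. path n \<omega> = xs} * ennreal (\<Lambda> k (snd (last xs)) j)"
proof -
  define ks where "ks l = (if l < n then fst (xs ! l) else k)" for l
  define js where "js l = (if l < n then snd (xs ! l) else j)" for l
  have prob_eq: "prob {\<omega> \<in> space M. \<forall>l\<le>m. N l \<omega> = ks l \<and> J l \<omega> = js l} =
      \<alpha> (ks 0) (js 0) * (\<Prod>l\<in>{1..m}. \<Lambda> (ks l) (js (l - 1)) (js l))" for m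
    using bmap by (auto simp: is_bmap_def)
  obtain m where m: "n = Suc m" using n by (cases n) auto
  have "{\<omega> \<in> space M. path n \<omega> = xs} = {\<omega> \<in> space M. \<forall>l\<le>m. N l \<omega> = ks l \<and> J l \<omega> = js l}"
    using len by (auto simp: path_eq_iff m ks_def js_def)
  moreover have "{\<omega> \<in> space M. path n \<omega> = xs \<and> N n \<omega> = k \<and> J n \<omega> = j} =
      {\<omega> \<in> space M. \<forall>l\<le>n. N l \<omega> = ks l \<and> J l \<omega> = js l}"
    using len by (auto simp: path_eq_iff ks_def js_def le_less)
  moreover have "(\<Prod>l\<in>{1..n}. \<Lambda> (ks l) (js (l - 1)) (js l)) =
      (\<Prod>l\<in>{1..m}. \<Lambda> (ks l) (js (l - 1)) (js l)) * \<Lambda> k (snd (last xs)) j"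
  proof -
    have "xs \<noteq> []" using len n by auto
    then have "snd (last xs) = js m" by (simp add: js_def m last_conv_nth len)
    moreover have "ks n = k" "js n = j" by (auto simp: ks_def js_def)
    moreover have "{1..n} = insert n {1..m}" "n \<notin> {1..m}" "n - 1 = m" by (auto simp: m)
    ultimately show ?thesis by (simp add: mult.commute)
  qed
  ultimately show ?thesis
    by (simp add: emeasure_eq_measure prob_eq ennreal_mult[symmetric] Lambda_nonneg alpha_nonneg prod_nonneg mult.assoc)
qed

text \<open>The Markov property in integrated form, \<open>F\<close> being an arbitrary function of
  the history: both sides are sums over histories, and each new slot is summed out against its
  factor.\<close>

lemma nn_integral_step:
  assumes n: "0 < n"
  shows "(\<integral>\<^sup>+\<omega>. F (path n \<omega>) * f (N n \<omega>) (J n \<omega>) \<partial>M) = (\<integral>\<^sup>+\<omega>. F (path n \<omega>) * step f (J (n - 1) \<omega>) \<partial>M)"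
proof -
  let ?p = "\<lambda>xs. emeasure M {\<omega> \<in> space M. path n \<omega> = xs}"
  let ?X = "\<lambda>\<omega>. (path n \<omega>, N n \<omega>, J n \<omega>)"
  have meas: "?X \<in> measurable M (count_space UNIV)"
  proof -
    have "?X -` {z} \<inter> space M \<in> events" for z
    proof -
      have "?X -` {z} \<inter> space M = {\<omega> \<in> space M. path n \<omega> = fst z \<and> N n \<omega> = fst (snd z) \<and> J n \<omega> = snd (snd z)}"
        by (auto simp: prod_eq_iff)
      also have "\<dots> \<in> events" by measurable
      finally show ?thesis .
    qed
    then show ?thesis by (subst measurable_count_space_eq2_countable) auto
  qed
  have "(\<integral>\<^sup>+\<omega>. F (path n \<omega>) * f (N n \<omega>) (J n \<omega>) \<partial>M) =
     (\<integral>\<^sup>+z. F (fst z) * f (fst (snd z)) (snd (snd z)) * emeasure M {\<omega> \<in> space M. ?X \<omega> = z} \<partial>count_space UNIV)"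
    using nn_integral_countable_rv[OF meas, of "\<lambda>z. F (fst z) * f (fst (snd z)) (snd (snd z))"] by simp
  also have "\<dots> = (\<integral>\<^sup>+xs. \<integral>\<^sup>+k. \<integral>\<^sup>+j. F xs * f k j * emeasure M {\<omega> \<in> space M. ?X \<omega> = (xs, k, j)}
      \<partial>count_space UNIV \<partial>count_space UNIV \<partial>count_space UNIV)"
    by (simp add: nn_integral_fst_count_space[symmetric])
  also have "\<dots> = (\<integral>\<^sup>+xs. F xs * step f (snd (last xs)) * ?p xs \<partial>count_space UNIV)"
  proof (intro nn_integral_cong)
    fix xs
    show "(\<integral>\<^sup>+k. \<integral>\<^sup>+j. F xs * f k j * emeasure M {\<omega> \<in> space M. ?X \<omega> = (xs, k, j)} \<partial>count_space UNIV \<partial>count_space UNIV)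
      = F xs * step f (snd (last xs)) * ?p xs"
    proof (cases "length xs = n")
      case True
      have "(\<integral>\<^sup>+k. \<integral>\<^sup>+j. F xs * f k j * emeasure M {\<omega> \<in> space M. ?X \<omega> = (xs, k, j)} \<partial>count_space UNIV \<partial>count_space UNIV)
        = (\<integral>\<^sup>+k. \<integral>\<^sup>+j. (F xs * ?p xs) * (f k j * ennreal (\<Lambda> k (snd (last xs)) j)) \<partial>count_space UNIV \<partial>count_space UNIV)"
        using emeasure_path_step[OF n True] by (intro nn_integral_cong) (simp add: mult_ac)
      also have "\<dots> = (\<integral>\<^sup>+k. (F xs * ?p xs) * (\<Sum>j<d. f k j * ennreal (\<Lambda> k (snd (last xs)) j)) \<partial>count_space UNIV)"
        by (subst sum_phases) (auto simp: Lambda_0 sum_distrib_left)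
      also have "\<dots> = (F xs * ?p xs) * step f (snd (last xs))"
        unfolding step_def by (rule nn_integral_cmult) simp
      finally show ?thesis by (simp add: mult_ac)
    next
      case False
      then have "path n \<omega> \<noteq> xs" for \<omega> by (auto simp: path_eq_iff)
      then have "{\<omega> \<in> space M. ?X \<omega> = (xs, k, j)} = {}" "{\<omega> \<in> space M. path n \<omega> = xs} = {}" for k j
        by auto
      then show ?thesis by (simp only: emeasure_empty mult_zero_right) simp
    qed
  qed
  also have "\<dots> = (\<integral>\<^sup>+\<omega>. F (path n \<omega>) * step f (snd (last (path n \<omega>))) \<partial>M)"
    by (rule nn_integral_countable_rv[OF path_measurable, symmetric])
  also have "\<dots> = (\<integral>\<^sup>+\<omega>. F (path n \<omega>) * step f (J (n - 1) \<omega>) \<partial>M)"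
  proof -
    have "snd (last (path n \<omega>)) = J (n - 1) \<omega>" for \<omega>
      using n by (simp add: path_def last_map)
    then show ?thesis by simp
  qed
  finally show ?thesis .
qed

lemma nn_integral_step1:
  "(\<integral>\<^sup>+\<omega>. f (N (Suc n) \<omega>) (J (Suc n) \<omega>) \<partial>M) = (\<integral>\<^sup>+\<omega>. step f (J n \<omega>) \<partial>M)"
  using nn_integral_step[of "Suc n" "\<lambda>_. 1" f] by simp

lemma nn_integral_initial:
  "(\<integral>\<^sup>+\<omega>. f (N 0 \<omega>) (J 0 \<omega>) \<partial>M) = initial f"
proof -
  let ?X = "\<lambda>\<omega>. (N 0 \<omega>, J 0 \<omega>)"
  have meas: "?X \<in> measurable M (count_space UNIV)"
  proof -
    have "?X -` {z} \<inter> space M \<in> events" for z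
    proof -
      have "?X -` {z} \<inter> space M = {\<omega> \<in> space M. N 0 \<omega> = fst z \<and> J 0 \<omega> = snd z}"
        by (auto simp: prod_eq_iff)
      also have "\<dots> \<in> events" by measurable
      finally show ?thesis .
    qed
    then show ?thesis by (subst measurable_count_space_eq2_countable) auto
  qed
  have p: "emeasure M {\<omega> \<in> space M. ?X \<omega> = (k, j)} = ennreal (\<alpha> k j)" for k j
  proof -
    have "prob {\<omega> \<in> space M. \<forall>l\<le>n. N l \<omega> = ks l \<and> J l \<omega> = js l} =
         \<alpha> (ks 0) (js 0) * (\<Prod>l\<in>{1..n}. \<Lambda> (ks l) (js (l - 1)) (js l))" for n ks js
      using bmap by (auto simp: is_bmap_def)
    from this[of 0 "\<lambda>_. k" "\<lambda>_. j"] show ?thesis by (simp add: emeasure_eq_measure)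
  qed
  have "(\<integral>\<^sup>+\<omega>. f (N 0 \<omega>) (J 0 \<omega>) \<partial>M) = (\<integral>\<^sup>+z. f (fst z) (snd z) * emeasure M {\<omega> \<in> space M. ?X \<omega> = z} \<partial>count_space UNIV)"
    using nn_integral_countable_rv[OF meas, of "\<lambda>z. f (fst z) (snd z)"] by simp
  also have "\<dots> = (\<integral>\<^sup>+k. \<integral>\<^sup>+j. f k j * emeasure M {\<omega> \<in> space M. ?X \<omega> = (k, j)} \<partial>count_space UNIV \<partial>count_space UNIV)"
    by (simp add: nn_integral_fst_count_space[symmetric])
  also have "\<dots> = initial f"
    unfolding p initial_def by (subst sum_phases) (auto simp: alpha_0)
  finally show ?thesis .
qed

text \<open>The law gives weight 0 to empty batches and to phases outside \<open>0..d-1\<close>, so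
  the indicator of such values has integral 0. This makes truncated subtraction in
  \<open>N - 1\<close> exact almost surely.\<close>

lemma AE_range: "AE \<omega> in M. 1 \<le> N n \<omega> \<and> J n \<omega> < d"
proof -
  define f where "f k j = (if 1 \<le> k \<and> j < d then 0 else 1 :: ennreal)" for k j :: nat
  have f0: "step f i = 0" "initial f = 0" for i
    unfolding step_def initial_def f_def by (auto simp: Lambda_0 alpha_0 intro!: nn_integral_zero' AE_I2 sum.neutral)
  have "(\<integral>\<^sup>+\<omega>. f (N n \<omega>) (J n \<omega>) \<partial>M) = 0"
    by (cases n) (simp_all add: nn_integral_step1 nn_integral_initial f0)
  moreover have "(\<lambda>\<omega>. f (N n \<omega>) (J n \<omega>)) \<in> borel_measurable M" unfolding f_def by measurable
  ultimately have "AE \<omega> in M. f (N n \<omega>) (J n \<omega>) = 0" by (simp add: nn_integral_0_iff_AE)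
  then show ?thesis by eventually_elim (auto simp: f_def split: if_splits)
qed

lemma nn_integral_le_const:
  assumes s: "\<And>i. i < d \<Longrightarrow> step f i \<le> c" and i: "initial f \<le> c"
  shows "(\<integral>\<^sup>+\<omega>. f (N n \<omega>) (J n \<omega>) \<partial>M) \<le> c"
proof (cases n)
  case (Suc m)
  have "(\<integral>\<^sup>+\<omega>. step f (J m \<omega>) \<partial>M) \<le> (\<integral>\<^sup>+\<omega>. c \<partial>M)"
    using AE_range[of m] by (intro nn_integral_mono_AE) (auto intro: s elim: eventually_mono)
  then show ?thesis by (simp add: Suc nn_integral_step1 emeasure_space_1)
qed (simp add: nn_integral_initial i)

end

text \<open>For t \<ge> 0 apply \<open>exp t - 1 \<le> t * exp t\<close> twice; for
  \<open>t = - u\<close> compare \<open>exp (- u) \<le> 1 / (1 + u)\<close> with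
  \<open>1 - u + u\<^sup>2\<close>.\<close>

lemma exp_le_quadratic: "exp t \<le> 1 + t + t\<^sup>2 * exp \<bar>t\<bar>" for t :: real
proof (cases "0 \<le> t")
  case True
  have "1 - t \<le> exp (- t)" using exp_ge_add_one_self[of "- t"] by simp
  then have "exp t * (1 - t) \<le> exp t * exp (- t)" by (intro mult_left_mono) auto
  then have 1: "exp t - 1 \<le> t * exp t" by (simp add: exp_add[symmetric] algebra_simps)
  have "t * (exp t - 1) \<le> t * (t * exp t)" using True 1 by (intro mult_left_mono) auto
  with 1 have "exp t - 1 - t \<le> t * (t * exp t)" by (simp add: algebra_simps)
  then show ?thesis using True by (simp add: power2_eq_square mult.assoc)
next
  case False
  define u where "u = - t"
  have u: "0 < u" using False by (simp add: u_def)
  have "1 + u \<le> exp u" by (rule exp_ge_add_one_self)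
  then have "exp (- u) \<le> 1 / (1 + u)" using u by (simp add: exp_minus field_simps)
  also have "\<dots> \<le> 1 - u + u\<^sup>2 * 1"
  proof -
    have "1 \<le> (1 - u + u\<^sup>2) * (1 + u)" using u by (simp add: algebra_simps power2_eq_square)
    then show ?thesis using u by (simp add: divide_le_eq)
  qed
  also have "\<dots> \<le> 1 - u + u\<^sup>2 * exp u" using u by (intro add_left_mono mult_left_mono) auto
  finally show ?thesis using u by (simp add: u_def)
qed

lemma summable_stretched_exponential:
  fixes a c \<theta> :: real
  assumes "0 < a" "0 < \<theta>"
  shows "summable (\<lambda>k::nat. (real k + c)\<^sup>2 * exp (- a * real k powr \<theta>))"
proof (rule summable_comparison_test_bigo)
  show "summable (\<lambda>k. norm (inverse (real k ^ 2)))"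
    using inverse_power_summable[of 2, where 'a = real] by simp
  show "(\<lambda>k. (real k + c)\<^sup>2 * exp (- a * real k powr \<theta>)) \<in> O(\<lambda>k. inverse (real k ^ 2))"
    using assms by real_asymp
qed

section \<open>Exponential moments and deviations for light batches\<close>

text \<open>\<open>drift\<close> is the Poisson equation: given the current phase \<open>i\<close>,
  the next batch plus \<open>h\<close> at the next phase has mean \<open>lam + h i\<close>. Within
  the locale \<open>lam\<close> is known only through this equation.\<close>

locale light_bmap = bmap_process +
  fixes h :: "nat \<Rightarrow> real" and lam hb B b \<theta> :: real
  assumes Lambda_le: "\<Lambda> k i j \<le> B * exp (- b * real k powr \<theta>)"
    and alpha_le: "\<alpha> k i \<le> B * exp (- b * real k powr \<theta>)"
    and B: "0 < B" and b: "0 < b" and theta: "0 < \<theta>" "\<theta> \<le> 1/2" and lam: "1 < lam"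
    and h: "0 \<le> h j" "h j \<le> hb"
    and drift: "i < d \<Longrightarrow> (\<Sum>j<d. \<Sum>k. real k * \<Lambda> k i j) + (\<Sum>j<d. bmap_trans \<Lambda> i j * h j) = lam + h i"
begin

lemma hb: "0 \<le> hb"
  using h[of 0] by linarith

lemma light_sum_le:
  assumes f: "\<And>k j. 0 \<le> f k j" "\<And>k j. j < d \<Longrightarrow> f k j \<le> v k"
    and p: "\<And>k j. 0 \<le> p k j" "\<And>k j. p k j \<le> B * exp (- b * real k powr \<theta>)"
    and v: "summable (\<lambda>k. v k * exp (- b * real k powr \<theta>))"
  shows "(\<integral>\<^sup>+k. (\<Sum>j<d. ennreal (f k j) * ennreal (p k j)) \<partial>count_space UNIV)
     \<le> ennreal (real d * B * (\<Sum>k. v k * exp (- b * real k powr \<theta>)))"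
proof -
  let ?w = "\<lambda>k. real d * B * (v k * exp (- b * real k powr \<theta>))"
  have le: "(\<Sum>j<d. ennreal (f k j) * ennreal (p k j)) \<le> ennreal (?w k)" for k
  proof -
    have "(\<Sum>j<d. ennreal (f k j) * ennreal (p k j)) = ennreal (\<Sum>j<d. f k j * p k j)"
      using f p by (simp add: ennreal_mult[symmetric] sum_ennreal)
    also have "(\<Sum>j<d. f k j * p k j) \<le> (\<Sum>j<d. v k * (B * exp (- b * real k powr \<theta>)))"
    proof (rule sum_mono)
      fix j assume "j \<in> {..<d}"
      then have "f k j \<le> v k" by (intro f) simp
      moreover from this have "0 \<le> v k" using f(1)[of k j] by linarith
      ultimately show "f k j * p k j \<le> v k * (B * exp (- b * real k powr \<theta>))"
        using p by (intro mult_mono)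
    qed
    then have "ennreal (\<Sum>j<d. f k j * p k j) \<le> ennreal (\<Sum>j<d. v k * (B * exp (- b * real k powr \<theta>)))"
      by (rule ennreal_leI)
    finally show ?thesis by (simp add: mult_ac)
  qed
  have w0: "0 \<le> ?w k" for k
  proof (cases "d = 0")
    case False
    then have "0 \<le> v k" using f(1)[of k 0] f(2)[of 0 k] by simp
    then show ?thesis using B by simp
  qed simp
  have "(\<integral>\<^sup>+k. (\<Sum>j<d. ennreal (f k j) * ennreal (p k j)) \<partial>count_space UNIV) \<le> (\<integral>\<^sup>+k. ennreal (?w k) \<partial>count_space UNIV)"
    by (intro nn_integral_mono le)
  also have "\<dots> = ennreal (real d * B * (\<Sum>k. v k * exp (- b * real k powr \<theta>)))"
    by (intro nn_integral_ennreal_count_space w0 sums_mult summable_sums v)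
  finally show ?thesis .
qed

lemma nn_integral_light_le:
  assumes "\<And>k j. 0 \<le> f k j" "\<And>k j. j < d \<Longrightarrow> f k j \<le> v k"
    and "summable (\<lambda>k. v k * exp (- b * real k powr \<theta>))"
  shows "(\<integral>\<^sup>+\<omega>. ennreal (f (N n \<omega>) (J n \<omega>)) \<partial>M) \<le> ennreal (real d * B * (\<Sum>k. v k * exp (- b * real k powr \<theta>)))"
proof (rule nn_integral_le_const[of "\<lambda>k j. ennreal (f k j)"])
  show "step (\<lambda>k j. ennreal (f k j)) i \<le> ennreal (real d * B * (\<Sum>k. v k * exp (- b * real k powr \<theta>)))" for i
    unfolding step_def by (rule light_sum_le) (use assms Lambda_nonneg Lambda_le in auto)
  show "initial (\<lambda>k j. ennreal (f k j)) \<le> ennreal (real d * B * (\<Sum>k. v k * exp (- b * real k powr \<theta>)))"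
    unfolding initial_def by (rule light_sum_le) (use assms alpha_nonneg alpha_le in auto)
qed

text \<open>Half of the decay rate \<open>b\<close> may be spent on tilting; the other half keeps
  the series summable.\<close>

definition \<eta> :: real where "\<eta> = b / 2"

lemma eta_pos: "0 < \<eta>"
  using b by (simp add: \<eta>_def)

text \<open>Dominates the square of a martingale increment with batch \<open>k\<close> times the
  exponential of its tilted absolute value, for all admissible tilts at once;
  \<open>curvature\<close> bounds its conditional mean.\<close>

definition quad :: "nat \<Rightarrow> real" where
  "quad k = (real k + (lam + hb))\<^sup>2 * exp (\<eta> * real k powr \<theta> + \<eta> * (lam + hb))"

definition curvature :: real where
  "curvature = real d * B * (\<Sum>k. quad k * exp (- b * real k powr \<theta>))"

lemma summable_exp_light:
  "summable (\<lambda>k. (real k + c)\<^sup>2 * exp (\<eta> * real k powr \<theta> + c') * exp (- b * real k powr \<theta>))"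
proof -
  have "summable (\<lambda>k. exp c' * ((real k + c)\<^sup>2 * exp (- \<eta> * real k powr \<theta>)))"
    using eta_pos theta by (intro summable_mult summable_stretched_exponential) auto
  moreover have "exp c' * ((real k + c)\<^sup>2 * exp (- \<eta> * real k powr \<theta>)) =
     (real k + c)\<^sup>2 * exp (\<eta> * real k powr \<theta> + c') * exp (- b * real k powr \<theta>)" for k
  proof -
    have "c' + (- \<eta> * real k powr \<theta>) = (\<eta> * real k powr \<theta> + c') + (- b * real k powr \<theta>)"
      by (simp add: \<eta>_def field_simps)
    then have "exp c' * exp (- \<eta> * real k powr \<theta>) = exp (\<eta> * real k powr \<theta> + c') * exp (- b * real k powr \<theta>)"
      by (simp only: exp_add[symmetric])
    then show ?thesis by (metis mult.assoc mult.commute)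
  qed
  ultimately show ?thesis by (simp only:)
qed

lemma curvature_nonneg: "0 \<le> curvature"
  unfolding curvature_def
proof (intro mult_nonneg_nonneg suminf_nonneg)
  show "summable (\<lambda>k. quad k * exp (- b * real k powr \<theta>))"
    unfolding quad_def by (rule summable_exp_light)
qed (use B in \<open>auto simp: quad_def\<close>)

lemma Lambda_sums:
  assumes "i < d"
  shows "(\<lambda>k. \<Sum>j<d. \<Lambda> k i j) sums 1"
proof -
  have "(\<lambda>k. \<Sum>j<d. \<Lambda> k i j) sums (\<Sum>j<d. \<Sum>k. \<Lambda> k i j)"
    using params by (intro sums_sum summable_sums) (auto simp: bmap_params_def)
  then show ?thesis using params assms by (auto simp: bmap_params_def)
qed

lemma summable_mean: "summable (\<lambda>k. real k * \<Lambda> k i j)"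
proof (rule summable_comparison_test')
  show "summable (\<lambda>k. B * ((real k + 1)\<^sup>2 * exp (- b * real k powr \<theta>)))"
    by (intro summable_mult summable_stretched_exponential b theta)
  fix k :: nat
  have "real k \<le> (real k + 1)\<^sup>2" by (simp add: power2_eq_square algebra_simps)
  then have "real k * \<Lambda> k i j \<le> (real k + 1)\<^sup>2 * (B * exp (- b * real k powr \<theta>))"
    by (intro mult_mono Lambda_le Lambda_nonneg) auto
  then show "norm (real k * \<Lambda> k i j) \<le> B * ((real k + 1)\<^sup>2 * exp (- b * real k powr \<theta>))"
    using Lambda_nonneg[of k i j] by (simp add: mult_ac)
qed

lemma drift_sums:
  assumes "i < d"
  shows "(\<lambda>k. \<Sum>j<d. \<Lambda> k i j * (real k + h j)) sums (lam + h i)"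
proof -
  have "(\<lambda>k. \<Sum>j<d. real k * \<Lambda> k i j + \<Lambda> k i j * h j) sums
        (\<Sum>j<d. (\<Sum>k. real k * \<Lambda> k i j) + (\<Sum>k. \<Lambda> k i j) * h j)"
    using params by (intro sums_sum sums_add sums_mult2 summable_sums summable_mean) (auto simp: bmap_params_def)
  moreover have "(\<Sum>j<d. (\<Sum>k. real k * \<Lambda> k i j) + (\<Sum>k. \<Lambda> k i j) * h j) = lam + h i"
    using drift[OF assms] by (simp add: sum.distrib bmap_trans_def)
  ultimately show ?thesis by (simp add: algebra_simps)
qed

text \<open>Second-order expansion of the exponential: by the Poisson equation the first-order terms
  cancel in the mean, and the quadratic term is at most \<open>curvature * s\<^sup>2\<close>.
  Truncation at \<open>y\<close> serves to make the linear tilt \<open>s * min k y\<close> stay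
  below \<open>\<eta> * k powr \<theta>\<close>.\<close>

lemma step_exp_le:
  assumes i: "i < d" and s: "0 \<le> s" "s \<le> \<eta>" and y: "\<And>k. s * real (min k y) \<le> \<eta> * real k powr \<theta>"
  shows "step (\<lambda>k j. ennreal (exp (s * (real (min k y) - lam + h j)))) i \<le>
     ennreal ((1 + curvature * s\<^sup>2) * exp (s * h i))"
proof -
  have sumq: "summable (\<lambda>k. quad k * exp (- b * real k powr \<theta>))"
    unfolding quad_def by (rule summable_exp_light)
  have q0: "0 \<le> quad k" for k by (simp add: quad_def)
  have Lq_le: "(\<Sum>j<d. \<Lambda> k i j * quad k) \<le> real d * B * (quad k * exp (- b * real k powr \<theta>))" for k
  proof -
    have "(\<Sum>j<d. \<Lambda> k i j * quad k) \<le> (\<Sum>j<d. (B * exp (- b * real k powr \<theta>)) * quad k)"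
      by (intro sum_mono mult_right_mono Lambda_le q0)
    then show ?thesis by (simp add: mult_ac)
  qed
  have Lq0: "0 \<le> (\<Sum>j<d. \<Lambda> k i j * quad k)" for k
    by (intro sum_nonneg mult_nonneg_nonneg Lambda_nonneg q0)
  have sumLq: "summable (\<lambda>k. \<Sum>j<d. \<Lambda> k i j * quad k)"
    by (rule summable_comparison_test'[OF summable_mult[OF sumq, of "real d * B"], of 0])
       (use Lq_le Lq0 in auto)
  define W where "W = (\<Sum>k. \<Sum>j<d. \<Lambda> k i j * quad k)"
  have W: "W \<le> curvature"
    unfolding W_def curvature_def suminf_mult[OF sumq, symmetric]
    by (intro suminf_le Lq_le sumLq summable_mult sumq)
  let ?q = "\<lambda>k j. 1 + s * (real k + h j) - s * (lam + h i) + s\<^sup>2 * quad k"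
  have point: "exp (s * (real (min k y) - lam + h j)) \<le> exp (s * h i) * ?q k j" for k j
  proof -
    define D where "D = real (min k y) - lam + h j - h i"
    have "\<bar>D\<bar> \<le> real (min k y) + (lam + hb)"
      unfolding D_def using h[of i] h[of j] lam by (auto simp: abs_le_iff)
    then have D: "\<bar>D\<bar> \<le> real k + (lam + hb)" "s * \<bar>D\<bar> \<le> s * real (min k y) + s * (lam + hb)"
      using s by (auto simp: distrib_left[symmetric] intro!: mult_left_mono)
    have "s * \<bar>D\<bar> \<le> \<eta> * real k powr \<theta> + \<eta> * (lam + hb)"
      using D(2) y[of k] s lam hb mult_right_mono[of s \<eta> "lam + hb"] by linarith
    then have sD: "exp \<bar>s * D\<bar> \<le> exp (\<eta> * real k powr \<theta> + \<eta> * (lam + hb))"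
      using s by (simp add: abs_mult)
    have D2: "D\<^sup>2 \<le> (real k + (lam + hb))\<^sup>2"
      using D(1) power_mono[of "\<bar>D\<bar>" _ 2] by simp
    have "exp (s * D) \<le> 1 + s * D + (s * D)\<^sup>2 * exp \<bar>s * D\<bar>" by (rule exp_le_quadratic)
    also have "(s * D)\<^sup>2 * exp \<bar>s * D\<bar> \<le> (s\<^sup>2 * (real k + (lam + hb))\<^sup>2) * exp (\<eta> * real k powr \<theta> + \<eta> * (lam + hb))"
      unfolding power_mult_distrib using D2 sD by (intro mult_mono) auto
    also have "\<dots> = s\<^sup>2 * quad k" by (simp add: quad_def)
    \<comment> \<open>The first-order term returns to the full batch, for which the Poisson equation
      is exact; this only increases it as s \<ge> 0.\<close>
    also have "s * D \<le> s * (real k - lam + h j - h i)"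
      unfolding D_def using s by (intro mult_left_mono) auto
    finally have "exp (s * D) \<le> ?q k j" by (simp add: algebra_simps)
    then have "exp (s * h i) * exp (s * D) \<le> exp (s * h i) * ?q k j" by (intro mult_left_mono) auto
    moreover have "exp (s * h i) * exp (s * D) = exp (s * (real (min k y) - lam + h j))"
      by (simp add: exp_add[symmetric] D_def algebra_simps)
    ultimately show ?thesis by simp
  qed
  have "(\<lambda>k. (\<Sum>j<d. \<Lambda> k i j) + s * (\<Sum>j<d. \<Lambda> k i j * (real k + h j)) - s * (lam + h i) * (\<Sum>j<d. \<Lambda> k i j)
       + s\<^sup>2 * (\<Sum>j<d. \<Lambda> k i j * quad k)) sums (1 + s * (lam + h i) - s * (lam + h i) * 1 + s\<^sup>2 * W)"
    unfolding W_def
    by (intro sums_add sums_diff sums_mult Lambda_sums drift_sums i summable_sums sumLq)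
  moreover have "(\<Sum>j<d. \<Lambda> k i j) + s * (\<Sum>j<d. \<Lambda> k i j * (real k + h j)) - s * (lam + h i) * (\<Sum>j<d. \<Lambda> k i j)
       + s\<^sup>2 * (\<Sum>j<d. \<Lambda> k i j * quad k) = (\<Sum>j<d. ?q k j * \<Lambda> k i j)" for k
    unfolding sum_distrib_left sum.distrib[symmetric] sum_subtractf[symmetric]
    by (intro sum.cong refl) (simp add: algebra_simps)
  ultimately have sums: "(\<lambda>k. exp (s * h i) * (\<Sum>j<d. ?q k j * \<Lambda> k i j)) sums (exp (s * h i) * (1 + s\<^sup>2 * W))"
    by (intro sums_mult) simp
  have qL: "0 \<le> exp (s * h i) * ?q k j" for k j
    by (rule order_trans[OF _ point]) simp
  have "step (\<lambda>k j. ennreal (exp (s * (real (min k y) - lam + h j)))) i \<le>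
     (\<integral>\<^sup>+k. ennreal (exp (s * h i) * (\<Sum>j<d. ?q k j * \<Lambda> k i j)) \<partial>count_space UNIV)"
    unfolding step_def
  proof (rule nn_integral_mono)
    fix k
    have "(\<Sum>j<d. ennreal (exp (s * (real (min k y) - lam + h j))) * ennreal (\<Lambda> k i j)) =
       ennreal (\<Sum>j<d. exp (s * (real (min k y) - lam + h j)) * \<Lambda> k i j)"
      using Lambda_nonneg by (simp add: ennreal_mult[symmetric] sum_ennreal)
    also have "\<dots> \<le> ennreal (\<Sum>j<d. (exp (s * h i) * ?q k j) * \<Lambda> k i j)"
      by (intro ennreal_leI sum_mono mult_right_mono point Lambda_nonneg)
    finally show "(\<Sum>j<d. ennreal (exp (s * (real (min k y) - lam + h j))) * ennreal (\<Lambda> k i j)) \<le>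
       ennreal (exp (s * h i) * (\<Sum>j<d. ?q k j * \<Lambda> k i j))"
      by (simp add: sum_distrib_left mult.assoc)
  qed
  also have "\<dots> = ennreal (exp (s * h i) * (1 + s\<^sup>2 * W))"
  proof (rule nn_integral_ennreal_count_space[OF _ sums])
    fix k
    have "0 \<le> (\<Sum>j<d. (exp (s * h i) * ?q k j) * \<Lambda> k i j)"
      by (intro sum_nonneg mult_nonneg_nonneg qL Lambda_nonneg)
    then show "0 \<le> exp (s * h i) * (\<Sum>j<d. ?q k j * \<Lambda> k i j)"
      by (simp add: sum_distrib_left mult.assoc)
  qed
  also have "\<dots> \<le> ennreal ((1 + curvature * s\<^sup>2) * exp (s * h i))"
  proof (rule ennreal_leI)
    have "s\<^sup>2 * W \<le> s\<^sup>2 * curvature" using W by (intro mult_left_mono) auto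
    then have "exp (s * h i) * (1 + s\<^sup>2 * W) \<le> exp (s * h i) * (1 + s\<^sup>2 * curvature)" by (intro mult_left_mono) auto
    then show "exp (s * h i) * (1 + s\<^sup>2 * W) \<le> (1 + curvature * s\<^sup>2) * exp (s * h i)" by (simp add: mult_ac)
  qed
  finally show ?thesis .
qed

definition S :: "nat \<Rightarrow> 'a \<Rightarrow> nat" where "S n \<omega> = (\<Sum>l<n. N l \<omega> - 1)"

lemma S_rv[measurable]: "S n \<in> measurable M (count_space UNIV)"
  unfolding S_def by measurable

text \<open>\<open>s\<close> times the centred sum plus \<open>h\<close> at the last phase, with
  batches cut at \<open>y\<close>; without the cut this sum is the martingale of the Poisson
  equation. It is used for \<open>n \<ge> 1\<close>, when \<open>n - 1\<close> is the last
  slot.\<close>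

definition tilted :: "real \<Rightarrow> nat \<Rightarrow> nat \<Rightarrow> 'a \<Rightarrow> real" where
  "tilted s y n \<omega> = s * ((\<Sum>l<n. real (min (N l \<omega>) y) - lam) + h (J (n - 1) \<omega>))"

lemma tilted_measurable[measurable]: "tilted s y n \<in> borel_measurable M"
  unfolding tilted_def by measurable

definition initial_bound :: real where
  "initial_bound = real d * B * (\<Sum>k. exp (\<eta> * real k powr \<theta> + \<eta> * hb) * exp (- b * real k powr \<theta>))"

lemma summable_exp: "summable (\<lambda>k. exp (\<eta> * real k powr \<theta> + \<eta> * hb) * exp (- b * real k powr \<theta>))"
proof (rule summable_comparison_test'[OF summable_exp_light[of 1 "\<eta> * hb"], of 0])
  fix k :: nat
  have "1 \<le> (real k + 1)\<^sup>2" by (simp add: power2_eq_square algebra_simps)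
  from mult_right_mono[OF this, of "exp (\<eta> * real k powr \<theta> + \<eta> * hb) * exp (- b * real k powr \<theta>)"]
  show "norm (exp (\<eta> * real k powr \<theta> + \<eta> * hb) * exp (- b * real k powr \<theta>)) \<le>
      (real k + 1)\<^sup>2 * exp (\<eta> * real k powr \<theta> + \<eta> * hb) * exp (- b * real k powr \<theta>)"
    by (simp add: mult.assoc)
qed

lemma initial_bound_nonneg: "0 \<le> initial_bound"
  unfolding initial_bound_def using B by (intro mult_nonneg_nonneg suminf_nonneg summable_exp) auto

text \<open>Each transition costs one factor \<open>1 + curvature * s\<^sup>2\<close>. The first of
  the \<open>Suc n\<close> slots follows the law \<alpha> instead and is covered by
  \<open>initial_bound\<close>, hence the exponent \<open>n\<close>.\<close>

lemma nn_integral_tilted_le: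
  assumes s: "0 \<le> s" "s \<le> \<eta>" and y: "\<And>k. s * real (min k y) \<le> \<eta> * real k powr \<theta>"
  shows "(\<integral>\<^sup>+\<omega>. ennreal (exp (tilted s y (Suc n) \<omega>)) \<partial>M) \<le>
    ennreal (initial_bound * (1 + curvature * s\<^sup>2) ^ n)"
proof (induction n)
  case 0
  have "(\<integral>\<^sup>+\<omega>. ennreal (exp (s * (real (min (N 0 \<omega>) y) - lam + h (J 0 \<omega>)))) \<partial>M) \<le> ennreal initial_bound"
    unfolding initial_bound_def
  proof (rule nn_integral_light_le[OF _ _ summable_exp])
    fix k j
    have "s * (real (min k y) - lam + h j) \<le> s * real (min k y) + s * h j"
      using s lam by (simp add: algebra_simps)
    also have "\<dots> \<le> \<eta> * real k powr \<theta> + \<eta> * hb"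
      using s h[of j] by (intro add_mono y mult_mono) auto
    finally show "exp (s * (real (min k y) - lam + h j)) \<le> exp (\<eta> * real k powr \<theta> + \<eta> * hb)" by simp
  qed simp
  then show ?case by (simp add: tilted_def)
next
  case (Suc n)
  define F where "F xs = ennreal (exp (s * (\<Sum>l<Suc n. real (min (fst (xs ! l)) y) - lam)))" for xs :: "(nat \<times> nat) list"
  define f where "f k j = ennreal (exp (s * (real (min k y) - lam + h j)))" for k j
  have F_path: "F (path (Suc n) \<omega>) = ennreal (exp (s * (\<Sum>l<Suc n. real (min (N l \<omega>) y) - lam)))" for \<omega>
  proof -
    have "path (Suc n) \<omega> ! l = (N l \<omega>, J l \<omega>)" if "l < Suc n" for l
      using that by (simp add: path_def del: upt_Suc)
    then have "(\<Sum>l<Suc n. real (min (fst (path (Suc n) \<omega> ! l)) y) - lam) = (\<Sum>l<Suc n. real (min (N l \<omega>) y) - lam)"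
      by (intro sum.cong refl) simp
    then show ?thesis unfolding F_def by (simp only:)
  qed
  have "(\<integral>\<^sup>+\<omega>. ennreal (exp (tilted s y (Suc (Suc n)) \<omega>)) \<partial>M) =
     (\<integral>\<^sup>+\<omega>. F (path (Suc n) \<omega>) * f (N (Suc n) \<omega>) (J (Suc n) \<omega>) \<partial>M)"
  proof (rule nn_integral_cong)
    fix \<omega>
    have "tilted s y (Suc (Suc n)) \<omega> = s * (\<Sum>l<Suc n. real (min (N l \<omega>) y) - lam)
        + s * (real (min (N (Suc n) \<omega>) y) - lam + h (J (Suc n) \<omega>))"
      unfolding tilted_def by (simp add: algebra_simps)
    then show "ennreal (exp (tilted s y (Suc (Suc n)) \<omega>)) = F (path (Suc n) \<omega>) * f (N (Suc n) \<omega>) (J (Suc n) \<omega>)"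
      unfolding F_path f_def by (simp only: exp_add ennreal_mult[symmetric] exp_ge_zero)
  qed
  also have "\<dots> = (\<integral>\<^sup>+\<omega>. F (path (Suc n) \<omega>) * step f (J n \<omega>) \<partial>M)"
    by (subst nn_integral_step) auto
  also have "\<dots> \<le> (\<integral>\<^sup>+\<omega>. ennreal (1 + curvature * s\<^sup>2) * ennreal (exp (tilted s y (Suc n) \<omega>)) \<partial>M)"
  proof (rule nn_integral_mono_AE)
    show "AE \<omega> in M. F (path (Suc n) \<omega>) * step f (J n \<omega>) \<le>
       ennreal (1 + curvature * s\<^sup>2) * ennreal (exp (tilted s y (Suc n) \<omega>))"
      using AE_range[of n]
    proof eventually_elim
      case (elim \<omega>)
      have "step f (J n \<omega>) \<le> ennreal ((1 + curvature * s\<^sup>2) * exp (s * h (J n \<omega>)))"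
        unfolding f_def using elim by (intro step_exp_le s y) auto
      then have "F (path (Suc n) \<omega>) * step f (J n \<omega>) \<le> F (path (Suc n) \<omega>) * ennreal ((1 + curvature * s\<^sup>2) * exp (s * h (J n \<omega>)))"
        by (intro mult_left_mono) auto
      also have "\<dots> = ennreal (1 + curvature * s\<^sup>2) * ennreal (exp (tilted s y (Suc n) \<omega>))"
      proof -
        have "exp (tilted s y (Suc n) \<omega>) = exp (s * (\<Sum>l<Suc n. real (min (N l \<omega>) y) - lam)) * exp (s * h (J n \<omega>))"
          by (simp only: tilted_def distrib_left exp_add diff_Suc_1)
        then show ?thesis unfolding F_path using curvature_nonneg
          by (simp only: ennreal_mult[symmetric] exp_ge_zero mult_nonneg_nonneg add_nonneg_nonneg zero_le_one zero_le_power2 mult_ac)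
      qed
      finally show ?case .
    qed
  qed
  also have "\<dots> = ennreal (1 + curvature * s\<^sup>2) * (\<integral>\<^sup>+\<omega>. ennreal (exp (tilted s y (Suc n) \<omega>)) \<partial>M)"
    by (rule nn_integral_cmult) measurable
  also have "\<dots> \<le> ennreal (1 + curvature * s\<^sup>2) * ennreal (initial_bound * (1 + curvature * s\<^sup>2) ^ n)"
    by (intro mult_left_mono Suc) auto
  also have "\<dots> = ennreal (initial_bound * (1 + curvature * s\<^sup>2) ^ Suc n)"
    using curvature_nonneg initial_bound_nonneg
    by (subst ennreal_mult[symmetric]) (auto simp: mult_ac)
  finally show ?case .
qed

definition excess_const :: real where
  "excess_const = real d * B * (\<Sum>k. (real k + 1)\<^sup>2 * exp (- \<eta> * real k powr \<theta>))"

text \<open>The price of undoing the truncation: for batches \<open>k > y\<close> half of the decay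
  rate gives \<open>exp (- \<eta> * y powr \<theta>)\<close>, the other half keeps the sum
  finite.\<close>

lemma nn_integral_excess_le:
  "(\<integral>\<^sup>+\<omega>. ennreal (real (N n \<omega> - y)) \<partial>M) \<le> ennreal (excess_const * exp (- \<eta> * real y powr \<theta>))"
proof -
  let ?v = "\<lambda>k. if y < k then real k else 0"
  have le: "?v k * exp (- b * real k powr \<theta>) \<le> exp (- \<eta> * real y powr \<theta>) * ((real k + 1)\<^sup>2 * exp (- \<eta> * real k powr \<theta>))" for k
  proof (cases "y < k")
    case True
    have "real y powr \<theta> \<le> real k powr \<theta>" using True theta by (intro powr_mono2) auto
    then have "\<eta> * real y powr \<theta> \<le> \<eta> * real k powr \<theta>" using eta_pos by (intro mult_left_mono) auto
    then have "exp (- b * real k powr \<theta>) \<le> exp (- \<eta> * real y powr \<theta> + - \<eta> * real k powr \<theta>)"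
      by (simp add: \<eta>_def)
    moreover have "real k \<le> (real k + 1)\<^sup>2" by (simp add: power2_eq_square algebra_simps)
    ultimately have "real k * exp (- b * real k powr \<theta>) \<le> (real k + 1)\<^sup>2 * exp (- \<eta> * real y powr \<theta> + - \<eta> * real k powr \<theta>)"
      by (intro mult_mono) auto
    then show ?thesis using True by (simp only: exp_add if_True mult_ac)
  qed simp
  have sum: "summable (\<lambda>k. (real k + 1)\<^sup>2 * exp (- \<eta> * real k powr \<theta>))"
    using eta_pos theta by (intro summable_stretched_exponential)
  have sumv: "summable (\<lambda>k. ?v k * exp (- b * real k powr \<theta>))"
    by (rule summable_comparison_test'[OF summable_mult[OF sum, of "exp (- \<eta> * real y powr \<theta>)"], of 0])
       (use le in \<open>auto simp: abs_mult\<close>)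
  have "(\<integral>\<^sup>+\<omega>. ennreal (real (N n \<omega> - y)) \<partial>M) \<le> ennreal (real d * B * (\<Sum>k. ?v k * exp (- b * real k powr \<theta>)))"
    by (rule nn_integral_light_le[of "\<lambda>k j. real (k - y)", OF _ _ sumv]) auto
  also have "\<dots> \<le> ennreal (real d * B * (exp (- \<eta> * real y powr \<theta>) * (\<Sum>k. (real k + 1)\<^sup>2 * exp (- \<eta> * real k powr \<theta>))))"
    unfolding suminf_mult[OF sum, symmetric] using B
    by (intro ennreal_leI mult_left_mono suminf_le le sumv summable_mult sum) auto
  finally show ?thesis by (simp add: excess_const_def mult_ac)
qed

lemma excess_const_nonneg: "0 \<le> excess_const"
  unfolding excess_const_def using B eta_pos theta
  by (intro mult_nonneg_nonneg suminf_nonneg summable_stretched_exponential) auto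

text \<open>An exponential Markov bound for the truncated sum plus the mean of what was cut off. The
  factor \<open>y powr (1 - \<theta>)\<close> is \<open>1 / s\<close> up to a constant, the price of
  bounding a mean excess and not only a probability. The level \<open>y\<close> stays free above
  \<open>n\<close>, so that it can be tied to the threshold or to the length.\<close>

theorem deviation_bound:
  "\<exists>C>0. \<exists>\<kappa>>0. \<forall>n y u. 1 \<le> n \<longrightarrow> n \<le> y \<longrightarrow> 0 \<le> u \<longrightarrow>
     (\<integral>\<^sup>+\<omega>. ennreal (max 0 (real (S n \<omega>) - (lam - 1) * real n - u)) \<partial>M) \<le>
     ennreal (C * (real y powr (1 - \<theta>) * exp (- \<kappa> * (real y powr (\<theta> - 1) * u)) + exp (- \<kappa> * real y powr \<theta>)))"
proof -
  define \<kappa> where "\<kappa> = \<eta> / 2"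
  have \<kappa>: "0 < \<kappa>" "\<kappa> \<le> \<eta>" using eta_pos by (auto simp: \<kappa>_def)
  define K1 where "K1 = initial_bound * exp (curvature * \<eta>\<^sup>2) / \<eta>"
  have K1: "0 \<le> K1" using initial_bound_nonneg eta_pos by (simp add: K1_def)
  \<comment> \<open>Absorbs the number \<open>n \<le> y\<close> of truncated slots; this is why the
    final rate \<open>\<kappa>\<close> is half of \<open>\<eta>\<close>.\<close>
  obtain K3 where K3: "0 < K3" "\<And>k. (real k + 1)\<^sup>2 * exp (- \<kappa> * real k powr \<theta>) \<le> K3"
  proof -
    have "(\<lambda>k. (real k + 1)\<^sup>2 * exp (- \<kappa> * real k powr \<theta>)) \<longlonglongrightarrow> 0"
      by (rule summable_LIMSEQ_zero[OF summable_stretched_exponential[OF \<kappa>(1) theta(1)]])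
    then have "Bseq (\<lambda>k. (real k + 1)\<^sup>2 * exp (- \<kappa> * real k powr \<theta>))"
      by (intro convergent_imp_Bseq convergentI)
    then obtain K where "0 < K" "\<And>k. \<bar>(real k + 1)\<^sup>2 * exp (- \<kappa> * real k powr \<theta>)\<bar> \<le> K"
      by (auto simp: Bseq_def)
    then show ?thesis by (intro that[of K]) (auto intro: order_trans[OF abs_ge_self])
  qed
  define C where "C = K1 + excess_const * K3 + 1"
  have C: "0 < C" "K1 \<le> C" "excess_const * K3 \<le> C"
    using K1 K3(1) excess_const_nonneg by (auto simp: C_def intro: add_nonneg_pos)
  show ?thesis
  proof (rule exI[of _ C], intro conjI C(1), rule exI[of _ \<kappa>], intro conjI allI impI \<kappa>(1))
    fix n y :: nat and u :: real
    assume n: "1 \<le> n" and y: "n \<le> y" and u: "0 \<le> u"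
    define s where "s = \<eta> * real y powr (\<theta> - 1)"
    have y1: "1 \<le> real y" using n y by simp
    have s: "0 < s" "s \<le> \<eta>"
    proof -
      show "0 < s" using eta_pos y1 by (simp add: s_def)
      have "real y powr (\<theta> - 1) \<le> real y powr 0" using y1 theta by (intro powr_mono) auto
      then show "s \<le> \<eta>" using eta_pos y1 by (simp add: s_def mult_left_le)
    qed
    \<comment> \<open>By concavity the line of slope
      \<open>s = \<eta> * y powr (\<theta> - 1)\<close>, which meets the curve
      \<open>\<eta> * k powr \<theta>\<close> at \<open>k = y\<close>, lies below it up to
      \<open>y\<close>; beyond \<open>y\<close> the left side stays constant.\<close>
    have sk: "s * real (min k y) \<le> \<eta> * real k powr \<theta>" for k
    proof -
      have "real y powr (\<theta> - 1) * real (min k y) \<le> real k powr \<theta>"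
      proof (cases "k \<le> y")
        case True
        show ?thesis
        proof (cases "k = 0")
          case False
          have "real y powr (\<theta> - 1) * real k \<le> real k powr (\<theta> - 1) * real k"
            using True False theta by (intro mult_right_mono powr_mono2') auto
          also have "\<dots> = real k powr \<theta>" using False by (simp add: powr_diff)
          finally show ?thesis using True by (simp add: min_def)
        qed simp
      next
        case False
        have "real y powr (\<theta> - 1) * real y = real y powr \<theta>" using y1 by (simp add: powr_diff)
        also have "\<dots> \<le> real k powr \<theta>" using False theta by (intro powr_mono2) auto
        finally show ?thesis using False by (simp add: min_def)
      qed
      then show ?thesis unfolding s_def mult.assoc using eta_pos by (intro mult_left_mono) auto
    qed
    obtain m where m: "n = Suc m" using n by (cases n) auto
    \<comment> \<open>This is where \<theta> \<le> 1/2 enters: \<open>m * s\<^sup>2\<close> is at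
      most \<open>\<eta>\<^sup>2 * y powr (2 * \<theta> - 1)\<close> because
      \<open>m \<le> y\<close>.\<close>
    have growth: "(1 + curvature * s\<^sup>2) ^ m \<le> exp (curvature * \<eta>\<^sup>2)"
    proof -
      have "(1 + curvature * s\<^sup>2) ^ m \<le> exp (curvature * s\<^sup>2) ^ m"
        using curvature_nonneg by (intro power_mono exp_ge_add_one_self) auto
      also have "\<dots> = exp (curvature * (real m * s\<^sup>2))" by (simp add: exp_of_nat_mult[symmetric] mult_ac)
      also have "real m * s\<^sup>2 \<le> \<eta>\<^sup>2"
      proof -
        have "real m * s\<^sup>2 \<le> real y * s\<^sup>2" using m y by (intro mult_right_mono) auto
        also have "\<dots> = \<eta>\<^sup>2 * (real y powr 1 * real y powr (\<theta> - 1) * real y powr (\<theta> - 1))"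
          using y1 by (simp add: s_def power2_eq_square mult_ac)
        also have "real y powr 1 * real y powr (\<theta> - 1) * real y powr (\<theta> - 1) = real y powr (2 * \<theta> - 1)"
          unfolding powr_add[symmetric] by (simp add: algebra_simps)
        also have "\<eta>\<^sup>2 * real y powr (2 * \<theta> - 1) \<le> \<eta>\<^sup>2 * real y powr 0"
          using y1 theta by (intro mult_left_mono powr_mono) auto
        finally show ?thesis using y1 by simp
      qed
      then have "exp (curvature * (real m * s\<^sup>2)) \<le> exp (curvature * \<eta>\<^sup>2)"
        using curvature_nonneg by (simp add: mult_left_mono)
      finally show ?thesis by simp
    qed
    \<comment> \<open>Each batch is split as \<open>min N y + (N - y)\<close>. The truncated sum
      \<open>W\<close> includes the nonnegative \<open>h\<close>, and its positive part beyond
      \<open>u\<close> is bounded by \<open>exp (s * (W - u)) / s\<close>, from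
      \<open>t \<le> exp t\<close>.\<close>
    have point: "AE \<omega> in M. ennreal (max 0 (real (S n \<omega>) - (lam - 1) * real n - u)) \<le>
        ennreal (exp (- s * u) / s) * ennreal (exp (tilted s y n \<omega>)) + (\<Sum>l<n. ennreal (real (N l \<omega> - y)))"
    proof -
      have "AE \<omega> in M. \<forall>l<n. 1 \<le> N l \<omega> \<and> J l \<omega> < d"
        using AE_range by (simp add: AE_all_countable AE_finite_all)
      then show ?thesis
      proof eventually_elim
        case (elim \<omega>)
        define W where "W = (\<Sum>l<n. real (min (N l \<omega>) y) - lam) + h (J (n - 1) \<omega>)"
        define V where "V = (\<Sum>l<n. real (N l \<omega> - y))"
        have V: "0 \<le> V" by (simp add: V_def sum_nonneg)
        have "real (S n \<omega>) - (lam - 1) * real n = (\<Sum>l<n. real (N l \<omega>) - 1) - (\<Sum>l<n. lam - 1)"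
          using elim by (simp add: S_def of_nat_diff)
        also have "\<dots> = (\<Sum>l<n. (real (min (N l \<omega>) y) - lam) + real (N l \<omega> - y))"
          unfolding sum_subtractf[symmetric] by (intro sum.cong refl) (auto simp: min_def)
        also have "\<dots> \<le> W + V" using h(1)[of "J (n - 1) \<omega>"] by (simp add: W_def V_def sum.distrib)
        finally have "real (S n \<omega>) - (lam - 1) * real n - u \<le> (W - u) + V" by simp
        moreover have "W - u \<le> exp (s * (W - u)) / s"
        proof -
          have "s * (W - u) \<le> exp (s * (W - u))" using exp_ge_add_one_self[of "s * (W - u)"] by linarith
          then show ?thesis using s by (simp add: le_divide_eq mult.commute)
        qed
        moreover have "0 \<le> exp (s * (W - u)) / s" using s by simp
        ultimately have "max 0 (real (S n \<omega>) - (lam - 1) * real n - u) \<le> exp (s * (W - u)) / s + V"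
          using V by linarith
        also have "exp (s * (W - u)) / s = exp (- s * u) / s * exp (tilted s y n \<omega>)"
          by (simp add: tilted_def W_def exp_add[symmetric] algebra_simps)
        finally have "ennreal (max 0 (real (S n \<omega>) - (lam - 1) * real n - u)) \<le>
           ennreal (exp (- s * u) / s * exp (tilted s y n \<omega>) + V)" by (rule ennreal_leI)
        also have "\<dots> = ennreal (exp (- s * u) / s) * ennreal (exp (tilted s y n \<omega>)) + ennreal V"
          using s V by (simp add: ennreal_mult[symmetric])
        finally show ?case by (simp add: V_def sum_ennreal)
      qed
    qed
    have "(\<integral>\<^sup>+\<omega>. ennreal (max 0 (real (S n \<omega>) - (lam - 1) * real n - u)) \<partial>M) \<le>
       (\<integral>\<^sup>+\<omega>. ennreal (exp (- s * u) / s) * ennreal (exp (tilted s y n \<omega>)) + (\<Sum>l<n. ennreal (real (N l \<omega> - y))) \<partial>M)"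
      by (rule nn_integral_mono_AE[OF point])
    also have "\<dots> = ennreal (exp (- s * u) / s) * (\<integral>\<^sup>+\<omega>. ennreal (exp (tilted s y n \<omega>)) \<partial>M)
        + (\<Sum>l<n. \<integral>\<^sup>+\<omega>. ennreal (real (N l \<omega> - y)) \<partial>M)"
      by (simp add: nn_integral_add nn_integral_cmult nn_integral_sum del: sum_ennreal)
    also have "\<dots> \<le> ennreal (exp (- s * u) / s) * ennreal (initial_bound * (1 + curvature * s\<^sup>2) ^ m)
        + (\<Sum>l<n. ennreal (excess_const * exp (- \<eta> * real y powr \<theta>)))"
      unfolding m using s by (intro add_mono mult_left_mono sum_mono nn_integral_excess_le nn_integral_tilted_le sk) auto
    also have "\<dots> = ennreal (exp (- s * u) / s * (initial_bound * (1 + curvature * s\<^sup>2) ^ m)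
        + real n * (excess_const * exp (- \<eta> * real y powr \<theta>)))"
      using s curvature_nonneg initial_bound_nonneg excess_const_nonneg
      by (simp add: ennreal_mult[symmetric] sum_ennreal ennreal_of_nat_eq_real_of_nat ennreal_plus[symmetric] del: ennreal_plus)
    also have "\<dots> \<le> ennreal (C * (real y powr (1 - \<theta>) * exp (- \<kappa> * (real y powr (\<theta> - 1) * u)) + exp (- \<kappa> * real y powr \<theta>)))"
    proof (rule ennreal_leI)
      have "exp (- s * u) / s * (initial_bound * (1 + curvature * s\<^sup>2) ^ m) \<le> exp (- s * u) / s * (initial_bound * exp (curvature * \<eta>\<^sup>2))"
        using s growth initial_bound_nonneg by (intro mult_left_mono) auto
      also have "\<dots> = K1 * (real y powr (1 - \<theta>) * exp (- s * u))"
      proof -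
        have "real y powr (\<theta> - 1) = inverse (real y powr (1 - \<theta>))" using y1 by (simp add: powr_minus[symmetric])
        then show ?thesis using eta_pos y1 by (simp add: K1_def s_def field_simps)
      qed
      also have "\<dots> \<le> C * (real y powr (1 - \<theta>) * exp (- \<kappa> * (real y powr (\<theta> - 1) * u)))"
      proof (intro mult_mono C)
        have "\<kappa> * (real y powr (\<theta> - 1) * u) \<le> \<eta> * (real y powr (\<theta> - 1) * u)"
          using \<kappa> u by (intro mult_right_mono) auto
        then show "exp (- s * u) \<le> exp (- \<kappa> * (real y powr (\<theta> - 1) * u))" by (simp add: s_def mult.assoc)
      qed (use C in auto)
      finally have 1: "exp (- s * u) / s * (initial_bound * (1 + curvature * s\<^sup>2) ^ m) \<le>
         C * (real y powr (1 - \<theta>) * exp (- \<kappa> * (real y powr (\<theta> - 1) * u)))" .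
      have "real n \<le> real y" using y by simp
      also have "\<dots> \<le> (real y + 1)\<^sup>2" by (simp add: power2_eq_square algebra_simps)
      finally have "real n * (excess_const * exp (- \<eta> * real y powr \<theta>)) \<le> (real y + 1)\<^sup>2 * (excess_const * exp (- \<eta> * real y powr \<theta>))"
        using excess_const_nonneg by (intro mult_right_mono) auto
      also have "\<dots> = excess_const * ((real y + 1)\<^sup>2 * exp (- \<kappa> * real y powr \<theta>)) * exp (- \<kappa> * real y powr \<theta>)"
      proof -
        have "- \<eta> * real y powr \<theta> = - \<kappa> * real y powr \<theta> + - \<kappa> * real y powr \<theta>" by (simp add: \<kappa>_def)
        then have "exp (- \<eta> * real y powr \<theta>) = exp (- \<kappa> * real y powr \<theta>) * exp (- \<kappa> * real y powr \<theta>)"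
          by (simp only: exp_add)
        then show ?thesis by (simp only: mult_ac)
      qed
      also have "\<dots> \<le> excess_const * K3 * exp (- \<kappa> * real y powr \<theta>)"
        using excess_const_nonneg by (intro mult_right_mono mult_left_mono K3) auto
      also have "\<dots> \<le> C * exp (- \<kappa> * real y powr \<theta>)" by (intro mult_right_mono C) auto
      finally show "exp (- s * u) / s * (initial_bound * (1 + curvature * s\<^sup>2) ^ m) + real n * (excess_const * exp (- \<eta> * real y powr \<theta>))
        \<le> C * (real y powr (1 - \<theta>) * exp (- \<kappa> * (real y powr (\<theta> - 1) * u)) + exp (- \<kappa> * real y powr \<theta>))"
        using 1 by (simp add: distrib_left)
    qed
    finally show "(\<integral>\<^sup>+\<omega>. ennreal (max 0 (real (S n \<omega>) - (lam - 1) * real n - u)) \<partial>M) \<le>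
     ennreal (C * (real y powr (1 - \<theta>) * exp (- \<kappa> * (real y powr (\<theta> - 1) * u)) + exp (- \<kappa> * real y powr \<theta>)))" .
  qed
qed

section \<open>Means of the net input\<close>

lemma sum_ennreal_mult:
  assumes "\<And>j. j \<in> A \<Longrightarrow> 0 \<le> f j" "\<And>j. j \<in> A \<Longrightarrow> 0 \<le> g j"
  shows "(\<Sum>j\<in>A. ennreal (f j) * ennreal (g j)) = ennreal (\<Sum>j\<in>A. f j * g j)"
proof -
  have "(\<Sum>j\<in>A. ennreal (f j) * ennreal (g j)) = (\<Sum>j\<in>A. ennreal (f j * g j))"
    using assms by (intro sum.cong refl ennreal_mult[symmetric])
  also have "\<dots> = ennreal (\<Sum>j\<in>A. f j * g j)"
    using assms by (intro sum_ennreal mult_nonneg_nonneg)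
  finally show ?thesis .
qed

lemma integrable_N: "integrable M (\<lambda>\<omega>. real (N n \<omega>))"
proof (rule integrableI_nonneg)
  have "(\<integral>\<^sup>+\<omega>. ennreal (real (N n \<omega>)) \<partial>M) \<le> ennreal (real d * B * (\<Sum>k. (real k + 1)\<^sup>2 * exp (- b * real k powr \<theta>)))"
  proof (rule nn_integral_light_le[of "\<lambda>k j. real k"])
    show "real k \<le> (real k + 1)\<^sup>2" for k by (simp add: power2_eq_square algebra_simps)
    show "summable (\<lambda>k. (real k + 1)\<^sup>2 * exp (- b * real k powr \<theta>))"
      by (rule summable_stretched_exponential[OF b theta(1)])
  qed simp
  then show "(\<integral>\<^sup>+\<omega>. ennreal (real (N n \<omega>)) \<partial>M) < \<infinity>"
    by (rule order_le_less_trans) simp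
qed auto

lemma integrable_h: "integrable M (\<lambda>\<omega>. h (J n \<omega>))"
proof (rule integrable_const_bound[where B = hb])
  show "AE \<omega> in M. norm (h (J n \<omega>)) \<le> hb" using h by (intro AE_I2) simp
qed measurable

lemma integrable_S: "integrable M (\<lambda>\<omega>. real (S n \<omega>))"
proof (rule Bochner_Integration.integrable_bound)
  show "integrable M (\<lambda>\<omega>. \<Sum>l<n. real (N l \<omega>))" by (intro Bochner_Integration.integrable_sum integrable_N)
  show "AE \<omega> in M. norm (real (S n \<omega>)) \<le> norm (\<Sum>l<n. real (N l \<omega>))"
  proof (rule AE_I2)
    fix \<omega>
    have "real (S n \<omega>) \<le> (\<Sum>l<n. real (N l \<omega>))"
      unfolding S_def of_nat_sum by (intro sum_mono) simp
    then show "norm (real (S n \<omega>)) \<le> norm (\<Sum>l<n. real (N l \<omega>))" by (simp add: sum_nonneg)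
  qed
qed measurable

lemma expectation_S: "(\<integral>\<omega>. real (S n \<omega>) \<partial>M) = (\<Sum>l<n. (\<integral>\<omega>. real (N l \<omega>) \<partial>M) - 1)"
proof -
  have "(\<integral>\<omega>. real (S n \<omega>) \<partial>M) = (\<integral>\<omega>. (\<Sum>l<n. real (N l \<omega>) - 1) \<partial>M)"
  proof (rule integral_cong_AE)
    have "AE \<omega> in M. \<forall>l<n. 1 \<le> N l \<omega> \<and> J l \<omega> < d"
      using AE_range by (simp add: AE_all_countable)
    then show "AE \<omega> in M. real (S n \<omega>) = (\<Sum>l<n. real (N l \<omega>) - 1)"
      by eventually_elim (simp add: S_def of_nat_diff)
  qed measurable
  also have "\<dots> = (\<Sum>l<n. \<integral>\<omega>. real (N l \<omega>) - 1 \<partial>M)"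
    by (intro Bochner_Integration.integral_sum) (simp add: integrable_N)
  finally show ?thesis by (simp add: integrable_N prob_space)
qed

text \<open>The mean of the Poisson equation; the correction is a difference of consecutive values
  of the mean of \<open>h\<close>, so it telescopes in sums.\<close>

lemma expectation_N_Suc:
  "(\<integral>\<omega>. real (N (Suc n) \<omega>) \<partial>M) = lam + (\<integral>\<omega>. h (J n \<omega>) \<partial>M) - (\<integral>\<omega>. h (J (Suc n) \<omega>) \<partial>M)"
proof -
  define f where "f k j = ennreal (real k + h j)" for k j
  have step: "step f i = ennreal (lam + h i)" if "i < d" for i
  proof -
    have "step f i = (\<integral>\<^sup>+k. ennreal (\<Sum>j<d. \<Lambda> k i j * (real k + h j)) \<partial>count_space UNIV)"
      unfolding step_def f_def using Lambda_nonneg h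
      by (intro nn_integral_cong, subst sum_ennreal_mult) (auto simp: mult.commute)
    also have "\<dots> = ennreal (lam + h i)"
      using Lambda_nonneg h by (intro nn_integral_ennreal_count_space drift_sums that) (auto intro!: sum_nonneg)
    finally show ?thesis .
  qed
  have "(\<integral>\<^sup>+\<omega>. ennreal (real (N (Suc n) \<omega>) + h (J (Suc n) \<omega>)) \<partial>M) = (\<integral>\<^sup>+\<omega>. step f (J n \<omega>) \<partial>M)"
    using nn_integral_step1[of f n] by (simp add: f_def)
  also have "\<dots> = (\<integral>\<^sup>+\<omega>. ennreal (lam + h (J n \<omega>)) \<partial>M)"
    using AE_range[of n] by (intro nn_integral_cong_AE) (auto simp: step elim: eventually_mono)
  finally have "ennreal (\<integral>\<omega>. real (N (Suc n) \<omega>) + h (J (Suc n) \<omega>) \<partial>M) = ennreal (\<integral>\<omega>. lam + h (J n \<omega>) \<partial>M)"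
    using h lam integrable_N[of "Suc n"] integrable_h
    by (subst (asm) (1 2) nn_integral_eq_integral) auto
  moreover have "0 \<le> (\<integral>\<omega>. real (N (Suc n) \<omega>) + h (J (Suc n) \<omega>) \<partial>M)" "0 \<le> (\<integral>\<omega>. lam + h (J n \<omega>) \<partial>M)"
    using h lam by (auto intro!: integral_nonneg_AE)
  ultimately have "(\<integral>\<omega>. real (N (Suc n) \<omega>) + h (J (Suc n) \<omega>) \<partial>M) = (\<integral>\<omega>. lam + h (J n \<omega>) \<partial>M)"
    by (simp only: ennreal_inj)
  then show ?thesis using integrable_N integrable_h by (simp add: prob_space)
qed

text \<open>The first slot has an arbitrary law and contributes at least 0 instead of
  \<open>lam - 1\<close>; the telescoped \<open>h\<close> terms lose at most
  \<open>hb\<close>.\<close>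

lemma expectation_S_ge:
  assumes "1 \<le> n"
  shows "(lam - 1) * real n - (lam - 1 + hb) \<le> (\<integral>\<omega>. real (S n \<omega>) \<partial>M)"
proof -
  obtain m where m: "n = Suc m" using assms by (cases n) auto
  have tel: "(\<Sum>l<m. (\<integral>\<omega>. real (N (Suc l) \<omega>) \<partial>M) - 1) = (lam - 1) * real m + (\<integral>\<omega>. h (J 0 \<omega>) \<partial>M) - (\<integral>\<omega>. h (J m \<omega>) \<partial>M)" for m
    by (induction m) (simp_all add: expectation_N_Suc algebra_simps)
  have "(\<integral>\<omega>. h (J m \<omega>) \<partial>M) \<le> (\<integral>\<omega>. hb \<partial>M)"
    using h by (intro integral_mono integrable_h) auto
  then have 1: "(\<integral>\<omega>. h (J m \<omega>) \<partial>M) \<le> hb" by (simp add: prob_space)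
  have 2: "0 \<le> (\<integral>\<omega>. h (J 0 \<omega>) \<partial>M)" using h by (intro integral_nonneg_AE) auto
  have "(\<integral>\<omega>. 1 \<partial>M) \<le> (\<integral>\<omega>. real (N 0 \<omega>) \<partial>M)"
    using AE_range[of 0] by (intro integral_mono_AE integrable_N) (auto elim!: eventually_mono)
  then have 3: "1 \<le> (\<integral>\<omega>. real (N 0 \<omega>) \<partial>M)" by (simp add: prob_space)
  show ?thesis
    unfolding expectation_S m sum.lessThan_Suc_shift tel using 1 2 3 by (simp add: algebra_simps)
qed

lemma expectation_S_excess_ge:
  assumes "1 \<le> n"
  shows "max 0 ((lam - 1) * real n - (real x + (lam - 1 + hb))) \<le> (\<integral>\<omega>. real (S n \<omega> - x) \<partial>M)"
proof -
  have int: "integrable M (\<lambda>\<omega>. real (S n \<omega> - x))"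
    by (rule Bochner_Integration.integrable_bound[OF integrable_S[of n]]) auto
  have "(\<integral>\<omega>. real (S n \<omega>) - real x \<partial>M) \<le> (\<integral>\<omega>. real (S n \<omega> - x) \<partial>M)"
    by (intro integral_mono int) (auto simp: integrable_S)
  moreover have "(\<integral>\<omega>. real (S n \<omega>) - real x \<partial>M) = (\<integral>\<omega>. real (S n \<omega>) \<partial>M) - real x"
    by (simp add: integrable_S prob_space)
  moreover have "0 \<le> (\<integral>\<omega>. real (S n \<omega> - x) \<partial>M)" by simp
  ultimately show ?thesis using expectation_S_ge[OF assms] by linarith
qed

text \<open>\<open>deviation_bound\<close> in two regimes. If the mean input stays below
  \<open>x\<close>, the level is a multiple of \<open>x\<close> and \<open>u\<close> is the
  remaining distance; otherwise the level is \<open>n\<close> itself and \<open>u = 0\<close>, which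
  leaves a fluctuation term \<open>n powr (1 - \<theta>)\<close>.\<close>

lemma expectation_S_excess_le:
  "\<exists>C>0. \<exists>\<kappa>>0. \<forall>n x. 1 \<le> n \<longrightarrow>
     (1 \<le> x \<longrightarrow> (lam - 1) * real n \<le> real x \<longrightarrow>
       (\<integral>\<omega>. real (S n \<omega> - x) \<partial>M) \<le> C * (real x powr (1 - \<theta>) *
          exp (- \<kappa> * (real x powr \<theta> - ((lam - 1) * real n) powr \<theta>)) + exp (- \<kappa> * real x powr \<theta>))) \<and>
     (real x < (lam - 1) * real n \<longrightarrow>
       (\<integral>\<omega>. real (S n \<omega> - x) \<partial>M) \<le> ((lam - 1) * real n - real x) + C * real n powr (1 - \<theta>))"
proof -
  obtain C \<kappa> where C: "0 < C" and \<kappa>: "0 < \<kappa>" and dev: "\<And>n y u. 1 \<le> n \<Longrightarrow> n \<le> y \<Longrightarrow> 0 \<le> u \<Longrightarrow>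
     (\<integral>\<^sup>+\<omega>. ennreal (max 0 (real (S n \<omega>) - (lam - 1) * real n - u)) \<partial>M) \<le>
     ennreal (C * (real y powr (1 - \<theta>) * exp (- \<kappa> * (real y powr (\<theta> - 1) * u)) + exp (- \<kappa> * real y powr \<theta>)))"
    using deviation_bound by blast
  have int: "integrable M (\<lambda>\<omega>. max 0 (real (S n \<omega>) - (lam - 1) * real n - u))" for n u
    by (intro integrable_max Bochner_Integration.integrable_diff integrable_S) auto
  have dev': "(\<integral>\<omega>. max 0 (real (S n \<omega>) - (lam - 1) * real n - u) \<partial>M) \<le>
     C * (real y powr (1 - \<theta>) * exp (- \<kappa> * (real y powr (\<theta> - 1) * u)) + exp (- \<kappa> * real y powr \<theta>))"
    if "1 \<le> n" "n \<le> y" "0 \<le> u" for n y u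
  proof -
    have "ennreal (\<integral>\<omega>. max 0 (real (S n \<omega>) - (lam - 1) * real n - u) \<partial>M) \<le>
       ennreal (C * (real y powr (1 - \<theta>) * exp (- \<kappa> * (real y powr (\<theta> - 1) * u)) + exp (- \<kappa> * real y powr \<theta>)))"
      using dev[OF that] by (subst nn_integral_eq_integral[symmetric]) (auto intro: int)
    then show ?thesis using C by (subst (asm) ennreal_le_iff) (auto intro!: mult_nonneg_nonneg add_nonneg_nonneg)
  qed
  define \<mu> where "\<mu> = lam - 1"
  have \<mu>: "0 < \<mu>" using lam by (simp add: \<mu>_def)
  \<comment> \<open>An integer factor such that \<open>n \<le> q * x\<close> whenever
    \<open>(lam - 1) * n \<le> x\<close>. It changes the rate by
    \<open>q powr (\<theta> - 1)\<close> and the constant by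
    \<open>q powr (1 - \<theta>)\<close>.\<close>
  define q where "q = nat \<lceil>max 1 (1 / \<mu>)\<rceil>"
  have q: "1 \<le> real q" "1 / \<mu> \<le> real q" "1 \<le> q" unfolding q_def by linarith+
  define \<kappa>' where "\<kappa>' = \<kappa> * real q powr (\<theta> - 1)"
  have \<kappa>': "0 < \<kappa>'" "\<kappa>' \<le> \<kappa>"
  proof -
    show "0 < \<kappa>'" using \<kappa> q by (simp add: \<kappa>'_def)
    have "real q powr (\<theta> - 1) \<le> real q powr 0" using q theta by (intro powr_mono) auto
    then show "\<kappa>' \<le> \<kappa>" using \<kappa> q by (simp add: \<kappa>'_def mult_left_le)
  qed
  define C' where "C' = 2 * C * real q powr (1 - \<theta>)"
  have q1: "1 \<le> real q powr (1 - \<theta>)" using q theta by (intro ge_one_powr_ge_zero) auto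
  have C': "0 < C'" "C * real q powr (1 - \<theta>) \<le> C'" "C \<le> C * real q powr (1 - \<theta>)" "2 * C \<le> C'"
    using C q q1 by (auto simp: C'_def)
  show ?thesis
  proof (rule exI[of _ C'], intro conjI C'(1), rule exI[of _ \<kappa>'], intro conjI allI impI \<kappa>'(1))
    fix n x :: nat
    assume n: "1 \<le> n" and x: "1 \<le> x" and nx: "(lam - 1) * real n \<le> real x"
    define y where "y = q * x"
    have "real n \<le> 1 / \<mu> * real x" using nx \<mu> by (simp add: \<mu>_def field_simps)
    also have "\<dots> \<le> real q * real x" using q by (intro mult_right_mono) auto
    finally have y: "n \<le> y" unfolding y_def by (simp add: of_nat_mult[symmetric] del: of_nat_mult)
    define u where "u = real x - (lam - 1) * real n"
    have u: "0 \<le> u" using nx by (simp add: u_def)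
    have "(\<integral>\<omega>. real (S n \<omega> - x) \<partial>M) = (\<integral>\<omega>. max 0 (real (S n \<omega>) - (lam - 1) * real n - u) \<partial>M)"
      by (intro Bochner_Integration.integral_cong) (auto simp: u_def max_def)
    also have "\<dots> \<le> C * (real y powr (1 - \<theta>) * exp (- \<kappa> * (real y powr (\<theta> - 1) * u)) + exp (- \<kappa> * real y powr \<theta>))"
      by (rule dev'[OF n y u])
    also have "\<dots> \<le> C * (real q powr (1 - \<theta>) * (real x powr (1 - \<theta>) *
          exp (- \<kappa>' * (real x powr \<theta> - ((lam - 1) * real n) powr \<theta>))) + real q powr (1 - \<theta>) * exp (- \<kappa>' * real x powr \<theta>))"
    proof (intro mult_left_mono add_mono)
      \<comment> \<open>The chord inequality turns the linear cost into a difference of powers, the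
        form in which the tail of \<open>Ion\<close> can be compared.\<close>
      have "real x powr \<theta> - ((lam - 1) * real n) powr \<theta> \<le> real x powr (\<theta> - 1) * u"
        unfolding u_def using x nx lam theta by (intro powr_diff_le) auto
      then have "\<kappa>' * (real x powr \<theta> - ((lam - 1) * real n) powr \<theta>) \<le> \<kappa>' * (real x powr (\<theta> - 1) * u)"
        using \<kappa>' by (intro mult_left_mono) auto
      also have "\<dots> = \<kappa> * (real y powr (\<theta> - 1) * u)"
        by (simp add: \<kappa>'_def y_def powr_mult)
      finally have "exp (- \<kappa> * (real y powr (\<theta> - 1) * u)) \<le> exp (- \<kappa>' * (real x powr \<theta> - ((lam - 1) * real n) powr \<theta>))"
        by simp
      then have "real y powr (1 - \<theta>) * exp (- \<kappa> * (real y powr (\<theta> - 1) * u)) \<le>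
         real y powr (1 - \<theta>) * exp (- \<kappa>' * (real x powr \<theta> - ((lam - 1) * real n) powr \<theta>))"
        by (intro mult_left_mono) auto
      then show "real y powr (1 - \<theta>) * exp (- \<kappa> * (real y powr (\<theta> - 1) * u)) \<le>
         real q powr (1 - \<theta>) * (real x powr (1 - \<theta>) * exp (- \<kappa>' * (real x powr \<theta> - ((lam - 1) * real n) powr \<theta>)))"
        by (simp add: y_def powr_mult mult.assoc)
      have "real x powr \<theta> \<le> real y powr \<theta>"
        unfolding y_def using q x theta by (intro powr_mono2) auto
      then have "\<kappa>' * real x powr \<theta> \<le> \<kappa> * real y powr \<theta>"
        using \<kappa>' by (intro mult_mono) auto
      then have "exp (- \<kappa> * real y powr \<theta>) \<le> 1 * exp (- \<kappa>' * real x powr \<theta>)" by simp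
      also have "\<dots> \<le> real q powr (1 - \<theta>) * exp (- \<kappa>' * real x powr \<theta>)"
        by (intro mult_right_mono q1) auto
      finally show "exp (- \<kappa> * real y powr \<theta>) \<le> real q powr (1 - \<theta>) * exp (- \<kappa>' * real x powr \<theta>)" .
    qed (use C in auto)
    also have "\<dots> = (C * real q powr (1 - \<theta>)) * (real x powr (1 - \<theta>) *
          exp (- \<kappa>' * (real x powr \<theta> - ((lam - 1) * real n) powr \<theta>)) + exp (- \<kappa>' * real x powr \<theta>))"
      by (simp only: distrib_left mult_ac)
    also have "\<dots> \<le> C' * (real x powr (1 - \<theta>) *
          exp (- \<kappa>' * (real x powr \<theta> - ((lam - 1) * real n) powr \<theta>)) + exp (- \<kappa>' * real x powr \<theta>))"
      by (intro mult_right_mono C' add_nonneg_nonneg mult_nonneg_nonneg) auto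
    finally show "(\<integral>\<omega>. real (S n \<omega> - x) \<partial>M) \<le> C' * (real x powr (1 - \<theta>) *
          exp (- \<kappa>' * (real x powr \<theta> - ((lam - 1) * real n) powr \<theta>)) + exp (- \<kappa>' * real x powr \<theta>))" .
  next
    fix n x :: nat
    assume n: "1 \<le> n" and nx: "real x < (lam - 1) * real n"
    have "(\<integral>\<omega>. real (S n \<omega> - x) \<partial>M) \<le> (\<integral>\<omega>. ((lam - 1) * real n - real x) + max 0 (real (S n \<omega>) - (lam - 1) * real n - 0) \<partial>M)"
    proof (rule integral_mono)
      show "integrable M (\<lambda>\<omega>. real (S n \<omega> - x))"
        by (rule Bochner_Integration.integrable_bound[OF integrable_S[of n]]) auto
      show "integrable M (\<lambda>\<omega>. ((lam - 1) * real n - real x) + max 0 (real (S n \<omega>) - (lam - 1) * real n - 0))"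
        by (intro Bochner_Integration.integrable_add int) auto
      show "real (S n \<omega> - x) \<le> ((lam - 1) * real n - real x) + max 0 (real (S n \<omega>) - (lam - 1) * real n - 0)" for \<omega>
        using nx by linarith
    qed
    also have "\<dots> = ((lam - 1) * real n - real x) + (\<integral>\<omega>. max 0 (real (S n \<omega>) - (lam - 1) * real n - 0) \<partial>M)"
      using int[of n 0] by (simp add: prob_space)
    also have "(\<integral>\<omega>. max 0 (real (S n \<omega>) - (lam - 1) * real n - 0) \<partial>M) \<le>
       C * (real n powr (1 - \<theta>) * exp (- \<kappa> * (real n powr (\<theta> - 1) * 0)) + exp (- \<kappa> * real n powr \<theta>))"
      by (rule dev'[OF n order_refl order_refl])
    also have "\<dots> \<le> C * (real n powr (1 - \<theta>) + real n powr (1 - \<theta>))"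
    proof (intro mult_left_mono add_mono)
      have "exp (- \<kappa> * real n powr \<theta>) \<le> 1" using \<kappa> by simp
      also have "1 \<le> real n powr (1 - \<theta>)" using n theta by (intro ge_one_powr_ge_zero) auto
      finally show "exp (- \<kappa> * real n powr \<theta>) \<le> real n powr (1 - \<theta>)" .
    qed (use C in auto)
    also have "\<dots> = (2 * C) * real n powr (1 - \<theta>)" by simp
    also have "\<dots> \<le> C' * real n powr (1 - \<theta>)" by (intro mult_right_mono C') auto
    finally show "(\<integral>\<omega>. real (S n \<omega> - x) \<partial>M) \<le> ((lam - 1) * real n - real x) + C' * real n powr (1 - \<theta>)" by simp
  qed
qed

text \<open>The start law is one transition from \<phi>, and \<phi> is invariant, so every slot has
  the law of one transition from \<phi>; the mean batch is then the stationary rate in each slot.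
  The induction is over all test functions at once.\<close>

lemma expectation_S_stationary:
  assumes phi: "stationary_vec d (bmap_trans \<Lambda>) \<phi>" and rate: "bmap_rate d \<Lambda> \<phi> = lam"
    and start: "\<And>k j. 1 \<le> k \<Longrightarrow> j < d \<Longrightarrow> \<alpha> k j = (\<Sum>i<d. \<phi> i * \<Lambda> k i j)"
  shows "(\<integral>\<omega>. real (S n \<omega>) \<partial>M) = (lam - 1) * real n"
proof -
  have phi0: "0 \<le> \<phi> i" if "i < d" for i using phi that by (auto simp: stationary_vec_def)
  have alpha: "\<alpha> k j = (\<Sum>i<d. \<phi> i * \<Lambda> k i j)" if "j < d" for k j
    using that start[of k j] by (cases "k = 0") (auto simp: alpha_0 Lambda_0)
  have init: "initial f = (\<Sum>i<d. ennreal (\<phi> i) * step f i)" for f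
  proof -
    have "initial f = (\<integral>\<^sup>+k. (\<Sum>i<d. ennreal (\<phi> i) * (\<Sum>j<d. f k j * ennreal (\<Lambda> k i j))) \<partial>count_space UNIV)"
      unfolding initial_def
    proof (rule nn_integral_cong)
      fix k
      have "(\<Sum>j<d. f k j * ennreal (\<alpha> k j)) = (\<Sum>j<d. \<Sum>i<d. f k j * (ennreal (\<phi> i) * ennreal (\<Lambda> k i j)))"
        unfolding sum_distrib_left[symmetric]
        by (intro sum.cong refl, subst sum_ennreal_mult) (use phi0 Lambda_nonneg alpha in auto)
      also have "\<dots> = (\<Sum>i<d. ennreal (\<phi> i) * (\<Sum>j<d. f k j * ennreal (\<Lambda> k i j)))"
        unfolding sum_distrib_left by (subst sum.swap) (simp add: mult_ac)
      finally show "(\<Sum>j<d. f k j * ennreal (\<alpha> k j)) = (\<Sum>i<d. ennreal (\<phi> i) * (\<Sum>j<d. f k j * ennreal (\<Lambda> k i j)))" .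
    qed
    also have "\<dots> = (\<Sum>i<d. ennreal (\<phi> i) * step f i)"
      unfolding step_def by (subst nn_integral_sum) (simp_all add: nn_integral_cmult)
    finally show ?thesis .
  qed
  have step_const: "step (\<lambda>k j. g j) i = (\<Sum>j<d. g j * ennreal (bmap_trans \<Lambda> i j))" for g i
  proof -
    have "step (\<lambda>k j. g j) i = (\<Sum>j<d. g j * (\<integral>\<^sup>+k. ennreal (\<Lambda> k i j) \<partial>count_space UNIV))"
      unfolding step_def by (subst nn_integral_sum) (simp_all add: nn_integral_cmult)
    moreover have "(\<integral>\<^sup>+k. ennreal (\<Lambda> k i j) \<partial>count_space UNIV) = ennreal (bmap_trans \<Lambda> i j)" for j
      unfolding bmap_trans_def using params Lambda_nonneg
      by (intro nn_integral_ennreal_count_space summable_sums) (auto simp: bmap_params_def)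
    ultimately show ?thesis by simp
  qed
  have bt0: "0 \<le> bmap_trans \<Lambda> i j" for i j
    unfolding bmap_trans_def using params Lambda_nonneg by (intro suminf_nonneg) (auto simp: bmap_params_def)
  have inv: "(\<integral>\<^sup>+\<omega>. f (N n \<omega>) (J n \<omega>) \<partial>M) = (\<Sum>i<d. ennreal (\<phi> i) * step f i)" for n f
  proof (induction n arbitrary: f)
    case 0
    then show ?case by (simp add: nn_integral_initial init)
  next
    case (Suc n)
    have "(\<integral>\<^sup>+\<omega>. f (N (Suc n) \<omega>) (J (Suc n) \<omega>) \<partial>M) = (\<integral>\<^sup>+\<omega>. step f (J n \<omega>) \<partial>M)"
      by (rule nn_integral_step1)
    also have "\<dots> = (\<Sum>i<d. ennreal (\<phi> i) * step (\<lambda>k j. step f j) i)"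
      by (rule Suc.IH[of "\<lambda>k j. step f j"])
    also have "\<dots> = (\<Sum>j<d. (\<Sum>i<d. ennreal (\<phi> i) * ennreal (bmap_trans \<Lambda> i j)) * step f j)"
      unfolding step_const sum_distrib_left sum_distrib_right by (subst sum.swap) (simp add: mult_ac)
    also have "\<dots> = (\<Sum>j<d. ennreal (\<phi> j) * step f j)"
    proof (intro sum.cong refl arg_cong2[where f = "(*)"])
      fix j assume j: "j \<in> {..<d}"
      have "(\<Sum>i<d. ennreal (\<phi> i) * ennreal (bmap_trans \<Lambda> i j)) = ennreal (\<Sum>i<d. \<phi> i * bmap_trans \<Lambda> i j)"
        using phi0 bt0 by (intro sum_ennreal_mult) auto
      then show "(\<Sum>i<d. ennreal (\<phi> i) * ennreal (bmap_trans \<Lambda> i j)) = ennreal (\<phi> j)"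
        using phi j by (simp add: stationary_vec_def)
    qed
    finally show ?case .
  qed
  have EN: "(\<integral>\<omega>. real (N l \<omega>) \<partial>M) = lam" for l
  proof -
    define g where "g i = (\<Sum>j<d. \<Sum>k. real k * \<Lambda> k i j)" for i
    have g0: "0 \<le> g i" for i
      unfolding g_def using Lambda_nonneg summable_mean by (intro sum_nonneg suminf_nonneg) auto
    have st: "step (\<lambda>k j. ennreal (real k)) i = ennreal (g i)" for i
    proof -
      have "step (\<lambda>k j. ennreal (real k)) i = (\<integral>\<^sup>+k. ennreal (\<Sum>j<d. real k * \<Lambda> k i j) \<partial>count_space UNIV)"
        unfolding step_def using Lambda_nonneg
        by (intro nn_integral_cong sum_ennreal_mult) auto
      also have "\<dots> = ennreal (g i)"
        unfolding g_def using Lambda_nonneg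
        by (intro nn_integral_ennreal_count_space sums_sum summable_sums summable_mean) (auto intro!: sum_nonneg)
      finally show ?thesis .
    qed
    have "ennreal (\<integral>\<omega>. real (N l \<omega>) \<partial>M) = (\<integral>\<^sup>+\<omega>. ennreal (real (N l \<omega>)) \<partial>M)"
      by (rule nn_integral_eq_integral[symmetric]) (auto simp: integrable_N)
    also have "\<dots> = (\<Sum>i<d. ennreal (\<phi> i) * ennreal (g i))"
      using inv[of "\<lambda>k j. ennreal (real k)" l] by (simp add: st)
    also have "\<dots> = ennreal (\<Sum>i<d. \<phi> i * g i)"
      using phi0 g0 by (intro sum_ennreal_mult) auto
    also have "(\<Sum>i<d. \<phi> i * g i) = lam" using rate by (simp add: bmap_rate_def g_def)
    finally have "ennreal (\<integral>\<omega>. real (N l \<omega>) \<partial>M) = ennreal lam" .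
    moreover have "0 \<le> (\<integral>\<omega>. real (N l \<omega>) \<partial>M)" by simp
    ultimately show ?thesis using lam by simp
  qed
  show ?thesis unfolding expectation_S EN by (simp add: mult.commute)
qed

lemma random_sum_measurable:
  assumes "I \<in> measurable M (count_space UNIV)"
  shows "(\<lambda>\<omega>. S (I \<omega>) \<omega>) \<in> measurable M (count_space UNIV)"
  by (rule measurable_compose_countable[OF S_rv assms])

text \<open>Conditioning on \<open>I\<close> by summation over the joint values of \<open>I\<close>
  and \<open>S I\<close>: by independence the length can be frozen inside the inner
  integral.\<close>

lemma expectation_random_sum:
  assumes ind: "indep2 M (count_space UNIV) I (Pi\<^sub>M UNIV (\<lambda>_. count_space UNIV)) (\<lambda>\<omega> n. (N n \<omega>, J n \<omega>))"
  shows "(\<integral>\<omega>. real (S (I \<omega>) \<omega> - x) \<partial>M) = (\<integral>\<omega>. (\<integral>w. real (S (I \<omega>) w - x) \<partial>M) \<partial>M)"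
proof -
  have I[measurable]: "I \<in> measurable M (count_space UNIV)" using ind by (simp add: indep2_def)
  have SI[measurable]: "(\<lambda>\<omega>. S (I \<omega>) \<omega>) \<in> measurable M (count_space UNIV)" by (rule random_sum_measurable[OF I])
  let ?X = "\<lambda>\<omega>. (I \<omega>, S (I \<omega>) \<omega>)"
  have X: "?X \<in> measurable M (count_space UNIV)"
  proof -
    have "?X -` {z} \<inter> space M \<in> events" for z
    proof -
      have "?X -` {z} \<inter> space M = {\<omega> \<in> space M. I \<omega> = fst z \<and> S (I \<omega>) \<omega> = snd z}"
        by (auto simp: prod_eq_iff)
      also have "\<dots> \<in> events" by measurable
      finally show ?thesis .
    qed
    then show ?thesis by (subst measurable_count_space_eq2_countable) auto
  qed
  have prod: "emeasure M {\<omega> \<in> space M. ?X \<omega> = (n, s)} =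
     emeasure M {\<omega> \<in> space M. I \<omega> = n} * emeasure M {\<omega> \<in> space M. S n \<omega> = s}" for n s
  proof -
    \<comment> \<open>Independence concerns the whole sequence of batches and phases, so
      \<open>S n = s\<close> has to be written as a measurable set of sequences.\<close>
    let ?B = "{p. (\<Sum>l<n. fst (p l) - 1) = s} :: (nat \<Rightarrow> nat \<times> nat) set"
    have "(\<lambda>p. \<Sum>l<n. fst (p l) - 1) \<in> measurable (Pi\<^sub>M UNIV (\<lambda>_. count_space UNIV :: (nat \<times> nat) measure)) (count_space UNIV)"
    proof -
      have [measurable]: "(\<lambda>p. fst (p l) - 1) \<in> measurable (Pi\<^sub>M UNIV (\<lambda>_. count_space UNIV :: (nat \<times> nat) measure)) (count_space UNIV)" for l :: nat
        by (rule measurable_compose[OF measurable_component_singleton[of l]]) auto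
      show ?thesis by measurable
    qed
    from measurable_sets[OF this, of "{s}"] have "(\<lambda>p. \<Sum>l<n. fst (p l) - 1) -` {s} \<in> sets (Pi\<^sub>M UNIV (\<lambda>_. count_space UNIV :: (nat \<times> nat) measure))"
      by (simp add: space_PiM)
    then have B: "?B \<in> sets (Pi\<^sub>M UNIV (\<lambda>_. count_space UNIV))" by (simp add: vimage_def)
    have "measure M (I -` {n} \<inter> (\<lambda>\<omega> n. (N n \<omega>, J n \<omega>)) -` ?B \<inter> space M) =
      measure M (I -` {n} \<inter> space M) * measure M ((\<lambda>\<omega> n. (N n \<omega>, J n \<omega>)) -` ?B \<inter> space M)"
    proof -
      have "measure M (I -` A' \<inter> (\<lambda>\<omega> n. (N n \<omega>, J n \<omega>)) -` B' \<inter> space M) =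
        measure M (I -` A' \<inter> space M) * measure M ((\<lambda>\<omega> n. (N n \<omega>, J n \<omega>)) -` B' \<inter> space M)"
        if "A' \<in> sets (count_space UNIV)" "B' \<in> sets (Pi\<^sub>M UNIV (\<lambda>_. count_space UNIV))" for A' B'
        using ind that unfolding indep2_def by blast
      from this[OF _ B, of "{n}"] show ?thesis by simp
    qed
    moreover have "I -` {n} \<inter> (\<lambda>\<omega> n. (N n \<omega>, J n \<omega>)) -` ?B \<inter> space M = {\<omega> \<in> space M. ?X \<omega> = (n, s)}"
      by (auto simp: S_def)
    moreover have "I -` {n} \<inter> space M = {\<omega> \<in> space M. I \<omega> = n}" by auto
    moreover have "(\<lambda>\<omega> n. (N n \<omega>, J n \<omega>)) -` ?B \<inter> space M = {\<omega> \<in> space M. S n \<omega> = s}"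
      by (auto simp: S_def)
    ultimately show ?thesis by (simp only: emeasure_eq_measure ennreal_mult measure_nonneg)
  qed
  have "(\<integral>\<^sup>+\<omega>. ennreal (real (S (I \<omega>) \<omega> - x)) \<partial>M) =
     (\<integral>\<^sup>+z. ennreal (real (snd z - x)) * emeasure M {\<omega> \<in> space M. ?X \<omega> = z} \<partial>count_space UNIV)"
    using nn_integral_countable_rv[OF X, of "\<lambda>z. ennreal (real (snd z - x))"] by simp
  also have "\<dots> = (\<integral>\<^sup>+n. \<integral>\<^sup>+s. ennreal (real (s - x)) * emeasure M {\<omega> \<in> space M. ?X \<omega> = (n, s)} \<partial>count_space UNIV \<partial>count_space UNIV)"
    by (simp add: nn_integral_fst_count_space[symmetric])
  also have "\<dots> = (\<integral>\<^sup>+n. ennreal (\<integral>w. real (S n w - x) \<partial>M) * emeasure M {\<omega> \<in> space M. I \<omega> = n} \<partial>count_space UNIV)"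
  proof (rule nn_integral_cong)
    fix n
    have "(\<integral>\<^sup>+s. ennreal (real (s - x)) * emeasure M {\<omega> \<in> space M. ?X \<omega> = (n, s)} \<partial>count_space UNIV) =
      (\<integral>\<^sup>+s. emeasure M {\<omega> \<in> space M. I \<omega> = n} * (ennreal (real (s - x)) * emeasure M {\<omega> \<in> space M. S n \<omega> = s}) \<partial>count_space UNIV)"
      unfolding prod by (intro nn_integral_cong) (simp only: mult_ac)
    also have "\<dots> = emeasure M {\<omega> \<in> space M. I \<omega> = n} * (\<integral>\<^sup>+s. ennreal (real (s - x)) * emeasure M {\<omega> \<in> space M. S n \<omega> = s} \<partial>count_space UNIV)"
      by (rule nn_integral_cmult) simp
    also have "(\<integral>\<^sup>+s. ennreal (real (s - x)) * emeasure M {\<omega> \<in> space M. S n \<omega> = s} \<partial>count_space UNIV) =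
      (\<integral>\<^sup>+w. ennreal (real (S n w - x)) \<partial>M)"
      by (rule nn_integral_countable_rv[OF S_rv, symmetric])
    also have "\<dots> = ennreal (\<integral>w. real (S n w - x) \<partial>M)"
      by (rule nn_integral_eq_integral) (auto intro: Bochner_Integration.integrable_bound[OF integrable_S[of n]])
    finally show "(\<integral>\<^sup>+s. ennreal (real (s - x)) * emeasure M {\<omega> \<in> space M. ?X \<omega> = (n, s)} \<partial>count_space UNIV) =
      ennreal (\<integral>w. real (S n w - x) \<partial>M) * emeasure M {\<omega> \<in> space M. I \<omega> = n}"
      by (simp only: mult.commute)
  qed
  also have "\<dots> = (\<integral>\<^sup>+\<omega>. ennreal (\<integral>w. real (S (I \<omega>) w - x) \<partial>M) \<partial>M)"
    by (rule nn_integral_countable_rv[OF I, symmetric])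
  finally have eq: "(\<integral>\<^sup>+\<omega>. ennreal (real (S (I \<omega>) \<omega> - x)) \<partial>M) = (\<integral>\<^sup>+\<omega>. ennreal (\<integral>w. real (S (I \<omega>) w - x) \<partial>M) \<partial>M)" .
  have "(\<integral>\<omega>. real (S (I \<omega>) \<omega> - x) \<partial>M) = enn2real (\<integral>\<^sup>+\<omega>. ennreal (real (S (I \<omega>) \<omega> - x)) \<partial>M)"
    by (intro integral_eq_nn_integral) auto
  moreover have "(\<integral>\<omega>. (\<integral>w. real (S (I \<omega>) w - x) \<partial>M) \<partial>M) = enn2real (\<integral>\<^sup>+\<omega>. ennreal (\<integral>w. real (S (I \<omega>) w - x) \<partial>M) \<partial>M)"
  proof (intro integral_eq_nn_integral)
    show "(\<lambda>\<omega>. \<integral>w. real (S (I \<omega>) w - x) \<partial>M) \<in> borel_measurable M"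
      by (rule measurable_compose[OF I, of "\<lambda>n. \<integral>w. real (S n w - x) \<partial>M"]) simp
  qed auto
  ultimately show ?thesis using eq by simp
qed

end

section \<open>Asymptotics of the loss probability\<close>

text \<open>Markov's inequality for \<open>exp Q\<close>: a cumulative hazard function is
  nondecreasing, so the tail at \<open>k\<close> is at most a constant times
  \<open>exp (- Q k)\<close>, and \<open>Q\<close> dominates a multiple of
  \<open>x powr \<theta>\<close>.\<close>

lemma SC_stretched_tail:
  fixes FY :: "real measure"
  assumes FY: "prob_space FY" "sets FY = sets borel" and SC: "SC Q"
    and Q: "(\<lambda>x. x powr \<theta>) \<in> O(Q)" and exp: "(\<integral>\<^sup>+y. ennreal (exp (Q y)) \<partial>FY) < \<infinity>"
    and theta: "0 < \<theta>"
  shows "\<exists>C>0. \<exists>c>0. \<forall>k::nat. measure FY {real k<..} \<le> C * exp (- c * real k powr \<theta>)"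
proof -
  interpret FY: prob_space FY by fact
  obtain \<mu> :: "real measure" where \<mu>: "prob_space \<mu>" "sets \<mu> = sets borel" and Qdef: "\<And>x. Q x = - ln (measure \<mu> {x<..})"
    using SC unfolding SC_def by blast
  have lim: "filterlim (\<lambda>x. Q x / ln x) at_top at_top" using SC unfolding SC_def by blast
  interpret \<mu>: prob_space \<mu> by fact
  have anti: "measure \<mu> {y<..} \<le> measure \<mu> {x<..}" if "x \<le> y" for x y
    using that by (intro \<mu>.finite_measure_mono) (auto simp: \<mu>(2))
  \<comment> \<open>Because \<open>ln 0 = 0\<close>, a vanishing tail would make \<open>Q\<close>
    equal to 0 from there on, against the growth of \<open>Q x / ln x\<close>.\<close>
  have pos: "0 < measure \<mu> {x<..}" for x
  proof (rule ccontr)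
    assume "\<not> 0 < measure \<mu> {x<..}"
    then have "measure \<mu> {x<..} \<le> 0" by simp
    then have zero: "measure \<mu> {y<..} = 0" if "x \<le> y" for y
      using anti[OF that] measure_nonneg[of \<mu> "{y<..}"] by linarith
    have "\<forall>\<^sub>F y in at_top. 1 \<le> Q y / ln y" using lim by (simp add: filterlim_at_top)
    then obtain z where z: "\<And>y. z \<le> y \<Longrightarrow> 1 \<le> Q y / ln y" by (auto simp: eventually_at_top_linorder)
    show False using z[of "max x z"] zero[of "max x z"] by (simp add: Qdef)
  qed
  have mono: "Q x \<le> Q y" if "x \<le> y" for x y
    using anti[OF that] pos[of y] pos[of x] by (simp add: Qdef)
  have Q0: "0 \<le> Q x" for x using pos[of x] by (simp add: Qdef)
  obtain c where c: "0 < c" and "\<forall>\<^sub>F x in at_top. norm (x powr \<theta>) \<le> c * norm (Q x)"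
    using landau_o.bigE[OF Q] by blast
  then obtain X where X: "\<And>x. X \<le> x \<Longrightarrow> x powr \<theta> \<le> c * Q x"
    using Q0 by (auto simp: eventually_at_top_linorder)
  define D where "D = enn2real (\<integral>\<^sup>+y. ennreal (exp (Q y)) \<partial>FY)"
  have D: "(\<integral>\<^sup>+y. ennreal (exp (Q y)) \<partial>FY) = ennreal D" "0 \<le> D"
    using exp by (auto simp: D_def)
  have markov: "measure FY {real k<..} \<le> D * exp (- Q (real k))" for k
  proof -
    have "ennreal (exp (Q (real k))) * emeasure FY {real k<..} = (\<integral>\<^sup>+y. ennreal (exp (Q (real k))) * indicator {real k<..} y \<partial>FY)"
      by (simp add: nn_integral_cmult_indicator FY(2))
    also have "\<dots> \<le> (\<integral>\<^sup>+y. ennreal (exp (Q y)) \<partial>FY)"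
      by (intro nn_integral_mono) (auto simp: indicator_def intro!: ennreal_leI mono)
    finally have "ennreal (exp (Q (real k)) * measure FY {real k<..}) \<le> ennreal D"
      by (simp add: D(1) FY.emeasure_eq_measure ennreal_mult)
    then have "exp (Q (real k)) * measure FY {real k<..} \<le> D" using D(2) by simp
    then show ?thesis by (simp add: exp_minus field_simps)
  qed
  define C where "C = D + exp (max X 0 powr \<theta> / c)"
  show ?thesis
  proof (rule exI[of _ C], intro conjI, goal_cases)
    case 1
    then show ?case using D(2) by (simp add: C_def add_nonneg_pos)
  next
    case 2
    show ?case
    proof (rule exI[of _ "1 / c"], intro conjI allI)
      show "0 < 1 / c" using c by simp
      fix k :: nat
      show "measure FY {real k<..} \<le> C * exp (- (1 / c) * real k powr \<theta>)"
      proof (cases "X \<le> real k")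
        case True
        have "real k powr \<theta> / c \<le> Q (real k)" using X[OF True] c by (simp add: field_simps)
        then have "D * exp (- Q (real k)) \<le> C * exp (- (1 / c) * real k powr \<theta>)"
          using D(2) by (intro mult_mono) (auto simp: C_def)
        with markov[of k] show ?thesis by linarith
      next
        case False
        have "real k powr \<theta> \<le> max X 0 powr \<theta>" using False theta by (intro powr_mono2) auto
        then have "real k powr \<theta> / c \<le> max X 0 powr \<theta> / c" using c by (intro divide_right_mono) auto
        then have "1 \<le> exp (max X 0 powr \<theta> / c) * exp (- (1 / c) * real k powr \<theta>)"
          by (simp add: exp_add[symmetric])
        also have "\<dots> \<le> C * exp (- (1 / c) * real k powr \<theta>)"
          using D(2) by (intro mult_right_mono) (auto simp: C_def)
        finally show ?thesis using FY.prob_le_1[of "{real k<..}"] by linarith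
      qed
    qed
  qed
qed

text \<open>A term is at most the tail sum starting with it. The tail beyond \<open>k\<close> starts
  with the term \<open>Suc k\<close>, and since
  \<open>Suc k powr \<theta> \<le> k powr \<theta> + 1\<close> this shift costs a factor
  \<open>exp c\<close>. The finitely many other terms go into the constant.\<close>

lemma stretched_exponential_pointwise:
  fixes a T :: "nat \<Rightarrow> real"
  assumes a: "\<And>k. 0 \<le> a k" "summable a"
    and O: "(\<lambda>k. \<Sum>l. a (l + Suc k)) \<in> O(T)" and T: "\<And>k. 0 \<le> T k" "\<And>k. T k \<le> C * exp (- c * real k powr \<theta>)"
    and c: "0 < c" and theta: "0 < \<theta>" "\<theta> \<le> 1"
  shows "\<exists>B>0. \<forall>k. a k \<le> B * exp (- c * real k powr \<theta>)"
proof -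
  obtain m where m: "0 < m" and ev: "\<forall>\<^sub>F k in at_top. norm (\<Sum>l. a (l + Suc k)) \<le> m * norm (T k)"
    using landau_o.bigE[OF O] by blast
  have "\<forall>\<^sub>F k in at_top. (\<Sum>l. a (l + Suc k)) \<le> m * T k"
    by (rule eventually_mono[OF ev]) (use T(1) in \<open>simp add: abs_le_iff\<close>)
  then obtain K where K: "\<And>k. K \<le> k \<Longrightarrow> (\<Sum>l. a (l + Suc k)) \<le> m * T k"
    unfolding eventually_at_top_linorder by blast
  have C: "0 \<le> C" using T[of 0] by (simp add: zero_le_mult_iff)
  have big: "a (Suc k) \<le> (m * C * exp c) * exp (- c * real (Suc k) powr \<theta>)" if "K \<le> k" for k
  proof -
    have "summable (\<lambda>l. a (l + Suc k))" using a(2) by (rule summable_ignore_initial_segment)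
    from sum_le_suminf[OF this, of "{0}"] have "a (Suc k) \<le> (\<Sum>l. a (l + Suc k))" using a by simp
    also have "\<dots> \<le> m * (C * exp (- c * real k powr \<theta>))"
      using K[OF that] mult_left_mono[OF T(2)[of k], of m] m by linarith
    also have "m * (C * exp (- c * real k powr \<theta>)) \<le> m * (C * exp (c + - c * real (Suc k) powr \<theta>))"
    proof -
      have "real (Suc k) powr \<theta> - real k powr \<theta> \<le> real (Suc k) powr (\<theta> - 1) * (real (Suc k) - real k)"
        using theta by (intro powr_diff_le) auto
      also have "real (Suc k) - real k = 1" by simp
      also have "real (Suc k) powr (\<theta> - 1) \<le> real (Suc k) powr 0" using theta by (intro powr_mono) auto
      finally have "real (Suc k) powr \<theta> \<le> real k powr \<theta> + 1" by simp
      then have "c * real (Suc k) powr \<theta> \<le> c * (real k powr \<theta> + 1)" using c by (intro mult_left_mono) auto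
      then have "- c * real k powr \<theta> \<le> c + - c * real (Suc k) powr \<theta>" by (simp add: algebra_simps)
      then show ?thesis using m C by (intro mult_left_mono) auto
    qed
    finally show ?thesis by (simp only: exp_add mult_ac)
  qed
  define B where "B = m * C * exp c + (\<Sum>k\<le>K. a k / exp (- c * real k powr \<theta>)) + 1"
  have s0: "0 \<le> (\<Sum>k\<le>K. a k / exp (- c * real k powr \<theta>))" using a by (intro sum_nonneg) simp
  have m0: "0 \<le> m * C * exp c" using m C by simp
  have "a k \<le> B * exp (- c * real k powr \<theta>)" for k
  proof (cases "k \<le> K")
    case True
    then have "a k / exp (- c * real k powr \<theta>) \<le> (\<Sum>k\<le>K. a k / exp (- c * real k powr \<theta>))"
      using a by (intro member_le_sum[of k "{..K}" "\<lambda>k. a k / exp (- c * real k powr \<theta>)"]) auto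
    also have "\<dots> \<le> B" using m0 by (simp add: B_def)
    finally show ?thesis by (simp add: divide_le_eq)
  next
    case False
    then obtain k' where k': "k = Suc k'" "K \<le> k'" by (cases k) auto
    have "a k \<le> (m * C * exp c) * exp (- c * real k powr \<theta>)" using big[OF k'(2)] k'(1) by simp
    also have "\<dots> \<le> B * exp (- c * real k powr \<theta>)" using s0 by (intro mult_right_mono) (auto simp: B_def)
    finally show ?thesis .
  qed
  moreover have "0 < B" using s0 m0 by (simp add: B_def)
  ultimately show ?thesis by blast
qed

theorem theorem4p3:
  fixes M :: "'a measure"
    and d :: nat
    and \<alpha> :: "nat \<Rightarrow> nat \<Rightarrow> real"
    and \<Lambda> :: "nat \<Rightarrow> nat \<Rightarrow> nat \<Rightarrow> real"
    and \<phi> :: "nat \<Rightarrow> real"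
    and N J :: "nat \<Rightarrow> 'a \<Rightarrow> nat"
    and Ion Ioff :: "'a \<Rightarrow> nat"
    and FY :: "real measure"
    and Q :: "real \<Rightarrow> real"
    and \<theta> :: real
    and \<pi> :: "nat \<Rightarrow> nat \<Rightarrow> real"
  assumes M: "prob_space M"
    and params: "bmap_params d \<alpha> \<Lambda>"
    and irred: "irreducible_mat d (bmap_trans \<Lambda>)"
    and phi: "stationary_vec d (bmap_trans \<Lambda>) \<phi>"
    and rate_finite: "\<forall>i j. summable (\<lambda>k. real k * \<Lambda> k i j)"
    and lam: "bmap_rate d \<Lambda> \<phi> > 1"
    and bmap: "is_bmap M N J \<alpha> \<Lambda>"
    and Ion_rv: "Ion \<in> measurable M (count_space UNIV)"
    and Ion_pos: "\<forall>\<omega>\<in>space M. 1 \<le> Ion \<omega>"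
    and Ioff_rv: "Ioff \<in> measurable M (count_space UNIV)"
    and indep_on: "indep2 M (count_space UNIV) Ion
                     (Pi\<^sub>M UNIV (\<lambda>_. count_space UNIV)) (\<lambda>\<omega> n. (N n \<omega>, J n \<omega>))"
    and indep_off: "indep2 M (count_space UNIV) Ioff
                     (count_space UNIV \<Otimes>\<^sub>M Pi\<^sub>M UNIV (\<lambda>_. count_space UNIV))
                     (\<lambda>\<omega>. (Ion \<omega>, \<lambda>n. (N n \<omega>, J n \<omega>)))"
    and FY: "prob_space FY" "sets FY = sets borel" "measure FY {..<0} = 0"
    and Y_S: "subexponential FY"
    and alpha_tail: "\<forall>i<d. (\<lambda>k::nat. \<Sum>l. \<alpha> (l + Suc k) i) \<in> O(\<lambda>k. measure FY {real k<..})"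
    and Lambda_tail: "\<forall>i<d. \<forall>j<d.
                 (\<lambda>k::nat. \<Sum>l. \<Lambda> (l + Suc k) i j) \<in> O(\<lambda>k. measure FY {real k<..})"
    and mean_cond: "(\<integral>\<^sup>+\<omega>. of_nat (arrivals_excess Ion N \<omega>) \<partial>M) < (\<integral>\<^sup>+\<omega>. of_nat (Ioff \<omega>) \<partial>M)"
    and theta: "0 < \<theta>" "\<theta> \<le> 1/2"
    and cond_i: "in_L_pow M (\<lambda>\<omega>. real (Ion \<omega>)) (1 / \<theta>)"
    and cond_ii: "(\<integral>\<^sup>+\<omega>. of_nat (Ion \<omega>) \<partial>M) < \<infinity>"
                 "subexponential (equilibrium M (\<lambda>\<omega>. real (Ion \<omega>)))"
    and cond_iii: "SC Q" "(\<lambda>x. x powr \<theta>) \<in> O(Q)"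
                  "(\<integral>\<^sup>+y. ennreal (exp (Q y)) \<partial>FY) < \<infinity>"
    and stat: "\<forall>K. queue_stationary M (arrivals_excess Ion N) Ioff K (\<pi> K)"
  shows "(\<lambda>K. loss_prob M (arrivals_excess Ion N) Ion K (\<pi> K)) \<sim>[at_top]
           (\<lambda>K. (bmap_rate d \<Lambda> \<phi> - 1) * (\<integral>\<omega>. real (Ion \<omega>) \<partial>M)
                 / ((\<integral>\<omega>. real (arrivals_excess Ion N \<omega>) \<partial>M) + (\<integral>\<omega>. real (Ion \<omega>) \<partial>M))
                 * measure (equilibrium M (\<lambda>\<omega>. real (Ion \<omega>)))
                     {real K / (bmap_rate d \<Lambda> \<phi> - 1)<..})
       \<and> ((\<forall>k\<ge>1. \<forall>j<d. \<alpha> k j = (\<Sum>i<d. \<phi> i * \<Lambda> k i j)) \<longrightarrow>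
          (\<lambda>K. loss_prob M (arrivals_excess Ion N) Ion K (\<pi> K)) \<sim>[at_top]
           (\<lambda>K. (bmap_rate d \<Lambda> \<phi> - 1) / bmap_rate d \<Lambda> \<phi>
                 * measure (equilibrium M (\<lambda>\<omega>. real (Ion \<omega>)))
                     {real K / (bmap_rate d \<Lambda> \<phi> - 1)<..}))"
proof -
  interpret prob_space M by fact
  define lam where "lam = bmap_rate d \<Lambda> \<phi>"
  have lam1: "1 < lam" using lam by (simp add: lam_def)
  have d: "0 < d" and \<alpha>0: "\<And>k i. 0 \<le> \<alpha> k i" and \<Lambda>0: "\<And>k i j. 0 \<le> \<Lambda> k i j"
    and \<alpha>z: "\<And>k i. d \<le> i \<Longrightarrow> \<alpha> k i = 0" and \<Lambda>z: "\<And>k i j. d \<le> i \<or> d \<le> j \<Longrightarrow> \<Lambda> k i j = 0"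
    and \<alpha>s: "\<And>i. summable (\<lambda>k. \<alpha> k i)" and \<Lambda>s: "\<And>i j. summable (\<lambda>k. \<Lambda> k i j)"
    and \<Lambda>1: "\<And>i. i < d \<Longrightarrow> (\<Sum>j<d. \<Sum>k. \<Lambda> k i j) = 1"
    using params by (auto simp: bmap_params_def)

  obtain C0 b where C0: "0 < C0" and b: "0 < b" and FYtail: "\<And>k::nat. measure FY {real k<..} \<le> C0 * exp (- b * real k powr \<theta>)"
    using SC_stretched_tail[OF FY(1,2) cond_iii theta(1)] by blast
  have th1: "\<theta> \<le> 1" using theta by simp
  have "\<exists>B>0. \<forall>k. \<alpha> k i \<le> B * exp (- b * real k powr \<theta>)" if "i < d" for i
    using alpha_tail that
    by (intro stretched_exponential_pointwise[OF \<alpha>0 \<alpha>s _ measure_nonneg FYtail b theta(1) th1]) auto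
  then obtain B1 where B1: "\<And>i. i < d \<Longrightarrow> 0 < B1 i" "\<And>i k. i < d \<Longrightarrow> \<alpha> k i \<le> B1 i * exp (- b * real k powr \<theta>)"
    by metis
  have "\<exists>B>0. \<forall>k. \<Lambda> k i j \<le> B * exp (- b * real k powr \<theta>)" if "i < d" "j < d" for i j
    using Lambda_tail that
    by (intro stretched_exponential_pointwise[OF \<Lambda>0 \<Lambda>s _ measure_nonneg FYtail b theta(1) th1]) auto
  then obtain B2 where B2: "\<And>i j. i < d \<Longrightarrow> j < d \<Longrightarrow> 0 < B2 i j"
    "\<And>i j k. i < d \<Longrightarrow> j < d \<Longrightarrow> \<Lambda> k i j \<le> B2 i j * exp (- b * real k powr \<theta>)"
    by metis
  \<comment> \<open>All entries share the rate \<open>b\<close>, so one constant above all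
    individual ones serves every phase.\<close>
  define B where "B = 1 + (\<Sum>i<d. B1 i) + (\<Sum>i<d. \<Sum>j<d. B2 i j)"
  have s1: "0 \<le> (\<Sum>i<d. B1 i)" and s2: "0 \<le> (\<Sum>i<d. \<Sum>j<d. B2 i j)"
    using B1(1) B2(1) by (auto intro!: sum_nonneg intro: less_imp_le)
  have B: "0 < B" using s1 s2 by (simp add: B_def)
  have alpha_le: "\<alpha> k i \<le> B * exp (- b * real k powr \<theta>)" for k i
  proof (cases "i < d")
    case True
    have "B1 i \<le> (\<Sum>i<d. B1 i)" using True B1(1) by (intro member_le_sum) (auto intro: less_imp_le)
    then have "B1 i \<le> B" using s2 by (simp add: B_def)
    then show ?thesis using B1(2)[OF True, of k] by (meson exp_ge_zero mult_right_mono order_trans)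
  qed (use B \<alpha>z in auto)
  have Lambda_le: "\<Lambda> k i j \<le> B * exp (- b * real k powr \<theta>)" for k i j
  proof (cases "i < d \<and> j < d")
    case True
    have "B2 i j \<le> (\<Sum>j<d. B2 i j)" using True B2(1) by (intro member_le_sum) (auto intro: less_imp_le)
    also have "\<dots> \<le> (\<Sum>i<d. \<Sum>j<d. B2 i j)"
      using True B2(1) by (intro member_le_sum[of i "{..<d}" "\<lambda>i. \<Sum>j<d. B2 i j"]) (auto intro!: sum_nonneg intro: less_imp_le)
    finally have "B2 i j \<le> B" using s1 by (simp add: B_def)
    then show ?thesis using B2(2)[of i j k] True by (meson exp_ge_zero mult_right_mono order_trans)
  qed (use B \<Lambda>z in auto)

  have P0: "0 \<le> bmap_trans \<Lambda> i j" for i j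
    unfolding bmap_trans_def using \<Lambda>0 \<Lambda>s by (intro suminf_nonneg)
  have P1: "(\<Sum>j<d. bmap_trans \<Lambda> i j) = 1" if "i < d" for i
    unfolding bmap_trans_def by (rule \<Lambda>1[OF that])
  obtain h0 where h0: "\<And>i. 0 \<le> h0 i"
    "\<And>i. i < d \<Longrightarrow> (\<Sum>j<d. \<Sum>k. real k * \<Lambda> k i j) + (\<Sum>j<d. bmap_trans \<Lambda> i j * h0 j) = lam + h0 i"
    using poisson_equation[OF d P0 P1 irred phi, of "\<lambda>i. \<Sum>j<d. \<Sum>k. real k * \<Lambda> k i j"]
    unfolding lam_def bmap_rate_def by blast
  \<comment> \<open>Setting \<open>h\<close> to 0 outside the phases makes \<open>hb\<close> a bound
    at every natural number, and the Poisson equation does not see those values.\<close>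
  define h where "h i = (if i < d then h0 i else 0)" for i
  define hb where "hb = (\<Sum>i<d. h0 i)"
  have h_le: "h i \<le> hb" for i
    using h0(1) unfolding h_def hb_def by (auto intro!: member_le_sum sum_nonneg)
  interpret light_bmap M d \<alpha> \<Lambda> N J h lam hb B b \<theta>
  proof unfold_locales
    show "(\<Sum>j<d. \<Sum>k. real k * \<Lambda> k i j) + (\<Sum>j<d. bmap_trans \<Lambda> i j * h j) = lam + h i" if "i < d" for i
      using h0(2)[OF that] that by (simp add: h_def)
    show "0 \<le> h j" for j using h0(1) by (simp add: h_def)
  qed (use params bmap Lambda_le alpha_le B b theta lam1 h_le in auto)

  define A where "A = arrivals_excess Ion N"
  have A_S: "A \<omega> = S (Ion \<omega>) \<omega>" for \<omega> by (simp add: A_def arrivals_excess_def S_def)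
  have A_rv: "A \<in> measurable M (count_space UNIV)"
    using random_sum_measurable[OF Ion_rv] by (simp add: A_S[abs_def])
  have int_Ion: "integrable M (\<lambda>\<omega>. real (Ion \<omega>))"
    using cond_ii(1) Ion_rv by (intro integrableI_nonneg) (auto simp: ennreal_of_nat_eq_real_of_nat)
  define \<mu> where "\<mu> = lam - 1"
  have mu: "0 < \<mu>" using lam1 by (simp add: \<mu>_def)
  interpret P: insensitive_period M Ion \<theta> \<mu>
  proof unfold_locales
    show "long_tailed (\<lambda>x. prob {\<omega> \<in> space M. x < real (Ion \<omega>) powr \<theta>})"
      using cond_i by (simp add: in_L_pow_def)
  qed (use Ion_rv Ion_pos int_Ion theta mu in auto)

  interpret Fq: finite_queue M A Ioff \<pi>
  proof unfold_locales
    show "(\<integral>\<^sup>+\<omega>. of_nat (A \<omega>) \<partial>M) < (\<integral>\<^sup>+\<omega>. of_nat (Ioff \<omega>) \<partial>M)" using mean_cond by (simp add: A_def)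
    show "queue_stationary M A Ioff K (\<pi> K)" for K using stat by (simp add: A_def)
  qed (use A_rv Ioff_rv in auto)

  define e where "e n x = (\<integral>\<omega>. real (S n \<omega> - x) \<partial>M)" for n x
  have H_e: "Fq.H x = (\<integral>\<omega>. e (Ion \<omega>) x \<partial>M)" for x
    unfolding Fq.H_def A_S e_def by (rule expectation_random_sum[OF indep_on])
  obtain C \<kappa> where C: "0 < C" and \<kappa>: "0 < \<kappa>" and
    light: "\<And>n x. 1 \<le> n \<Longrightarrow> 1 \<le> x \<Longrightarrow> (lam - 1) * real n \<le> real x \<Longrightarrow>
       e n x \<le> C * (real x powr (1 - \<theta>) * exp (- \<kappa> * (real x powr \<theta> - ((lam - 1) * real n) powr \<theta>)) + exp (- \<kappa> * real x powr \<theta>))" and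
    heavy: "\<And>n x. 1 \<le> n \<Longrightarrow> real x < (lam - 1) * real n \<Longrightarrow> e n x \<le> ((lam - 1) * real n - real x) + C * real n powr (1 - \<theta>)"
    using expectation_S_excess_le unfolding e_def by blast
  have H_excess: "(\<lambda>x. Fq.H x / P.excess x) \<longlonglongrightarrow> 1"
    unfolding H_e
  \<comment> \<open>The shift \<open>\<mu> + hb\<close> is the defect of the mean of
    \<open>S n\<close> from \<open>\<mu> * n\<close>.\<close>
  proof (rule P.integrated_tail_asymptotics[where c = "\<mu> + hb", OF _ _ C \<kappa>])
    show "max 0 (\<mu> * real n - (real x + (\<mu> + hb))) \<le> e n x" if "1 \<le> n" for n x
      using expectation_S_excess_ge[OF that, of x] by (simp add: e_def \<mu>_def)
    show "0 \<le> \<mu> + hb" using mu hb by simp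
  qed (use light heavy in \<open>auto simp: \<mu>_def\<close>)

  define m where "m = (\<integral>\<omega>. real (Ion \<omega>) \<partial>M)"
  have m: "1 \<le> m"
  proof -
    have "(\<integral>\<omega>. 1 \<partial>M) \<le> m" unfolding m_def
      using Ion_pos by (intro integral_mono int_Ion) auto
    then show ?thesis by (simp add: prob_space)
  qed
  define E where "E = equilibrium M (\<lambda>\<omega>. real (Ion \<omega>))"
  have E: "sets E = sets borel" "prob_space E" "measure E {..<0} = 0"
    and E_tail: "\<And>x. 0 \<le> x \<Longrightarrow> measure E {x<..} = (\<integral>\<omega>. max 0 (real (Ion \<omega>) - x) \<partial>M) / m"
    unfolding E_def m_def
    by (rule equilibrium_properties[OF int_Ion]; use m in \<open>simp add: m_def\<close>)+
  have excess_E: "P.excess x = \<mu> * m * measure E {x / \<mu><..}" if "0 \<le> x" for x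
  proof -
    have "P.excess x = (\<integral>\<omega>. \<mu> * max 0 (real (Ion \<omega>) - x / \<mu>) \<partial>M)"
      unfolding P.excess_def using mu by (intro Bochner_Integration.integral_cong) (auto simp: max_def field_simps)
    then show ?thesis using m that mu by (simp add: E_tail)
  qed
  define G where "G x = P.excess (real x)" for x :: nat
  have G_pos: "0 < G x" for x by (simp add: G_def P.excess_pos)
  have G_anti: "antimono G" unfolding G_def by (intro antimonoI P.excess_antimono) simp
  have G_long: "(\<lambda>x. G (Suc x) / G x) \<longlonglongrightarrow> 1"
    using P.excess_shift_ratio[of 1] by (simp add: G_def add.commute)
  \<comment> \<open>Unit steps of the queue length are steps of size \<open>1 / \<mu>\<close> in the
    length of an on-period, hence the mesh \<open>1 / \<mu>\<close>. Since \<open>G\<close> is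
    \<open>\<mu> * m\<close> times the equilibrium tail, the convolution scales with the square of
    this factor, and \<open>\<epsilon>\<close> is divided by it once.\<close>
  have G_sub: "\<exists>c N. \<forall>K\<ge>N. (\<Sum>t\<in>{c..K-c}. G (K - t) * (G t - G (Suc t))) \<le> \<epsilon> * G K" if \<epsilon>: "0 < \<epsilon>" for \<epsilon>
  proof -
    have "0 < \<epsilon> / (\<mu> * m)" using \<epsilon> mu m by simp
    then have "\<exists>c::nat. \<exists>N. \<forall>K\<ge>N. (\<Sum>t\<in>{c..K-c}. measure E {real (K - t) * (1 / \<mu>)<..} *
     (measure E {real t * (1 / \<mu>)<..} - measure E {real (Suc t) * (1 / \<mu>)<..})) \<le> \<epsilon> / (\<mu> * m) * measure E {real K * (1 / \<mu>)<..}"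
      using mu by (intro subexponential_both_large E cond_ii(2)[folded E_def]) simp
    then obtain c N0 where N0: "\<And>K. N0 \<le> K \<Longrightarrow> (\<Sum>t\<in>{c..K-c}. measure E {real (K - t) * (1 / \<mu>)<..} *
     (measure E {real t * (1 / \<mu>)<..} - measure E {real (Suc t) * (1 / \<mu>)<..})) \<le> \<epsilon> / (\<mu> * m) * measure E {real K * (1 / \<mu>)<..}"
      by blast
    have alg: "(k * x) * (k * y - k * z) = k\<^sup>2 * (x * (y - z))" for k x y z :: real
      by (simp add: power2_eq_square algebra_simps)
    have G_E: "G t = \<mu> * m * measure E {real t * (1 / \<mu>)<..}" for t
      unfolding G_def by (simp add: excess_E)
    show ?thesis
    proof (intro exI allI impI)
      fix K assume K: "N0 \<le> K"
      have "(\<Sum>t\<in>{c..K-c}. G (K - t) * (G t - G (Suc t))) =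
        (\<mu> * m)\<^sup>2 * (\<Sum>t\<in>{c..K-c}. measure E {real (K - t) * (1 / \<mu>)<..} *
     (measure E {real t * (1 / \<mu>)<..} - measure E {real (Suc t) * (1 / \<mu>)<..}))"
        unfolding G_E sum_distrib_left by (intro sum.cong refl alg)
      also have "\<dots> \<le> (\<mu> * m)\<^sup>2 * (\<epsilon> / (\<mu> * m) * measure E {real K * (1 / \<mu>)<..})"
        by (intro mult_left_mono N0 K) simp
      also have "\<dots> = \<epsilon> * G K" unfolding G_E using mu m by (simp add: power2_eq_square)
      finally show "(\<Sum>t\<in>{c..K-c}. G (K - t) * (G t - G (Suc t))) \<le> \<epsilon> * G K" .
    qed
  qed
  have H_G: "(\<lambda>x. Fq.H x / G x) \<longlonglongrightarrow> 1" using H_excess by (simp add: G_def)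
  \<comment> \<open>The ratio to \<open>G\<close> is eventually positive, and \<open>H\<close> is
    nonincreasing, so positivity far out carries over to every \<open>x\<close>.\<close>
  have H_pos: "0 < Fq.H x" for x
  proof -
    have "\<forall>\<^sub>F y in sequentially. 0 < Fq.H y / G y" using order_tendstoD(1)[OF H_G, of 0] by simp
    then obtain y0 where "\<And>y. y0 \<le> y \<Longrightarrow> 0 < Fq.H y / G y"
      unfolding eventually_sequentially by blast
    from this[of "max x y0"] obtain y where "x \<le> y" "0 < Fq.H y / G y"
      by (meson max.cobounded1 max.cobounded2)
    then have "0 < Fq.H y" using G_pos[of y] by (simp add: zero_less_divide_iff)
    then show ?thesis using antimonoD[OF Fq.antimono_H \<open>x \<le> y\<close>] by linarith
  qed
  interpret Sq: subexponential_queue M A Ioff \<pi>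
  proof unfold_locales
    show "0 < Fq.H x" for x by (rule H_pos)
    show "(\<lambda>x. Fq.H (Suc x) / Fq.H x) \<longlonglongrightarrow> 1"
      by (rule long_tail_ratio_transfer[OF G_pos H_pos H_G G_long])
    show "\<exists>c N. \<forall>K\<ge>N. (\<Sum>t\<in>{c..K-c}. Fq.H t * (Fq.H (K - t) - Fq.H (Suc (K - t)))) \<le> \<epsilon> * Fq.H K" if "0 < \<epsilon>" for \<epsilon>
      by (rule subexponential_convolution_transfer[OF G_pos G_anti H_pos Fq.antimono_H Fq.H_tendsto_0 H_G G_long G_sub that])
  qed

  define a where "a = (\<integral>\<omega>. real (A \<omega>) \<partial>M)"
  have a: "0 \<le> a" by (simp add: a_def)
  have loss: "loss_prob M A Ion K (\<pi> K) = (\<Sum>l\<le>K. \<pi> K l * Fq.H (K - l)) / (a + m)" for K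
  proof -
    have "(\<integral>\<omega>. real (A \<omega> + Ion \<omega>) \<partial>M) = a + m"
      using Fq.integrable_A int_Ion by (simp add: a_def m_def)
    \<comment> \<open>For \<open>l \<le> K\<close> the overflow from state \<open>l\<close> is the
      excess of \<open>A\<close> over the free space \<open>K - l\<close>.\<close>
    moreover have "(\<integral>\<omega>. real (l + A \<omega> - K) \<partial>M) = Fq.H (K - l)" if "l \<le> K" for l
    proof -
      have "l + A \<omega> - K = A \<omega> - (K - l)" for \<omega> using that by linarith
      then show ?thesis by (simp add: Fq.H_def)
    qed
    ultimately show ?thesis unfolding loss_prob_def by simp
  qed
  have main: "(\<lambda>K. loss_prob M A Ion K (\<pi> K)) \<sim>[at_top] (\<lambda>K. \<mu> * m / (a + m) * measure E {real K / \<mu><..})"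
  proof (rule asymp_equivI')
    have "(\<lambda>K. ((\<Sum>l\<le>K. \<pi> K l * Fq.H (K - l)) / Fq.H K) * (Fq.H K / G K)) \<longlonglongrightarrow> 1 * 1"
      by (intro tendsto_mult Sq.queue_loss_asymptotics H_G)
    moreover have "((\<Sum>l\<le>K. \<pi> K l * Fq.H (K - l)) / Fq.H K) * (Fq.H K / G K) =
       loss_prob M A Ion K (\<pi> K) / (\<mu> * m / (a + m) * measure E {real K / \<mu><..})" for K
    proof -
      have "G K = \<mu> * m * measure E {real K / \<mu><..}" by (simp add: G_def excess_E)
      then have G: "\<mu> * m / (a + m) * measure E {real K / \<mu><..} = G K / (a + m)" by simp
      show ?thesis unfolding loss G using H_pos[of K] a m by simp
    qed
    ultimately show "(\<lambda>K. loss_prob M A Ion K (\<pi> K) / (\<mu> * m / (a + m) * measure E {real K / \<mu><..})) \<longlonglongrightarrow> 1"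
      by simp
  qed
  \<comment> \<open>From a stationary start a period of length \<open>n\<close> has mean input
    exactly \<open>\<mu> * n\<close>, so \<open>a = \<mu> * m\<close> and the denominator becomes
    \<open>lam * m\<close>.\<close>
  have stationary: "\<mu> * m / (a + m) = \<mu> / lam"
    if start: "\<forall>k\<ge>1. \<forall>j<d. \<alpha> k j = (\<Sum>i<d. \<phi> i * \<Lambda> k i j)"
  proof -
    have "e n 0 = \<mu> * real n" for n
      unfolding e_def \<mu>_def using expectation_S_stationary[OF phi, of n] start by (simp add: lam_def)
    then have "Fq.H 0 = \<mu> * m" unfolding H_e m_def using int_Ion by simp
    then have "a = \<mu> * m" by (simp add: Fq.H_def a_def)
    then have "a + m = lam * m" by (simp add: \<mu>_def algebra_simps)
    then show ?thesis using m by simp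
  qed
  have "(\<lambda>K. loss_prob M A Ion K (\<pi> K)) \<sim>[at_top] (\<lambda>K. \<mu> / lam * measure E {real K / \<mu><..})"
    if "\<forall>k\<ge>1. \<forall>j<d. \<alpha> k j = (\<Sum>i<d. \<phi> i * \<Lambda> k i j)"
    using main unfolding stationary[OF that] .
  with main show ?thesis
    unfolding A_def[symmetric] lam_def[symmetric] \<mu>_def[symmetric] E_def[symmetric] a_def[symmetric] m_def[symmetric]
    by blast
qed

end
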